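(* Let $G$ be a locally compact group and let $H$ be a discrete subgroup of $G$. If $E$ is a Leinert set in $H$, then the closed ideal $I_G(E)\subseteq A(G)$ has a Banach space complement in $A(G)$, i.e. there exists a bounded linear map $P$ from $A(G)$ onto $I_G(E)$ with $P^2=P$.
   Context: For a locally compact group $G$ with left Haar measure, $\lambda$ denotes the left regular representation on $L^2(G)$, $\lambda(x)f(y)=f(x^{-1}y)$. The Fourier algebra is $A(G)=\{x\mapsto \langle\lambda(x)f\,|\,g\rangle : f,g\in L^2(G)\}$, a Banach algebra under pointwise operations, with the norm of the predual of the group von Neumann algebra $VN(G)=\overline{\mathrm{span}\{\lambda(x):x\in G\}}^{WOT}\subseteq\mathcal B(L^2(G))$, the duality satisfying $\langle u,\lambda(x)\rangle=u(x)$. For closed $E\subseteq G$, $I_G(E)=\{u\in A(G): u(x)=0 \text{ for all } x\in E\}$, and the restriction algebra is $A_G(E)=\{u|_E: u\in A(G)\}$, identified with $A(G)/I_G(E)$ and given the quotient norm. If $H$ is a discrete group, a subset $E\subseteq H$ is a Leinert set (in $H$) if $A_H(E)\cong \ell^2(E)$ isomorphically as Banach algebras, where $\ell^2(E)$ is a Banach algebra under pointwise multiplication. *)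

theory Defs
  imports "HOL-Analysis.Analysis" "HOL-Algebra.Coset"
begin

section \<open>Locally compact groups and Haar measure\<close>

locale locally_compact_group = group G for G (structure) +
  fixes T :: "'a topology"
  assumes topspace_eq: "topspace T = carrier G"
    and continuous_mult: "continuous_map (prod_topology T T) T (\<lambda>(x, y). x \<otimes> y)"
    and continuous_inv: "continuous_map T T (\<lambda>x. inv x)"
    and Hausdorff: "Hausdorff_space T"
    and locally_compact: "locally_compact_space T"

text \<open>A nonzero left-invariant Radon measure on the Borel sets: finite on compact sets, outer
  regular on Borel sets and inner regular on open sets. The group is not assumed to be
  sigma-compact.\<close>

definition left_haar_measure :: "('a, 'm) monoid_scheme \<Rightarrow> 'a topology \<Rightarrow> 'a measure \<Rightarrow> bool" where
  "left_haar_measure G T M \<longleftrightarrow>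
     space M = topspace T \<and>
     sets M = sigma_sets (topspace T) {U. openin T U} \<and>
     emeasure M (space M) \<noteq> 0 \<and>
     (\<forall>x\<in>carrier G. \<forall>A\<in>sets M. emeasure M (x <#\<^bsub>G\<^esub> A) = emeasure M A) \<and>
     (\<forall>K. compactin T K \<longrightarrow> emeasure M K < \<infinity>) \<and>
     (\<forall>A\<in>sets M. emeasure M A = (INF U\<in>{U. openin T U \<and> A \<subseteq> U}. emeasure M U)) \<and>
     (\<forall>U. openin T U \<longrightarrow> emeasure M U = (SUP K\<in>{K. compactin T K \<and> K \<subseteq> U}. emeasure M K))"

definition discrete_subgroup :: "('a, 'm) monoid_scheme \<Rightarrow> 'a topology \<Rightarrow> 'a set \<Rightarrow> bool" where
  "discrete_subgroup G T H \<longleftrightarrow> subgroup H G \<and> subtopology T H = discrete_topology H"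


section \<open>The Hilbert space of square integrable functions and its operators\<close>

text \<open>Elements of \<open>L\<^sup>2\<close> are represented by square integrable functions, so equality in
  \<open>L\<^sup>2\<close> is equality almost everywhere. The inner product is linear in the first argument.\<close>

definition L2_fun :: "'a measure \<Rightarrow> ('a \<Rightarrow> complex) set" where
  "L2_fun M = {f \<in> borel_measurable M. integrable M (\<lambda>x. (cmod (f x))\<^sup>2)}"

definition L2_inner :: "'a measure \<Rightarrow> ('a \<Rightarrow> complex) \<Rightarrow> ('a \<Rightarrow> complex) \<Rightarrow> complex" where
  "L2_inner M f g = (\<integral>x. f x * cnj (g x) \<partial>M)"

definition L2_norm :: "'a measure \<Rightarrow> ('a \<Rightarrow> complex) \<Rightarrow> real" where
  "L2_norm M f = sqrt (\<integral>x. (cmod (f x))\<^sup>2 \<partial>M)"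

text \<open>Bounded operators on \<open>L\<^sup>2\<close>, acting on representatives. Linearity almost everywhere
  together with boundedness makes such a map compatible with equality almost everywhere.\<close>

definition L2_operators :: "'a measure \<Rightarrow> (('a \<Rightarrow> complex) \<Rightarrow> 'a \<Rightarrow> complex) set" where
  "L2_operators M = {A.
     (\<forall>f\<in>L2_fun M. A f \<in> L2_fun M) \<and>
     (\<forall>f\<in>L2_fun M. \<forall>g\<in>L2_fun M. \<forall>a b.
        AE x in M. A (\<lambda>y. a * f y + b * g y) x = a * A f x + b * A g x) \<and>
     (\<exists>C. \<forall>f\<in>L2_fun M. L2_norm M (A f) \<le> C * L2_norm M f)}"

definition L2_opnorm :: "'a measure \<Rightarrow> (('a \<Rightarrow> complex) \<Rightarrow> 'a \<Rightarrow> complex) \<Rightarrow> real" where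
  "L2_opnorm M A = Inf {C. 0 \<le> C \<and> (\<forall>f\<in>L2_fun M. L2_norm M (A f) \<le> C * L2_norm M f)}"

text \<open>The weak operator topology is the initial topology for the maps
  \<open>A \<mapsto> \<langle>A f | g\<rangle>\<close>. The \<open>restrict\<close> is only there because the points of a product
  topology are extensional functions.\<close>

definition L2_wot :: "'a measure \<Rightarrow> (('a \<Rightarrow> complex) \<Rightarrow> 'a \<Rightarrow> complex) topology" where
  "L2_wot M = pullback_topology (L2_operators M)
     (\<lambda>A. restrict (\<lambda>(f, g). L2_inner M (A f) g) (L2_fun M \<times> L2_fun M))
     (product_topology (\<lambda>_. euclidean) (L2_fun M \<times> L2_fun M))"


section \<open>The group von Neumann algebra and the Fourier algebra\<close>

definition left_regular ::
    "('a, 'm) monoid_scheme \<Rightarrow> 'a \<Rightarrow> ('a \<Rightarrow> complex) \<Rightarrow> 'a \<Rightarrow> complex" where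
  "left_regular G x f = (\<lambda>y. f (inv\<^bsub>G\<^esub> x \<otimes>\<^bsub>G\<^esub> y))"

definition left_regular_span ::
    "('a, 'm) monoid_scheme \<Rightarrow> (('a \<Rightarrow> complex) \<Rightarrow> 'a \<Rightarrow> complex) set" where
  "left_regular_span G =
     {(\<lambda>f y. \<Sum>x\<in>F. c x * left_regular G x f y) | F c. finite F \<and> F \<subseteq> carrier G}"

definition group_vN_algebra ::
    "('a, 'm) monoid_scheme \<Rightarrow> 'a measure \<Rightarrow> (('a \<Rightarrow> complex) \<Rightarrow> 'a \<Rightarrow> complex) set" where
  "group_vN_algebra G M = L2_wot M closure_of left_regular_span G"

text \<open>Functions on a subset of the type (the group, or a subset of it) are extended by \<open>0\<close>, so
  that equality and the pointwise operations are those of the type \<open>'a \<Rightarrow> complex\<close>.\<close>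

definition zero_extension :: "'a set \<Rightarrow> ('a \<Rightarrow> complex) \<Rightarrow> 'a \<Rightarrow> complex" where
  "zero_extension E u = (\<lambda>x. if x \<in> E then u x else 0)"

definition matrix_coefficient ::
    "('a, 'm) monoid_scheme \<Rightarrow> 'a measure \<Rightarrow> ('a \<Rightarrow> complex) \<Rightarrow> ('a \<Rightarrow> complex) \<Rightarrow> 'a \<Rightarrow> complex" where
  "matrix_coefficient G M f g =
     zero_extension (carrier G) (\<lambda>x. L2_inner M (left_regular G x f) g)"

definition fourier_algebra ::
    "('a, 'm) monoid_scheme \<Rightarrow> 'a measure \<Rightarrow> ('a \<Rightarrow> complex) set" where
  "fourier_algebra G M = {matrix_coefficient G M f g | f g. f \<in> L2_fun M \<and> g \<in> L2_fun M}"

text \<open>The duality between the Fourier algebra and the group von Neumann algebra: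
  \<open>\<langle>u, A\<rangle> = \<langle>A f | g\<rangle>\<close> whenever \<open>u(x) = \<langle>\<lambda>(x) f | g\<rangle>\<close>. The value does not depend
  on \<open>f\<close> and \<open>g\<close>: this is clear for \<open>A\<close> in the span of the \<open>\<lambda>(x)\<close>, and it passes to
  weak operator limits.\<close>

definition fourier_pairing ::
    "('a, 'm) monoid_scheme \<Rightarrow> 'a measure \<Rightarrow> ('a \<Rightarrow> complex) \<Rightarrow>
     (('a \<Rightarrow> complex) \<Rightarrow> 'a \<Rightarrow> complex) \<Rightarrow> complex" where
  "fourier_pairing G M u A =
     (THE c. \<exists>f\<in>L2_fun M. \<exists>g\<in>L2_fun M.
        u = matrix_coefficient G M f g \<and> c = L2_inner M (A f) g)"

definition fourier_norm :: "('a, 'm) monoid_scheme \<Rightarrow> 'a measure \<Rightarrow> ('a \<Rightarrow> complex) \<Rightarrow> real" where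
  "fourier_norm G M u =
     Sup {cmod (fourier_pairing G M u A) | A. A \<in> group_vN_algebra G M \<and> L2_opnorm M A \<le> 1}"

definition vanishing_ideal ::
    "('a, 'm) monoid_scheme \<Rightarrow> 'a measure \<Rightarrow> 'a set \<Rightarrow> ('a \<Rightarrow> complex) set" where
  "vanishing_ideal G M E = {u \<in> fourier_algebra G M. \<forall>x\<in>E. u x = 0}"

definition restriction_algebra ::
    "('a, 'm) monoid_scheme \<Rightarrow> 'a measure \<Rightarrow> 'a set \<Rightarrow> ('a \<Rightarrow> complex) set" where
  "restriction_algebra G M E = zero_extension E ` fourier_algebra G M"

text \<open>The \<open>u\<close> below form the coset of \<open>vanishing_ideal G M E\<close> that corresponds to \<open>v\<close>, so this
  is the quotient norm.\<close>

definition restriction_norm ::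
    "('a, 'm) monoid_scheme \<Rightarrow> 'a measure \<Rightarrow> 'a set \<Rightarrow> ('a \<Rightarrow> complex) \<Rightarrow> real" where
  "restriction_norm G M E v =
     Inf {fourier_norm G M u | u. u \<in> fourier_algebra G M \<and> zero_extension E u = v}"


section \<open>Maps between normed spaces of functions\<close>

definition bounded_clinear_between ::
    "('a \<Rightarrow> complex) set \<Rightarrow> (('a \<Rightarrow> complex) \<Rightarrow> real) \<Rightarrow>
     ('b \<Rightarrow> complex) set \<Rightarrow> (('b \<Rightarrow> complex) \<Rightarrow> real) \<Rightarrow>
     (('a \<Rightarrow> complex) \<Rightarrow> 'b \<Rightarrow> complex) \<Rightarrow> bool" where
  "bounded_clinear_between V nV W nW P \<longleftrightarrow>
     (\<forall>u\<in>V. P u \<in> W) \<and>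
     (\<forall>u\<in>V. \<forall>v\<in>V. \<forall>a b. P (\<lambda>x. a * u x + b * v x) = (\<lambda>x. a * P u x + b * P v x)) \<and>
     (\<exists>C. \<forall>u\<in>V. nW (P u) \<le> C * nV u)"

definition banach_algebra_isomorphic ::
    "('a \<Rightarrow> complex) set \<Rightarrow> (('a \<Rightarrow> complex) \<Rightarrow> real) \<Rightarrow>
     ('b \<Rightarrow> complex) set \<Rightarrow> (('b \<Rightarrow> complex) \<Rightarrow> real) \<Rightarrow> bool" where
  "banach_algebra_isomorphic V nV W nW \<longleftrightarrow>
     (\<exists>\<Phi>. bij_betw \<Phi> V W \<and>
        bounded_clinear_between V nV W nW \<Phi> \<and>
        bounded_clinear_between W nW V nV (inv_into V \<Phi>) \<and>
        (\<forall>u\<in>V. \<forall>v\<in>V. \<Phi> (\<lambda>x. u x * v x) = (\<lambda>x. \<Phi> u x * \<Phi> v x)))"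


section \<open>Leinert sets\<close>

definition ell2 :: "'a set \<Rightarrow> ('a \<Rightarrow> complex) set" where
  "ell2 E = {v. (\<forall>x. x \<notin> E \<longrightarrow> v x = 0) \<and> (\<lambda>x. (cmod (v x))\<^sup>2) summable_on E}"

definition ell2_norm :: "'a set \<Rightarrow> ('a \<Rightarrow> complex) \<Rightarrow> real" where
  "ell2_norm E v = sqrt (\<Sum>\<^sub>\<infinity>x\<in>E. (cmod (v x))\<^sup>2)"

text \<open>The Fourier algebra of a discrete group is formed with the counting measure.\<close>

lemma count_space_left_haar_measure:
  assumes "group H"
  shows "left_haar_measure H (discrete_topology (carrier H)) (count_space (carrier H))"
proof -
  interpret group H by fact
  have sets: "sigma_sets (carrier H) {U. U \<subseteq> carrier H} = Pow (carrier H)"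
    using sigma_algebra.sigma_sets_eq[OF sigma_algebra_Pow, of "carrier H"] by (simp add: Pow_def)
  have ne: "emeasure (count_space (carrier H)) (carrier H) \<noteq> 0"
    using one_closed by (auto simp: emeasure_count_space_eq_0)
  have inv: "emeasure (count_space (carrier H)) (x <#\<^bsub>H\<^esub> A) = emeasure (count_space (carrier H)) A"
    if x: "x \<in> carrier H" and A: "A \<subseteq> carrier H" for x A
  proof -
    have im: "x <#\<^bsub>H\<^esub> A = (\<lambda>a. x \<otimes>\<^bsub>H\<^esub> a) ` A"
      by (auto simp: l_coset_def)
    have inj: "inj_on (\<lambda>a. x \<otimes>\<^bsub>H\<^esub> a) A"
      using x A by (intro inj_onI) (use Units_l_cancel[of x] in \<open>simp add: subset_iff\<close>)
    have "(\<lambda>a. x \<otimes>\<^bsub>H\<^esub> a) ` A \<subseteq> carrier H"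
      using x A by auto
    then show ?thesis
      using A by (simp add: im emeasure_count_space card_image[OF inj] finite_image_iff[OF inj])
  qed
  have outer: "emeasure (count_space (carrier H)) A =
      (INF U\<in>{U. U \<subseteq> carrier H \<and> A \<subseteq> U}. emeasure (count_space (carrier H)) U)"
    if A: "A \<subseteq> carrier H" for A
    using A by (intro antisym INF_greatest INF_lower emeasure_mono) auto
  have inner: "emeasure (count_space (carrier H)) U =
      (SUP K\<in>{K. (K \<subseteq> carrier H \<and> finite K) \<and> K \<subseteq> U}. emeasure (count_space (carrier H)) K)"
    if U: "U \<subseteq> carrier H" for U
  proof (cases "finite U")
    case True
    then show ?thesis
      using U by (intro antisym SUP_upper SUP_least emeasure_mono) auto
  next
    case False
    have "(SUP K\<in>{K. (K \<subseteq> carrier H \<and> finite K) \<and> K \<subseteq> U}.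
        emeasure (count_space (carrier H)) K) = \<infinity>" (is "?S = _")
    proof (rule ccontr)
      assume fin: "?S \<noteq> \<infinity>"
      have "?S < \<infinity>"
        using fin unfolding infinity_ennreal_def top.not_eq_extremum .
      then obtain n :: nat where n: "?S < of_nat n"
        using ennreal_Ex_less_of_nat unfolding infinity_ennreal_def by blast
      obtain K where K: "K \<subseteq> U" "finite K" "card K = n"
        using infinite_arbitrarily_large[OF False] by blast
      have "emeasure (count_space (carrier H)) K \<le> ?S"
        using K U by (intro SUP_upper) auto
      moreover have "emeasure (count_space (carrier H)) K = of_nat n"
        using K U by simp
      ultimately show False
        using n by (metis leD)
    qed
    then show ?thesis
      using emeasure_count_space_infinite[OF U False] by (rule trans[OF _ sym, rotated])
  qed
  have compact: "emeasure (count_space (carrier H)) K < \<infinity>" if "K \<subseteq> carrier H" "finite K" for K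
    using that by (simp add: of_nat_less_top)
  show ?thesis
    unfolding left_haar_measure_def compactin_discrete_topology openin_discrete_topology
      topspace_discrete_topology space_count_space sets_count_space sets
  proof (intro conjI ballI allI impI)
    fix x A
    assume "x \<in> carrier H" "A \<in> Pow (carrier H)"
    then show "emeasure (count_space (carrier H)) (x <#\<^bsub>H\<^esub> A) = emeasure (count_space (carrier H)) A"
      by (intro inv) auto
  next
    fix A
    assume "A \<in> Pow (carrier H)"
    then show "emeasure (count_space (carrier H)) A =
        (INF U\<in>{U. U \<subseteq> carrier H \<and> A \<subseteq> U}. emeasure (count_space (carrier H)) U)"
      by (intro outer) auto
  next
    fix U
    assume "U \<subseteq> carrier H"
    then show "emeasure (count_space (carrier H)) U =
        (SUP K\<in>{K. (K \<subseteq> carrier H \<and> finite K) \<and> K \<subseteq> U}. emeasure (count_space (carrier H)) K)"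
      by (rule inner)
  qed (use ne compact in simp_all)
qed

definition leinert_set :: "('a, 'm) monoid_scheme \<Rightarrow> 'a set \<Rightarrow> bool" where
  "leinert_set H E \<longleftrightarrow>
     E \<subseteq> carrier H \<and>
     banach_algebra_isomorphic
       (restriction_algebra H (count_space (carrier H)) E)
       (restriction_norm H (count_space (carrier H)) E)
       (ell2 E) (ell2_norm E)"

end

theory Submission
  imports Defs "HOL-Library.Function_Algebras" "HOL-Algebra.Generated_Groups"
begin

text \<open>The Leinert property says that restriction to \<open>E\<close> maps \<open>A(H)\<close> boundedly into
  \<open>\<ell>\<^sup>2(E)\<close>, equivalently that \<open>\<parallel>\<Sum> c\<^sub>x \<lambda>(x)\<parallel> \<le> C \<parallel>c\<parallel>\<^sub>2\<close> on \<open>L\<^sup>2(H)\<close> for \<open>c\<close> supported on \<open>E\<close>.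
  Integrating over representatives of the cosets of \<open>H\<close> carries this operator bound over to \<open>L\<^sup>2(G)\<close>, and by duality
  restriction to \<open>E\<close> maps \<open>A(G)\<close> boundedly into \<open>\<ell>\<^sup>2(E)\<close>. If \<open>U\<close> is an open relatively compact set whose translates by
  \<open>H\<close> are disjoint, then \<open>S v = \<langle>\<lambda>(\<cdot>) 1\<^sub>U | \<Sum> cnj v\<^sub>h 1\<^sub>h\<^sub>U\<rangle> / \<mu>(U)\<close> is a bounded linear extension operator from
  \<open>\<ell>\<^sup>2(E)\<close> to \<open>A(G)\<close>, and \<open>P u = u - S (u|E)\<close> is the projection.

  Since \<open>A(G)\<close> consists of single matrix coefficients, \<open>P u \<in> A(G)\<close> is Eymard's theorem that sums of
  coefficients are coefficients. It is enough to dominate two vectors by one: if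
  \<open>\<parallel>A f\<parallel> + \<parallel>A k\<parallel> \<le> C \<parallel>A h\<parallel>\<close> for all \<open>A\<close> in the span of the translations, the Riesz theorem represents
  \<open>A \<mapsto> \<langle>A f|g\<rangle> + \<langle>A k|w\<rangle>\<close> as \<open>\<langle>A h|\<eta>\<rangle>\<close>. The vector \<open>h\<close> comes from the polar decomposition of a closed
  operator that intertwines \<open>\<ell>\<^sup>2 \<otimes> L\<^sup>2(G)\<close> with \<open>L\<^sup>2(G)\<close>.\<close>

section \<open>Complete semi-inner product spaces\<close>

text \<open>Addition of coefficients is the obstacle: a sum is a priori a coefficient of a multiple
  of \<lambda>, and an intertwiner down to one copy has to be found. The natural map t, sending
  \<xi> to x \<mapsto> \<langle>\<xi> | \<lambda>(x) \<Psi>\<rangle>, is unbounded in general. The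
  projection onto its graph trades it for bounded operators: its off-diagonal corners are Y = t (1 +
  t*t)^(-1) and the adjoint X, they commute with translations, and Y (X Y)^(-1/2) = t (t*t)^(-1/2)
  is the partial isometry sought. It is needed on a single vector, so the square root is summed as a
  series there, without functional calculus.

  Vectors are functions rather than classes of functions, hence the semi-inner products; identities
  between operators hold up to vectors of norm zero. Neither \<sigma>-compactness of G nor
  countability of H is available, and Haar measure may fail to be \<sigma>-finite: Fubini is
  replaced by countable sums, vectors are approximated by compactly supported ones, and only
  countably many elements of H are used at a time.\<close>

locale semi_hilbert =
  fixes V :: "'v::ab_group_add set"
    and sc :: "complex \<Rightarrow> 'v \<Rightarrow> 'v"
    and ip :: "'v \<Rightarrow> 'v \<Rightarrow> complex"
  assumes zero_mem: "0 \<in> V"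
    and add_mem: "x \<in> V \<Longrightarrow> y \<in> V \<Longrightarrow> x + y \<in> V"
    and sc_mem: "x \<in> V \<Longrightarrow> sc a x \<in> V"
    and sc_neg: "sc (-1) x = - x"
    and ip_add: "x \<in> V \<Longrightarrow> y \<in> V \<Longrightarrow> z \<in> V \<Longrightarrow> ip (x + y) z = ip x z + ip y z"
    and ip_sc: "x \<in> V \<Longrightarrow> z \<in> V \<Longrightarrow> ip (sc a x) z = a * ip x z"
    and ip_cnj: "x \<in> V \<Longrightarrow> y \<in> V \<Longrightarrow> ip y x = cnj (ip x y)"
    and ip_nonneg: "x \<in> V \<Longrightarrow> 0 \<le> Re (ip x x)"
    and complete: "(\<And>n. X n \<in> V) \<Longrightarrow>
      (\<And>e. e > 0 \<Longrightarrow> \<exists>N. \<forall>m\<ge>N. \<forall>n\<ge>N. Re (ip (X m - X n) (X m - X n)) < e) \<Longrightarrow>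
      \<exists>x\<in>V. (\<lambda>n. Re (ip (X n - x) (X n - x))) \<longlonglongrightarrow> 0"
begin

definition nrm :: "'v \<Rightarrow> real" where
  "nrm x = sqrt (Re (ip x x))"

lemma neg_mem: "x \<in> V \<Longrightarrow> - x \<in> V"
  using sc_mem[of x "-1"] by (simp add: sc_neg)

lemma diff_mem: "x \<in> V \<Longrightarrow> y \<in> V \<Longrightarrow> x - y \<in> V"
  using add_mem[of x "-y"] neg_mem[of y] by simp

lemma sum_mem: "(\<And>i. i \<in> I \<Longrightarrow> f i \<in> V) \<Longrightarrow> sum f I \<in> V"
  by (induction I rule: infinite_finite_induct) (auto intro: zero_mem add_mem)

lemma ip_zero: "z \<in> V \<Longrightarrow> ip 0 z = 0"
  using ip_add[of 0 0 z] zero_mem by simp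

lemma ip_neg: "x \<in> V \<Longrightarrow> z \<in> V \<Longrightarrow> ip (- x) z = - ip x z"
  using ip_sc[of x z "-1"] by (simp add: sc_neg)

lemma ip_diff: "x \<in> V \<Longrightarrow> y \<in> V \<Longrightarrow> z \<in> V \<Longrightarrow> ip (x - y) z = ip x z - ip y z"
  using ip_add[of x "-y" z] by (simp add: ip_neg neg_mem)

lemma ip_sum: "(\<And>i. i \<in> I \<Longrightarrow> f i \<in> V) \<Longrightarrow> z \<in> V \<Longrightarrow> ip (sum f I) z = (\<Sum>i\<in>I. ip (f i) z)"
  by (induction I rule: infinite_finite_induct) (auto simp: ip_zero ip_add sum_mem)

lemma ip_zero2: "z \<in> V \<Longrightarrow> ip z 0 = 0"
  using ip_cnj[of 0 z] ip_zero[of z] zero_mem by simp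

lemma ip_add2: "x \<in> V \<Longrightarrow> y \<in> V \<Longrightarrow> z \<in> V \<Longrightarrow> ip z (x + y) = ip z x + ip z y"
  using ip_cnj[of "x + y" z] ip_cnj[of x z] ip_cnj[of y z] by (simp add: ip_add add_mem)

lemma ip_sc2: "x \<in> V \<Longrightarrow> z \<in> V \<Longrightarrow> ip z (sc a x) = cnj a * ip z x"
  using ip_cnj[of "sc a x" z] ip_cnj[of x z] by (simp add: ip_sc sc_mem)

lemma ip_diff2: "x \<in> V \<Longrightarrow> y \<in> V \<Longrightarrow> z \<in> V \<Longrightarrow> ip z (x - y) = ip z x - ip z y"
  using ip_cnj[of "x - y" z] ip_cnj[of x z] ip_cnj[of y z] by (simp add: ip_diff diff_mem)

lemma ip_sum2: "(\<And>i. i \<in> I \<Longrightarrow> f i \<in> V) \<Longrightarrow> z \<in> V \<Longrightarrow> ip z (sum f I) = (\<Sum>i\<in>I. ip z (f i))"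
  using ip_cnj[of "sum f I" z] by (simp add: ip_sum sum_mem, intro sum.cong refl, metis ip_cnj)

lemma nrm_nonneg [simp]: "x \<in> V \<Longrightarrow> 0 \<le> nrm x"
  by (simp add: nrm_def ip_nonneg)

lemma nrm_sq: "x \<in> V \<Longrightarrow> (nrm x)\<^sup>2 = Re (ip x x)"
  by (simp add: nrm_def ip_nonneg)

lemma ip_self: "x \<in> V \<Longrightarrow> ip x x = complex_of_real ((nrm x)\<^sup>2)"
  using ip_cnj[of x x] by (auto simp: nrm_sq complex_eq_iff)

lemma nrm_sc: "x \<in> V \<Longrightarrow> nrm (sc a x) = cmod a * nrm x"
proof -
  assume x: "x \<in> V"
  have "ip (sc a x) (sc a x) = a * cnj a * ip x x"
    by (simp add: ip_sc ip_sc2 sc_mem x)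
  then have "(nrm (sc a x))\<^sup>2 = (cmod a * nrm x)\<^sup>2"
    using x by (simp add: ip_self sc_mem complex_norm_square[symmetric] power_mult_distrib
        del: of_real_power of_real_mult) (metis of_real_mult of_real_eq_iff)
  then show ?thesis
    using x by (simp add: power2_eq_iff_nonneg sc_mem)
qed

lemma nrm_neg: "x \<in> V \<Longrightarrow> nrm (- x) = nrm x"
  using nrm_sc[of x "-1"] by (simp add: sc_neg)

lemma nrm_diff_commute: "x \<in> V \<Longrightarrow> y \<in> V \<Longrightarrow> nrm (x - y) = nrm (y - x)"
  using nrm_neg[of "x - y"] by (simp add: diff_mem)

lemma nrm_add_sq: "x \<in> V \<Longrightarrow> y \<in> V \<Longrightarrow> (nrm (x + y))\<^sup>2 = (nrm x)\<^sup>2 + 2 * Re (ip x y) + (nrm y)\<^sup>2"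
  using ip_cnj[of x y] by (simp add: nrm_sq ip_add ip_add2 add_mem)

lemma nrm_diff_sq: "x \<in> V \<Longrightarrow> y \<in> V \<Longrightarrow> (nrm (x - y))\<^sup>2 = (nrm x)\<^sup>2 - 2 * Re (ip x y) + (nrm y)\<^sup>2"
  using ip_cnj[of x y] by (simp add: nrm_sq ip_diff ip_diff2 diff_mem)

text \<open>Nonnegativity of the norm of t x - \<langle>x, y\<rangle> y, where the factor
  \<langle>x, y\<rangle> makes the cross term real. A nonzero vector can have norm zero, so the case
  \<open>nrm x = 0\<close> is separate: there the quadratic in t is affine and, being nonnegative
  for all t, constant.\<close>

lemma Cauchy_Schwarz:
  assumes x: "x \<in> V" and y: "y \<in> V"
  shows "cmod (ip x y) \<le> nrm x * nrm y"
proof -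
  have quad: "0 \<le> t\<^sup>2 * (nrm x)\<^sup>2 - 2 * t * (cmod (ip x y))\<^sup>2 + (cmod (ip x y))\<^sup>2 * (nrm y)\<^sup>2" for t :: real
  proof -
    have "0 \<le> (nrm (sc (of_real t) x - sc (ip x y) y))\<^sup>2" by simp
    also have "\<dots> = (nrm (sc (of_real t) x))\<^sup>2 - 2 * Re (ip (sc (of_real t) x) (sc (ip x y) y)) + (nrm (sc (ip x y) y))\<^sup>2"
      by (intro nrm_diff_sq sc_mem x y)
    also have "ip (sc (of_real t) x) (sc (ip x y) y) = of_real t * (ip x y * cnj (ip x y))"
      using x y by (simp add: ip_sc ip_sc2 sc_mem)
    also have "\<dots> = of_real (t * (cmod (ip x y))\<^sup>2)"
      using complex_norm_square[of "ip x y"] by simp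
    finally show ?thesis
      using x y by (simp add: nrm_sc power_mult_distrib)
  qed
  let ?c = "cmod (ip x y)"
  have "?c\<^sup>2 \<le> (nrm x * nrm y)\<^sup>2"
  proof (cases "nrm x = 0")
    case True
    then have a: "0 \<le> ?c\<^sup>2 * ((nrm y)\<^sup>2 - 2 * t)" for t using quad[of t] by (simp add: algebra_simps)
    have "?c = 0"
    proof (rule ccontr)
      assume "?c \<noteq> 0"
      then have "0 < ?c\<^sup>2" by simp
      then have "0 \<le> ((nrm y)\<^sup>2 - 2 * ((nrm y)\<^sup>2 + 1))" using a zero_le_mult_iff by (metis not_less)
      then have "(nrm y)\<^sup>2 + 2 \<le> 0" by (simp add: algebra_simps)
      then show False using zero_le_power2[of "nrm y"] by linarith
    qed
    then show ?thesis by simp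
  next
    case False
    then have p: "0 < (nrm x)\<^sup>2" by simp
    have "0 \<le> (?c\<^sup>2 / (nrm x)\<^sup>2)\<^sup>2 * (nrm x)\<^sup>2 - 2 * (?c\<^sup>2 / (nrm x)\<^sup>2) * ?c\<^sup>2 + ?c\<^sup>2 * (nrm y)\<^sup>2"
      by (rule quad)
    also have "\<dots> = ?c\<^sup>2 * ((nrm y)\<^sup>2 - ?c\<^sup>2 / (nrm x)\<^sup>2)"
      using False by (simp add: field_simps power2_eq_square)
    finally have *: "0 \<le> ?c\<^sup>2 * ((nrm y)\<^sup>2 - ?c\<^sup>2 / (nrm x)\<^sup>2)" .
    show ?thesis
    proof (cases "?c = 0")
      case False
      then have "0 < ?c\<^sup>2" by simp
      with * have "?c\<^sup>2 / (nrm x)\<^sup>2 \<le> (nrm y)\<^sup>2" by (simp add: zero_le_mult_iff)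
      then show ?thesis using p by (simp add: field_simps power_mult_distrib)
    qed simp
  qed
  then show ?thesis using x y by (simp add: power2_le_iff_abs_le)
qed

lemma nrm_triangle: "x \<in> V \<Longrightarrow> y \<in> V \<Longrightarrow> nrm (x + y) \<le> nrm x + nrm y"
proof (rule power2_le_imp_le)
  assume xy: "x \<in> V" "y \<in> V"
  have "Re (ip x y) \<le> nrm x * nrm y"
    using Cauchy_Schwarz[OF xy] complex_Re_le_cmod[of "ip x y"] by linarith
  then show "(nrm (x + y))\<^sup>2 \<le> (nrm x + nrm y)\<^sup>2"
    using xy by (simp add: nrm_add_sq power2_sum)
qed simp

lemma nrm_triangle_diff: "x \<in> V \<Longrightarrow> y \<in> V \<Longrightarrow> nrm (x - y) \<le> nrm x + nrm y"
  using nrm_triangle[of x "-y"] by (simp add: nrm_neg neg_mem)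

lemma nrm_triangle3: "x \<in> V \<Longrightarrow> y \<in> V \<Longrightarrow> z \<in> V \<Longrightarrow> nrm (x - z) \<le> nrm (x - y) + nrm (y - z)"
  using nrm_triangle[of "x - y" "y - z"] by (simp add: diff_mem)

lemma nrm_triangle_ge: "x \<in> V \<Longrightarrow> y \<in> V \<Longrightarrow> \<bar>nrm x - nrm y\<bar> \<le> nrm (x - y)"
  using nrm_triangle[of "x - y" y] nrm_triangle[of "y - x" x] nrm_diff_commute[of x y]
  by (simp add: diff_mem abs_le_iff)

lemma nrm_sum: "(\<And>i. i \<in> I \<Longrightarrow> f i \<in> V) \<Longrightarrow> nrm (sum f I) \<le> (\<Sum>i\<in>I. nrm (f i))"
proof (induction I rule: infinite_finite_induct)
  case (insert i I)
  then show ?case using nrm_triangle[of "f i" "sum f I"] sum_mem[of I f] by force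
qed (auto simp: nrm_def ip_zero zero_mem)

lemma nrm_zero: "nrm 0 = 0"
  by (simp add: nrm_def ip_zero zero_mem)

lemma parallelogram: "x \<in> V \<Longrightarrow> y \<in> V \<Longrightarrow> (nrm (x + y))\<^sup>2 + (nrm (x - y))\<^sup>2 = 2 * (nrm x)\<^sup>2 + 2 * (nrm y)\<^sup>2"
  by (simp add: nrm_add_sq nrm_diff_sq)

lemma complete_nrm:
  assumes "\<And>n. X n \<in> V"
    and "\<And>e. e > 0 \<Longrightarrow> \<exists>N. \<forall>m\<ge>N. \<forall>n\<ge>N. nrm (X m - X n) < e"
  shows "\<exists>x\<in>V. (\<lambda>n. nrm (X n - x)) \<longlonglongrightarrow> 0"
proof -
  have "\<exists>x\<in>V. (\<lambda>n. Re (ip (X n - x) (X n - x))) \<longlonglongrightarrow> 0"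
  proof (rule complete)
    fix e :: real assume "e > 0"
    then obtain N where N: "\<forall>m\<ge>N. \<forall>n\<ge>N. nrm (X m - X n) < sqrt e" using assms(2)[of "sqrt e"] by auto
    then show "\<exists>N. \<forall>m\<ge>N. \<forall>n\<ge>N. Re (ip (X m - X n) (X m - X n)) < e"
      by (intro exI[of _ N]) (simp add: nrm_def)
  qed (rule assms)
  then obtain x where x: "x \<in> V" "(\<lambda>n. Re (ip (X n - x) (X n - x))) \<longlonglongrightarrow> 0" by blast
  then have "(\<lambda>n. sqrt (Re (ip (X n - x) (X n - x)))) \<longlonglongrightarrow> 0"
    using tendsto_real_sqrt by fastforce
  then show ?thesis using x by (auto simp: nrm_def)
qed

lemma ip_tendsto:
  assumes "\<And>n. X n \<in> V" "x \<in> V" "y \<in> V" "(\<lambda>n. nrm (X n - x)) \<longlonglongrightarrow> 0"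
  shows "(\<lambda>n. ip (X n) y) \<longlonglongrightarrow> ip x y"
proof (rule LIM_zero_cancel, rule Lim_null_comparison)
  show "(\<lambda>n. nrm (X n - x) * nrm y) \<longlonglongrightarrow> 0" using tendsto_mult_right[OF assms(4), of "nrm y"] by simp
  show "\<forall>\<^sub>F n in sequentially. norm (ip (X n) y - ip x y) \<le> nrm (X n - x) * nrm y"
    using assms Cauchy_Schwarz by (intro always_eventually allI) (simp add: ip_diff[symmetric] diff_mem)
qed

lemma nrm_tendsto:
  assumes "\<And>n. X n \<in> V" "x \<in> V" "(\<lambda>n. nrm (X n - x)) \<longlonglongrightarrow> 0"
  shows "(\<lambda>n. nrm (X n)) \<longlonglongrightarrow> nrm x"
proof (rule LIM_zero_cancel, rule Lim_null_comparison[OF _ assms(3)])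
  show "\<forall>\<^sub>F n in sequentially. norm (nrm (X n) - nrm x) \<le> nrm (X n - x)"
    using assms nrm_triangle_ge by (intro always_eventually allI) simp
qed

text \<open>The functional to be represented is given by its graph, because in applications its values are
  indexed by operators rather than by the vectors themselves.\<close>

lemma Riesz_graph:
  assumes R: "R \<subseteq> V \<times> UNIV" and R0: "(0, 0) \<in> R"
    and Radd: "\<And>w z w' z'. (w, z) \<in> R \<Longrightarrow> (w', z') \<in> R \<Longrightarrow> (w + w', z + z') \<in> R"
    and Rsc: "\<And>w z a. (w, z) \<in> R \<Longrightarrow> (sc a w, a * z) \<in> R"
    and bound: "\<And>w z. (w, z) \<in> R \<Longrightarrow> cmod z \<le> C * nrm w"
  obtains y where "y \<in> V" "\<And>e. e > 0 \<Longrightarrow> \<exists>w\<in>fst ` R. nrm (w - y) < e"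
    "\<And>w z. (w, z) \<in> R \<Longrightarrow> z = ip w y"
proof -
  \<comment> \<open>If z = \<langle>w, y\<rangle> on the graph, then J is \<parallel>w -
    y\<parallel>^2 - \<parallel>y\<parallel>^2, so y is found by minimizing J. Minimizing sequences
    are Cauchy by the parallelogram law.\<close>
  define J where "J p = (nrm (fst p))\<^sup>2 - 2 * Re (snd p)" for p :: "'v \<times> complex"
  have memV: "w \<in> V" if "(w, z) \<in> R" for w z using R that by auto
  have Jlow: "- C\<^sup>2 \<le> J p" if "p \<in> R" for p
  proof -
    obtain w z where p: "p = (w, z)" by (cases p)
    have "Re z \<le> C * nrm w" using bound[of w z] that p complex_Re_le_cmod[of z] by auto
    moreover have "0 \<le> (nrm w - C)\<^sup>2" by simp
    ultimately show ?thesis using p by (simp add: J_def power2_diff algebra_simps)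
  qed
  define m where "m = Inf (J ` R)"
  have bdd: "bdd_below (J ` R)" using Jlow by (intro bdd_belowI[of _ "-C\<^sup>2"]) auto
  have mle: "m \<le> J p" if "p \<in> R" for p unfolding m_def using bdd that by (intro cInf_lower) auto
  have "\<exists>p\<in>R. J p < m + inverse (real (Suc n))" for n
    using cInf_less_iff[OF _ bdd, of "m + inverse (real (Suc n))"] R0 unfolding m_def[symmetric] by auto
  then obtain p where pR: "\<And>n. p n \<in> R" and pJ: "\<And>n. J (p n) < m + inverse (real (Suc n))"
    by metis
  define w where "w n = fst (p n)" for n
  define z where "z n = snd (p n)" for n
  have wz: "(w n, z n) \<in> R" for n using pR by (simp add: w_def z_def)
  have wV: "w n \<in> V" for n using memV wz by blast
  have close: "(nrm (w i - w j))\<^sup>2 \<le> 2 * inverse (real (Suc i)) + 2 * inverse (real (Suc j))" for i j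
  proof -
    have sc_half: "nrm (sc (1/2) (w i + w j)) = nrm (w i + w j) / 2"
      using wV by (simp add: nrm_sc add_mem)
    have "m \<le> J (sc (1/2) (w i + w j), 1/2 * (z i + z j))"
      by (intro mle Rsc Radd wz)
    also have "\<dots> = (nrm (w i + w j))\<^sup>2 / 4 - Re (z i) - Re (z j)"
      by (simp add: J_def sc_half power_divide field_simps)
    finally have "4 * m \<le> (nrm (w i + w j))\<^sup>2 - 4 * Re (z i) - 4 * Re (z j)" by simp
    moreover have "(nrm (w k))\<^sup>2 - 2 * Re (z k) < m + inverse (real (Suc k))" for k
      using pJ[of k] by (simp add: J_def w_def z_def)
    from this[of i] this[of j] have "2 * (nrm (w i))\<^sup>2 - 4 * Re (z i) + (2 * (nrm (w j))\<^sup>2 - 4 * Re (z j))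
      \<le> 4 * m + 2 * inverse (real (Suc i)) + 2 * inverse (real (Suc j))" by linarith
    ultimately show ?thesis using parallelogram[OF wV[of i] wV[of j]] by linarith
  qed
  have "\<exists>y\<in>V. (\<lambda>n. nrm (w n - y)) \<longlonglongrightarrow> 0"
  proof (rule complete_nrm[OF wV])
    fix e :: real assume e: "e > 0"
    then have "e\<^sup>2 / 4 > 0" by simp
    then obtain N where N: "inverse (real (Suc N)) < e\<^sup>2 / 4" using reals_Archimedean by blast
    show "\<exists>N. \<forall>m\<ge>N. \<forall>n\<ge>N. nrm (w m - w n) < e"
    proof (intro exI allI impI)
      fix i j assume ij: "i \<ge> N" "j \<ge> N"
      then have "inverse (real (Suc i)) \<le> inverse (real (Suc N))" "inverse (real (Suc j)) \<le> inverse (real (Suc N))"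
        by (auto intro!: le_imp_inverse_le)
      then have "(nrm (w i - w j))\<^sup>2 < e\<^sup>2" using close[of i j] N by linarith
      then show "nrm (w i - w j) < e" using e by (simp add: power2_less_imp_less)
    qed
  qed
  then obtain y where y: "y \<in> V" and lim: "(\<lambda>n. nrm (w n - y)) \<longlonglongrightarrow> 0" by blast
  \<comment> \<open>Stationarity at the minimum: moving by t u yields a quadratic in t without
    constant term that is nonnegative for all real t, so its linear coefficient vanishes.\<close>
  have re: "Re v = Re (ip u y)" if uv: "(u, v) \<in> R" for u v
  proof -
    have uV: "u \<in> V" using memV uv by blast
    have ineq: "0 \<le> t\<^sup>2 * (nrm u)\<^sup>2 + 2 * t * (Re (ip u y) - Re v)" for t :: real
    proof -
      have "0 \<le> t\<^sup>2 * (nrm u)\<^sup>2 + 2 * t * (Re (ip (w n) u) - Re v) + inverse (real (Suc n))" for n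
      proof -
        have "m \<le> J (w n + sc (of_real t) u, z n + of_real t * v)"
          by (intro mle Rsc Radd wz uv)
        also have "\<dots> = (nrm (w n))\<^sup>2 + 2 * t * Re (ip (w n) u) + t\<^sup>2 * (nrm u)\<^sup>2 - 2 * Re (z n) - 2 * t * Re v"
          using uV wV by (simp add: J_def nrm_add_sq sc_mem nrm_sc ip_sc2 power_mult_distrib)
        also have "\<dots> = J (p n) + (t\<^sup>2 * (nrm u)\<^sup>2 + 2 * t * (Re (ip (w n) u) - Re v))"
          by (simp add: J_def w_def z_def algebra_simps)
        finally show ?thesis using pJ[of n] by linarith
      qed
      moreover have "(\<lambda>n. t\<^sup>2 * (nrm u)\<^sup>2 + 2 * t * (Re (ip (w n) u) - Re v) + inverse (real (Suc n)))
        \<longlonglongrightarrow> t\<^sup>2 * (nrm u)\<^sup>2 + 2 * t * (Re (ip y u) - Re v) + 0"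
        by (intro tendsto_intros LIMSEQ_inverse_real_of_nat ip_tendsto[OF wV y uV lim])
      ultimately have "0 \<le> t\<^sup>2 * (nrm u)\<^sup>2 + 2 * t * (Re (ip y u) - Re v) + 0"
        by (intro LIMSEQ_le_const) auto
      then show ?thesis using ip_cnj[of u y] y uV by simp
    qed
    define d where "d = Re (ip u y) - Re v"
    \<comment> \<open>The summand 1 keeps the divisor positive when u has norm zero.\<close>
    define s where "s = (nrm u)\<^sup>2 + 1"
    have s: "s > 0" using zero_le_power2[of "nrm u"] unfolding s_def by linarith
    have "0 \<le> (- d / s)\<^sup>2 * (nrm u)\<^sup>2 + 2 * (- d / s) * d" using ineq[of "- d / s"] d_def by simp
    also have "\<dots> = d\<^sup>2 / s\<^sup>2 * (s - 1) - 2 * d\<^sup>2 / s"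
      by (simp add: s_def power2_eq_square)
    also have "\<dots> = - (d\<^sup>2 / s) - d\<^sup>2 / s\<^sup>2"
      using s by (simp add: field_simps power2_eq_square)
    finally have "d\<^sup>2 / s \<le> - (d\<^sup>2 / s\<^sup>2)" by linarith
    moreover have "0 \<le> d\<^sup>2 / s\<^sup>2" by simp
    ultimately have "d\<^sup>2 / s \<le> 0" by linarith
    then have "d = 0" using s by (simp add: divide_le_0_iff)
    then show ?thesis by (simp add: d_def)
  qed
  show thesis
  proof (rule that[OF y])
    fix e :: real assume "e > 0"
    with lim have "eventually (\<lambda>n. nrm (w n - y) < e) sequentially" by (rule order_tendstoD)
    then obtain n where "nrm (w n - y) < e" by (auto simp: eventually_sequentially)
    then show "\<exists>w\<in>fst ` R. nrm (w - y) < e" using wz[of n] by force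
  next
    fix u v assume uv: "(u, v) \<in> R"
    have uV: "u \<in> V" using memV uv by blast
    \<comment> \<open>The graph is complex linear, so the real part at -\<i> u gives the imaginary
      part at u.\<close>
    have "Re (- \<i> * v) = Re (ip (sc (-\<i>) u) y)" by (rule re[OF Rsc[OF uv]])
    then have "Im v = Im (ip u y)" using uV y by (simp add: ip_sc)
    then show "v = ip u y" using re[OF uv] by (simp add: complex_eq_iff)
  qed
qed

end

text \<open>The b j are the Taylor coefficients of (1 - t)^(-1/2), and the claim compares
  coefficients in the square of this series, which is 1 / (1 - t). Up to signs it is Vandermonde's
  identity for the exponents -1/2 and -1/2.\<close>

lemma sum_pochhammer_half_square:
  fixes b :: "nat \<Rightarrow> real"
  defines "b \<equiv> \<lambda>j. pochhammer (1/2) j / fact j"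
  shows "(\<Sum>i\<le>l. b i * b (l - i)) = 1"
proof -
  have b: "(- (1/2) :: real) gchoose j = (-1) ^ j * b j" for j
    by (simp add: gbinomial_pochhammer b_def)
  have "(-1) ^ l * (\<Sum>i\<le>l. b i * b (l - i)) = (\<Sum>i\<le>l. ((-1) ^ i * b i) * ((-1) ^ (l - i) * b (l - i)))"
    unfolding sum_distrib_left
  proof (intro sum.cong refl)
    fix i assume "i \<in> {..l}"
    then have "(-1 :: real) ^ l = (-1) ^ i * (-1) ^ (l - i)" by (simp flip: power_add)
    then show "(-1) ^ l * (b i * b (l - i)) = ((-1) ^ i * b i) * ((-1) ^ (l - i) * b (l - i))"
      by simp
  qed
  also have "\<dots> = (\<Sum>i\<le>l. (- (1/2) gchoose i) * (- (1/2) gchoose (l - i)))"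
    by (simp add: b)
  also have "\<dots> = (- (1/2) + - (1/2) :: real) gchoose l"
    using gbinomial_Vandermonde[of "- (1/2) :: real" "- (1/2)" l] by (simp add: atMost_atLeast0)
  also have "\<dots> = (-1) ^ l"
    by (simp add: gbinomial_pochhammer pochhammer_fact[symmetric])
  finally show ?thesis by simp
qed

section \<open>Adjoints, projections and the polar vector, modulo null vectors\<close>

context semi_hilbert
begin

definition eqv :: "'v \<Rightarrow> 'v \<Rightarrow> bool" where
  "eqv x y \<longleftrightarrow> (\<forall>z\<in>V. ip x z = ip y z)"

lemma eqv_refl [simp]: "eqv x x" by (simp add: eqv_def)

lemma eqv_sym: "eqv x y \<Longrightarrow> eqv y x" by (simp add: eqv_def)

lemma eqv_trans [trans]: "eqv x y \<Longrightarrow> eqv y z \<Longrightarrow> eqv x z" by (simp add: eqv_def)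

lemma eqv_iff: "x \<in> V \<Longrightarrow> y \<in> V \<Longrightarrow> eqv x y \<longleftrightarrow> nrm (x - y) = 0"
proof
  assume xy: "x \<in> V" "y \<in> V" "eqv x y"
  then have "ip (x - y) (x - y) = 0" by (simp add: eqv_def ip_diff diff_mem)
  then show "nrm (x - y) = 0" by (simp add: nrm_def)
next
  assume xy: "x \<in> V" "y \<in> V" "nrm (x - y) = 0"
  show "eqv x y" unfolding eqv_def
  proof
    fix z assume z: "z \<in> V"
    have "cmod (ip (x - y) z) \<le> 0" using Cauchy_Schwarz[of "x - y" z] xy z by (simp add: diff_mem)
    then show "ip x z = ip y z" using xy z by (simp add: ip_diff)
  qed
qed

lemma eqv_ip: "eqv x x' \<Longrightarrow> eqv y y' \<Longrightarrow> x \<in> V \<Longrightarrow> x' \<in> V \<Longrightarrow> y \<in> V \<Longrightarrow> y' \<in> V \<Longrightarrow> ip x y = ip x' y'"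
  unfolding eqv_def by (metis ip_cnj)

lemma eqv_nrm: "eqv x y \<Longrightarrow> x \<in> V \<Longrightarrow> y \<in> V \<Longrightarrow> nrm x = nrm y"
  unfolding nrm_def using eqv_ip[of x y x y] by simp

lemma eqv_diff: "eqv x x' \<Longrightarrow> eqv y y' \<Longrightarrow> x \<in> V \<Longrightarrow> x' \<in> V \<Longrightarrow> y \<in> V \<Longrightarrow> y' \<in> V \<Longrightarrow> eqv (x - y) (x' - y')"
  by (simp add: eqv_def ip_diff)

lemma eqv_sc: "eqv x y \<Longrightarrow> x \<in> V \<Longrightarrow> y \<in> V \<Longrightarrow> eqv (sc a x) (sc a y)"
  by (simp add: eqv_def ip_sc)

lemma eqv_sum:
  "(\<And>i. i \<in> I \<Longrightarrow> eqv (f i) (g i) \<and> f i \<in> V \<and> g i \<in> V) \<Longrightarrow> eqv (sum f I) (sum g I)"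
  by (simp add: eqv_def ip_sum)

text \<open>Possession of an adjoint already makes A linear and compatible with null vectors, both
  up to \<open>eqv\<close>; this is how linearity of operators enters below.\<close>

definition adjoint_pair :: "('v \<Rightarrow> 'v) \<Rightarrow> ('v \<Rightarrow> 'v) \<Rightarrow> bool" where
  "adjoint_pair A B \<longleftrightarrow> (\<forall>x\<in>V. A x \<in> V \<and> B x \<in> V) \<and> (\<forall>x\<in>V. \<forall>y\<in>V. ip (A x) y = ip x (B y))"

lemma adjoint_pairD:
  assumes "adjoint_pair A B"
  shows "x \<in> V \<Longrightarrow> A x \<in> V" "x \<in> V \<Longrightarrow> B x \<in> V"
    "x \<in> V \<Longrightarrow> y \<in> V \<Longrightarrow> ip (A x) y = ip x (B y)"
  using assms by (auto simp: adjoint_pair_def)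

lemma adjoint_pair_sym: "adjoint_pair A B \<Longrightarrow> adjoint_pair B A"
  unfolding adjoint_pair_def by (metis ip_cnj)

lemma adjoint_pair_comp: "adjoint_pair A B \<Longrightarrow> adjoint_pair C D \<Longrightarrow> adjoint_pair (\<lambda>x. A (C x)) (\<lambda>x. D (B x))"
  unfolding adjoint_pair_def by simp

lemma adjoint_eqv: "adjoint_pair A B \<Longrightarrow> eqv x y \<Longrightarrow> x \<in> V \<Longrightarrow> y \<in> V \<Longrightarrow> eqv (A x) (A y)"
  unfolding adjoint_pair_def eqv_def by simp

lemma adjoint_diff: "adjoint_pair A B \<Longrightarrow> x \<in> V \<Longrightarrow> y \<in> V \<Longrightarrow> eqv (A (x - y)) (A x - A y)"
  unfolding adjoint_pair_def eqv_def by (simp add: ip_diff diff_mem)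

lemma adjoint_sum_sc: "adjoint_pair A B \<Longrightarrow> (\<And>i. i \<in> I \<Longrightarrow> f i \<in> V) \<Longrightarrow>
    eqv (A (\<Sum>i\<in>I. sc (c i) (f i))) (\<Sum>i\<in>I. sc (c i) (A (f i)))"
  unfolding adjoint_pair_def eqv_def by (simp add: ip_sum ip_sc sc_mem sum_mem)

definition subspace_of :: "'v set \<Rightarrow> bool" where
  "subspace_of W \<longleftrightarrow> W \<subseteq> V \<and> 0 \<in> W \<and> (\<forall>x\<in>W. \<forall>y\<in>W. x + y \<in> W) \<and> (\<forall>x\<in>W. \<forall>a. sc a x \<in> W)"

text \<open>W may fail to be closed: P x is a limit of vectors of W with x - P x orthogonal to W,
  which determines it up to \<open>eqv\<close>.\<close>

definition projection_onto :: "'v set \<Rightarrow> ('v \<Rightarrow> 'v) \<Rightarrow> bool" where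
  "projection_onto W P \<longleftrightarrow> (\<forall>x\<in>V. P x \<in> V \<and> (\<forall>e>0. \<exists>w\<in>W. nrm (w - P x) < e) \<and> (\<forall>w\<in>W. ip w (P x) = ip w x))"

text \<open>The functional w \<mapsto> \<langle>w, x\<rangle> on W is represented by a vector in the
  closure of W, and that vector is the projection of x.\<close>

lemma projection_exists:
  assumes W: "subspace_of W"
  obtains P where "projection_onto W P"
proof -
  have "\<exists>y. y \<in> V \<and> (\<forall>e>0. \<exists>w\<in>W. nrm (w - y) < e) \<and> (\<forall>w\<in>W. ip w y = ip w x)" if x: "x \<in> V" for x
  proof -
    have WV: "w \<in> V" if "w \<in> W" for w using W that by (auto simp: subspace_of_def)
    define R where "R = (\<lambda>w. (w, ip w x)) ` W"
    obtain y where y: "y \<in> V" "\<And>e. e > 0 \<Longrightarrow> \<exists>w\<in>fst ` R. nrm (w - y) < e" "\<And>w z. (w, z) \<in> R \<Longrightarrow> z = ip w y"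
    proof (rule Riesz_graph[of R "nrm x"])
      show "R \<subseteq> V \<times> UNIV" using WV by (auto simp: R_def)
      show "(0, 0) \<in> R" using W x by (auto simp: R_def subspace_of_def ip_zero image_iff intro!: bexI[of _ 0])
      show "(w + w', z + z') \<in> R" if "(w, z) \<in> R" "(w', z') \<in> R" for w z w' z'
        using that W WV x by (auto simp: R_def subspace_of_def ip_add image_iff intro!: bexI[of _ "w + w'"])
      show "(sc a w, a * z) \<in> R" if "(w, z) \<in> R" for w z a
        using that W WV x by (auto simp: R_def subspace_of_def ip_sc image_iff intro!: bexI[of _ "sc a w"])
      show "cmod z \<le> nrm x * nrm w" if "(w, z) \<in> R" for w z
        using that WV x Cauchy_Schwarz[of w x] by (auto simp: R_def mult.commute)
    qed blast
    show ?thesis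
    proof (intro exI[of _ y] conjI allI impI ballI)
      show "y \<in> V" by fact
      show "\<exists>w\<in>W. nrm (w - y) < e" if "e > 0" for e using y(2)[OF that] by (auto simp: R_def)
      show "ip w y = ip w x" if "w \<in> W" for w using y(3)[of w "ip w x"] that by (auto simp: R_def)
    qed
  qed
  then obtain P where "\<And>x. x \<in> V \<Longrightarrow> P x \<in> V \<and> (\<forall>e>0. \<exists>w\<in>W. nrm (w - P x) < e) \<and> (\<forall>w\<in>W. ip w (P x) = ip w x)"
    by metis
  then show thesis by (intro that[of P]) (auto simp: projection_onto_def)
qed

lemma ip_eq_of_dense:
  assumes W: "W \<subseteq> V" and a: "a \<in> V" "\<forall>e>0. \<exists>w\<in>W. nrm (w - a) < e"
    and b: "b \<in> V" "b' \<in> V" "\<forall>w\<in>W. ip w b = ip w b'"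
  shows "ip a b = ip a b'"
proof -
  have "cmod (ip a (b - b')) \<le> e" if e: "e > 0" for e
  proof -
    have pos: "0 < e / (nrm (b - b') + 1)" using e b by (simp add: add_nonneg_pos diff_mem)
    with a obtain w where w: "w \<in> W" "nrm (w - a) < e / (nrm (b - b') + 1)" by blast
    then have wV: "w \<in> V" using W by blast
    have "ip (w - a) (b - b') = - ip a (b - b')"
      using w wV a b by (simp add: ip_diff ip_diff2 diff_mem)
    then have "cmod (ip a (b - b')) \<le> nrm (w - a) * nrm (b - b')"
      using Cauchy_Schwarz[of "w - a" "b - b'"] wV a b by (simp add: diff_mem)
    also have "\<dots> \<le> e / (nrm (b - b') + 1) * (nrm (b - b') + 1)"
      using w wV a b pos by (intro mult_mono) (auto simp: diff_mem simp del: zero_le_divide_iff zero_less_divide_iff)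
    also have "\<dots> = e"
    proof -
      have "0 \<le> nrm (b - b')" using b by (simp add: diff_mem)
      then have "nrm (b - b') + 1 \<noteq> 0" by linarith
      then show ?thesis by simp
    qed
    finally show ?thesis .
  qed
  then have "cmod (ip a (b - b')) \<le> 0" by (meson field_le_epsilon not_le dense_le_bounded dual_order.trans le_less_linear dense)
  then show ?thesis using a b by (simp add: ip_diff2)
qed

lemma projection_adjoint:
  assumes W: "subspace_of W" and P: "projection_onto W P"
  shows "adjoint_pair P P"
proof -
  have PV: "P x \<in> V" if "x \<in> V" for x using P that by (simp add: projection_onto_def)
  have *: "ip (P x) (P y) = ip (P x) y" if "x \<in> V" "y \<in> V" for x y
    using W P that by (intro ip_eq_of_dense[of W]) (auto simp: projection_onto_def subspace_of_def)
  have "ip (P x) y = ip x (P y)" if "x \<in> V" "y \<in> V" for x y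
  proof -
    have "ip x (P y) = cnj (ip (P y) x)" using ip_cnj[of "P y" x] PV that by simp
    also have "\<dots> = cnj (ip (P y) (P x))" using *[OF that(2,1)] by simp
    also have "\<dots> = ip (P x) (P y)" using ip_cnj[of "P y" "P x"] PV that by simp
    finally show ?thesis using *[OF that] by simp
  qed
  then show ?thesis using PV by (auto simp: adjoint_pair_def)
qed

lemma projection_contraction:
  assumes W: "subspace_of W" and P: "projection_onto W P" and x: "x \<in> V"
  shows "nrm (P x) \<le> nrm x"
proof -
  have PV: "P x \<in> V" using P x by (simp add: projection_onto_def)
  have "ip (P x) (P x) = ip (P x) x"
    using W P x by (intro ip_eq_of_dense[of W]) (auto simp: projection_onto_def subspace_of_def)
  then have "(nrm (P x))\<^sup>2 = Re (ip (P x) x)" using PV by (simp add: nrm_sq)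
  also have "\<dots> \<le> nrm (P x) * nrm x" using Cauchy_Schwarz[OF PV x] complex_Re_le_cmod[of "ip (P x) x"] by linarith
  finally have "nrm (P x) * nrm (P x) \<le> nrm (P x) * nrm x" by (simp add: power2_eq_square)
  then show ?thesis using PV x by (cases "nrm (P x) = 0") (auto simp: less_le mult_le_cancel_left)
qed

text \<open>The vector a = A (P x) - P (A x) is orthogonal to W, because the adjoint B preserves W,
  and it lies in the closure of W, because A is bounded and preserves W. Hence a is orthogonal to
  itself.\<close>

lemma projection_commute:
  assumes W: "subspace_of W" and P: "projection_onto W P" and A: "adjoint_pair A B"
    and bd: "\<And>x. x \<in> V \<Longrightarrow> nrm (A x) \<le> c * nrm x"
    and AW: "\<And>w. w \<in> W \<Longrightarrow> A w \<in> W" and BW: "\<And>w. w \<in> W \<Longrightarrow> B w \<in> W" and x: "x \<in> V"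
  shows "eqv (A (P x)) (P (A x))"
proof -
  have WV: "W \<subseteq> V" using W by (simp add: subspace_of_def)
  have PV: "P y \<in> V" if "y \<in> V" for y using P that by (simp add: projection_onto_def)
  note AV = adjoint_pairD(1)[OF A] and BV = adjoint_pairD(2)[OF A]
  define a where "a = A (P x) - P (A x)"
  have aV: "a \<in> V" by (simp add: a_def diff_mem AV PV x)
  have orth: "ip w a = ip w 0" if w: "w \<in> W" for w
  proof -
    have wV: "w \<in> V" using w WV by blast
    have "ip w (A (P x)) = ip (B w) (P x)"
      using adjoint_pairD(3)[OF adjoint_pair_sym[OF A], of w "P x"] wV PV x by simp
    also have "\<dots> = ip (B w) x" using P BW[OF w] x by (simp add: projection_onto_def)
    also have "\<dots> = ip w (A x)" using adjoint_pairD(3)[OF adjoint_pair_sym[OF A], of w x] wV x by simp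
    also have "\<dots> = ip w (P (A x))" using P w x AV by (simp add: projection_onto_def)
    finally show ?thesis using wV x by (simp add: a_def ip_diff2 ip_zero2 AV PV)
  qed
  have "ip a a = ip a 0"
  proof (rule ip_eq_of_dense[OF WV aV _ aV zero_mem], intro allI impI)
    fix e :: real assume e: "e > 0"
    define d where "d = e / 2 / (\<bar>c\<bar> + 1)"
    have c1: "\<bar>c\<bar> + 1 > 0" by linarith
    then have d: "d > 0" using e by (simp add: d_def)
    obtain w where w: "w \<in> W" "nrm (w - P x) < d" using P x d unfolding projection_onto_def by blast
    obtain w' where w': "w' \<in> W" "nrm (w' - P (A x)) < e / 2"
      using P AV[OF x] e unfolding projection_onto_def by (meson half_gt_zero)
    have V1: "w \<in> V" "w' \<in> V" using w w' WV by auto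
    have "nrm (A w - A (P x)) = nrm (A (w - P x))"
      using adjoint_diff[OF A, of w "P x"] V1 x by (intro eqv_nrm) (auto intro: eqv_sym simp: AV PV diff_mem)
    also have "\<dots> \<le> c * nrm (w - P x)" using V1 x by (intro bd) (simp add: PV diff_mem)
    also have "\<dots> \<le> (\<bar>c\<bar> + 1) * d" using w V1 x by (intro mult_mono) (auto simp: PV diff_mem)
    also have "\<dots> = e / 2" using c1 unfolding d_def by (metis less_irrefl nonzero_mult_div_cancel_left times_divide_eq_right)
    finally have 1: "nrm (A w - A (P x)) \<le> e / 2" .
    have eq: "(A w - w') - a = (A w - A (P x)) - (w' - P (A x))" by (simp add: a_def)
    have "nrm ((A w - w') - a) \<le> nrm (A w - A (P x)) + nrm (w' - P (A x))"
      unfolding eq using V1 x by (intro nrm_triangle_diff) (auto simp: AV PV diff_mem)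
    then have "nrm ((A w - w') - a) < e" using 1 w' by linarith
    moreover have "A w - w' \<in> W"
    proof -
      have "A w + sc (-1) w' \<in> W" using W AW[OF w(1)] w'(1) unfolding subspace_of_def by blast
      then show ?thesis by (simp add: sc_neg)
    qed
    ultimately show "\<exists>w\<in>W. nrm (w - a) < e" by blast
  qed (use orth in blast)
  then have "nrm a = 0" using aV by (simp add: nrm_def ip_zero2)
  then show ?thesis using x by (simp add: eqv_iff AV PV a_def)
qed

text \<open>The vector \<open>h\<close> is \<open>Y (X Y)\<^sup>-\<^sup>1\<^sup>/\<^sup>2 \<Omega>\<close>, obtained from the binomial series of
  \<open>(1 - t)\<^sup>-\<^sup>1\<^sup>/\<^sup>2\<close> at \<open>S = 1 - X Y\<close>. All estimates reduce to the moments
  \<open>m j = \<langle>S\<^sup>j \<eta>, \<eta>\<rangle>\<close>, because the Cauchy square of the series has all coefficients \<open>1\<close>.\<close>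

lemma polar_vector:
  assumes XY: "adjoint_pair X Y"
    and Xc: "\<And>x. x \<in> V \<Longrightarrow> nrm (X x) \<le> nrm x" and Yc: "\<And>x. x \<in> V \<Longrightarrow> nrm (Y x) \<le> nrm x"
    and \<Omega>: "\<Omega> \<in> V" and ker: "\<And>q. q \<in> V \<Longrightarrow> nrm (Y q) = 0 \<Longrightarrow> ip q \<Omega> = 0"
  obtains h where "h \<in> V"
    "\<And>Q Q'. adjoint_pair Q Q' \<Longrightarrow> (\<And>x. x \<in> V \<Longrightarrow> eqv (Q (Y x)) (Y x)) \<Longrightarrow> eqv (Q h) h"
    "\<And>A A' c. adjoint_pair A A' \<Longrightarrow> (\<And>x. x \<in> V \<Longrightarrow> nrm (A x) \<le> c * nrm x) \<Longrightarrow>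
      (\<And>x. x \<in> V \<Longrightarrow> eqv (A (X x)) (X (A x))) \<Longrightarrow> (\<And>x. x \<in> V \<Longrightarrow> eqv (A (Y x)) (Y (A x))) \<Longrightarrow>
      nrm (A \<Omega>) \<le> nrm (A h)"
proof -
  note XV = adjoint_pairD(1)[OF XY] and YV = adjoint_pairD(2)[OF XY] and ipX = adjoint_pairD(3)[OF XY]
  note YX = adjoint_pair_sym[OF XY]
  define S where "S x = x - X (Y x)" for x
  define T where "T \<eta> j = (S ^^ j) \<eta>" for \<eta> j
  have SV: "S x \<in> V" if "x \<in> V" for x using that by (simp add: S_def XV YV diff_mem)
  have TV: "T \<eta> j \<in> V" if "\<eta> \<in> V" for \<eta> j unfolding T_def using that by (induction j) (auto simp: SV)
  have T0: "T \<eta> 0 = \<eta>" and TS: "T \<eta> (Suc j) = S (T \<eta> j)" for \<eta> j by (simp_all add: T_def)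
  have ipY: "ip (Y x) y = ip x (X y)" if "x \<in> V" "y \<in> V" for x y using adjoint_pairD(3)[OF YX] that by simp
  have ipS: "ip (S x) y = ip x (S y)" if "x \<in> V" "y \<in> V" for x y
    using that by (simp add: S_def ip_diff ip_diff2 XV YV ipX ipY)
  have ipT: "ip (T \<eta> i) (T \<eta> j) = ip (T \<eta> (i + j)) \<eta>" if "\<eta> \<in> V" for \<eta> i j
  proof (induction j arbitrary: i)
    case 0 then show ?case by (simp add: T0)
  next
    case (Suc j)
    have "ip (T \<eta> i) (T \<eta> (Suc j)) = ip (T \<eta> (Suc i)) (T \<eta> j)" using that by (simp add: TS ipS TV)
    then show ?case using Suc[of "Suc i"] by simp
  qed
  define m where "m \<eta> j = Re (ip (T \<eta> j) \<eta>)" for \<eta> j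
  have ipTm: "ip (T \<eta> i) (T \<eta> j) = of_real (m \<eta> (i + j))" if "\<eta> \<in> V" for \<eta> i j
  proof -
    have "ip (T \<eta> k) \<eta> = cnj (ip (T \<eta> k) \<eta>)" for k
      using ipT[OF that, of 0 k] ip_cnj[OF TV[OF that, of k] that] by (simp add: T0)
    then have "Im (ip (T \<eta> k) \<eta>) = 0" for k by (metis Im_complex_of_real Reals_cnj_iff complex_is_Real_iff)
    then show ?thesis using ipT[OF that] by (simp add: m_def complex_eq_iff)
  qed
  have nT: "(nrm (T \<eta> j))\<^sup>2 = m \<eta> (j + j)" if "\<eta> \<in> V" for \<eta> j
    using that by (simp add: nrm_sq TV ipTm)
  define e where "e \<eta> j = m \<eta> j - m \<eta> (Suc j)" for \<eta> j
  have ipYT: "ip (Y (T \<eta> i)) (Y (T \<eta> j)) = of_real (e \<eta> (i + j))" if "\<eta> \<in> V" for \<eta> i j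
  proof -
    have "X (Y (T \<eta> i)) = T \<eta> i - T \<eta> (Suc i)" by (simp add: TS S_def)
    then have "ip (Y (T \<eta> i)) (Y (T \<eta> j)) = ip (T \<eta> i - T \<eta> (Suc i)) (T \<eta> j)"
      using that ipX[of "Y (T \<eta> i)" "T \<eta> j"] by (simp add: TV YV)
    then show ?thesis using that by (simp add: ip_diff TV ipTm e_def)
  qed
  have nYT: "(nrm (Y (T \<eta> j)))\<^sup>2 = e \<eta> (j + j)" if "\<eta> \<in> V" for \<eta> j
    using that by (simp add: nrm_sq TV YV ipYT)
  \<comment> \<open>An even moment is a squared norm. An odd one is \<parallel>z\<parallel>^2 -
    \<parallel>Y z\<parallel>^2 with z = S^i \<eta>, and Y is a contraction. The differences e j are
    treated in the same way, with Y z in place of z and X in place of Y.\<close>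
  have m_nonneg: "0 \<le> m \<eta> j" if \<eta>: "\<eta> \<in> V" for \<eta> j
  proof (cases "even j")
    case True
    then obtain i where "j = i + i" by (metis evenE mult_2)
    then show ?thesis using nT[OF \<eta>, of i] by (metis zero_le_power2)
  next
    case False
    then obtain i where j: "j = Suc (i + i)" by (metis oddE mult_2 Suc_eq_plus1)
    have "m \<eta> j = m \<eta> (i + i) - e \<eta> (i + i)" by (simp add: e_def j)
    also have "\<dots> = (nrm (T \<eta> i))\<^sup>2 - (nrm (Y (T \<eta> i)))\<^sup>2" using \<eta> by (simp add: nT nYT)
    also have "\<dots> \<ge> 0" using Yc[OF TV[OF \<eta>, of i]] \<eta> by (simp add: TV YV power_mono)
    finally show ?thesis .
  qed
  have e_nonneg: "0 \<le> e \<eta> j" if \<eta>: "\<eta> \<in> V" for \<eta> j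
  proof (cases "even j")
    case True
    then obtain i where "j = i + i" by (metis evenE mult_2)
    then show ?thesis using nYT[OF \<eta>, of i] by (metis zero_le_power2)
  next
    case False
    then obtain i where j: "j = i + Suc i" by (metis oddE mult_2 Suc_eq_plus1 add_Suc_right)
    let ?z = "T \<eta> i"
    have z: "?z \<in> V" "Y ?z \<in> V" "X (Y ?z) \<in> V" using \<eta> by (auto simp: TV XV YV)
    have "of_real (e \<eta> j) = ip (Y ?z) (Y (S ?z))" using ipYT[OF \<eta>, of i "Suc i"] by (simp add: j TS)
    also have "\<dots> = ip (X (Y ?z)) (S ?z)" using z SV ipX[of "Y ?z" "S ?z"] by simp
    also have "\<dots> = ip (X (Y ?z)) ?z - ip (X (Y ?z)) (X (Y ?z))" using z by (simp add: S_def ip_diff2)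
    also have "ip (X (Y ?z)) ?z = ip (Y ?z) (Y ?z)" using z by (simp add: ipX)
    finally have "of_real (e \<eta> j) = (of_real ((nrm (Y ?z))\<^sup>2 - (nrm (X (Y ?z)))\<^sup>2) :: complex)"
      using z by (simp add: ip_self)
    then have "e \<eta> j = (nrm (Y ?z))\<^sup>2 - (nrm (X (Y ?z)))\<^sup>2" using of_real_eq_iff by blast
    also have "\<dots> \<ge> 0" using Xc[OF z(2)] z by (simp add: power_mono)
    finally show ?thesis .
  qed
  have m_dec: "m \<eta> (Suc j) \<le> m \<eta> j" if "\<eta> \<in> V" for \<eta> j using e_nonneg[OF that, of j] by (simp add: e_def)
  have decm: "decseq (m \<eta>)" if "\<eta> \<in> V" for \<eta> by (rule decseq_SucI) (use m_dec[OF that] in simp)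
  \<comment> \<open>The moments decrease, hence converge, and \<parallel>S^i \<Omega> - S^j
    \<Omega>\<parallel>^2 is m (i + i) - 2 m (i + j) + m (j + j), so the powers S^n \<Omega> are
    Cauchy. Their limit q is annihilated by Y up to norm zero, and \<open>ker\<close> then forces
    the moments to tend to 0.\<close>
  obtain L where L: "m \<Omega> \<longlonglongrightarrow> L"
    using decseq_convergent[OF decm[OF \<Omega>], of 0] m_nonneg[OF \<Omega>] by metis
  have "\<exists>q\<in>V. (\<lambda>n. nrm (T \<Omega> n - q)) \<longlonglongrightarrow> 0"
  proof (rule complete_nrm[OF TV[OF \<Omega>]])
    fix d :: real assume d: "d > 0"
    then have "eventually (\<lambda>j. \<bar>m \<Omega> j - L\<bar> < d\<^sup>2 / 4) sequentially"
      using tendstoD[OF L, of "d\<^sup>2 / 4"] by (simp add: dist_real_def)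
    then obtain N where N: "\<And>j. j \<ge> N \<Longrightarrow> \<bar>m \<Omega> j - L\<bar> < d\<^sup>2 / 4" by (auto simp: eventually_sequentially)
    show "\<exists>N. \<forall>i\<ge>N. \<forall>j\<ge>N. nrm (T \<Omega> i - T \<Omega> j) < d"
    proof (intro exI allI impI)
      fix i j assume ij: "i \<ge> N" "j \<ge> N"
      have "(nrm (T \<Omega> i - T \<Omega> j))\<^sup>2 = m \<Omega> (i + i) - 2 * m \<Omega> (i + j) + m \<Omega> (j + j)"
        using \<Omega> by (simp add: nrm_diff_sq TV nT ipTm)
      also have "\<dots> < d\<^sup>2"
        using N[of "i + i"] N[of "i + j"] N[of "j + j"] ij unfolding abs_less_iff by simp
      finally show "nrm (T \<Omega> i - T \<Omega> j) < d" using d by (simp add: power2_less_imp_less)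
    qed
  qed
  then obtain q where q: "q \<in> V" and Tq: "(\<lambda>n. nrm (T \<Omega> n - q)) \<longlonglongrightarrow> 0" by blast
  have "nrm (Y q) = 0"
  proof -
    have e0: "(\<lambda>j. sqrt (e \<Omega> (j + j))) \<longlonglongrightarrow> sqrt (L - L)"
      unfolding e_def
      by (intro tendsto_real_sqrt tendsto_diff LIMSEQ_subseq_LIMSEQ[OF L, unfolded comp_def])
        (auto simp: strict_mono_def)
    have "nrm (Y q) \<le> nrm (T \<Omega> j - q) + sqrt (e \<Omega> (j + j))" for j
    proof -
      have "nrm (Y q - Y (T \<Omega> j)) = nrm (Y (q - T \<Omega> j))"
        using adjoint_diff[OF YX q TV[OF \<Omega>, of j]] q \<Omega> by (intro eqv_nrm) (auto intro: eqv_sym simp: YV TV diff_mem)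
      also have "\<dots> \<le> nrm (T \<Omega> j - q)" using Yc[of "q - T \<Omega> j"] q \<Omega> by (simp add: TV diff_mem nrm_diff_commute)
      finally have "nrm (Y q - Y (T \<Omega> j)) \<le> nrm (T \<Omega> j - q)" .
      moreover have "nrm (Y (T \<Omega> j)) = sqrt (e \<Omega> (j + j))"
        using nYT[OF \<Omega>, of j] \<Omega> by (simp add: TV YV real_sqrt_unique)
      ultimately show ?thesis
        using nrm_triangle[of "Y q - Y (T \<Omega> j)" "Y (T \<Omega> j)"] q \<Omega> by (simp add: YV TV diff_mem)
    qed
    moreover have "(\<lambda>j. nrm (T \<Omega> j - q) + sqrt (e \<Omega> (j + j))) \<longlonglongrightarrow> 0 + sqrt (L - L)"
      by (intro tendsto_add Tq e0)
    ultimately have "nrm (Y q) \<le> 0 + sqrt (L - L)" by (intro LIMSEQ_le_const) auto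
    then show ?thesis using nrm_nonneg[OF YV[OF q]] by simp
  qed
  then have "ip q \<Omega> = 0" using ker q by blast
  moreover have "(\<lambda>n. Re (ip (T \<Omega> n) \<Omega>)) \<longlonglongrightarrow> Re (ip q \<Omega>)"
    by (intro tendsto_intros ip_tendsto TV \<Omega> q Tq)
  ultimately have m0: "m \<Omega> \<longlonglongrightarrow> 0" by (simp add: m_def[abs_def])

  define b where "b j = (pochhammer (1/2) j / fact j :: real)" for j
  have b_nonneg: "0 \<le> b j" for j by (simp add: b_def pochhammer_nonneg)
  have b_conv: "(\<Sum>i\<le>l. b i * b (l - i)) = 1" for l
    using sum_pochhammer_half_square[of l] by (simp add: b_def)
  \<comment> \<open>By \<open>nZ\<close> below, D \<eta> J is the squared norm of the part of the
    series with indices in J.\<close>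
  define D where "D \<eta> J = (\<Sum>i\<in>J. \<Sum>j\<in>J. b i * b j * e \<eta> (i + j))" for \<eta> J
  have tri: "(\<Sum>(i, j)\<in>{(i, j). i + j \<le> n}. b i * b j * f (i + j)) = (\<Sum>k\<le>n. f k)" for n and f :: "nat \<Rightarrow> real"
  proof -
    have "(\<Sum>(i, j)\<in>{(i, j). i + j \<le> n}. b i * b j * f (i + j)) = (\<Sum>k\<le>n. \<Sum>i\<le>k. b i * b (k - i) * f (i + (k - i)))"
      by (rule sum.triangle_reindex_eq)
    also have "\<dots> = (\<Sum>k\<le>n. (\<Sum>i\<le>k. b i * b (k - i)) * f k)"
      unfolding sum_distrib_right by (intro sum.cong refl) auto
    finally show ?thesis by (simp add: b_conv)
  qed
  have fin_tri: "finite {(i, j). i + j \<le> (n::nat)}" for n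
    by (rule finite_subset[of _ "{..n} \<times> {..n}"]) auto
  have tele: "(\<Sum>k\<le>n. e \<eta> k) = m \<eta> 0 - m \<eta> (Suc n)" for \<eta> n
    by (simp add: e_def sum_telescope)
  \<comment> \<open>All terms are nonnegative, and the square of indices up to n contains the
    triangle i + j \<le> n, over which each e k with k \<le> n has total coefficient 1.\<close>
  have D_low: "m \<eta> 0 - m \<eta> (Suc n) \<le> D \<eta> {..n}" if \<eta>: "\<eta> \<in> V" for \<eta> n
  proof -
    have "m \<eta> 0 - m \<eta> (Suc n) = (\<Sum>(i, j)\<in>{(i, j). i + j \<le> n}. b i * b j * e \<eta> (i + j))"
      by (simp add: tri tele)
    also have "\<dots> \<le> (\<Sum>(i, j)\<in>{..n} \<times> {..n}. b i * b j * e \<eta> (i + j))"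
      by (intro sum_mono2) (auto simp: b_nonneg e_nonneg[OF \<eta>])
    finally show ?thesis by (simp add: D_def sum.cartesian_product)
  qed
  \<comment> \<open>Indices beyond n involve only e l with l \<ge> n. The square lies in the
    triangle i + j \<le> n + 2 * k, and the sum over the triangle telescopes to at most m n. This
    makes the partial sums of the series Cauchy.\<close>
  have D_up: "D \<eta> {n<..k} \<le> m \<eta> n" if \<eta>: "\<eta> \<in> V" for \<eta> n k
  proof -
    define f where "f l = (if n \<le> l then e \<eta> l else 0)" for l
    have f: "0 \<le> f l" for l by (simp add: f_def e_nonneg[OF \<eta>])
    have "D \<eta> {n<..k} = (\<Sum>(i, j)\<in>{n<..k} \<times> {n<..k}. b i * b j * e \<eta> (i + j))"
      by (simp add: D_def sum.cartesian_product)
    also have "\<dots> = (\<Sum>(i, j)\<in>{n<..k} \<times> {n<..k}. b i * b j * f (i + j))"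
      by (intro sum.cong refl) (auto simp: f_def)
    also have "\<dots> \<le> (\<Sum>(i, j)\<in>{(i, j). i + j \<le> n + 2 * k}. b i * b j * f (i + j))"
      by (intro sum_mono2 fin_tri) (auto simp: b_nonneg f)
    also have "\<dots> = (\<Sum>l\<le>n + 2 * k. f l)" by (rule tri)
    also have "\<dots> = (\<Sum>l\<in>{n..n + 2 * k}. e \<eta> l)"
      by (rule sum.mono_neutral_cong_right) (auto simp: f_def)
    also have "\<dots> = m \<eta> n - m \<eta> (Suc (n + 2 * k))"
      using sum_Suc_diff[of n "n + 2 * k" "\<lambda>i. - m \<eta> i"] by (simp add: e_def)
    also have "\<dots> \<le> m \<eta> n" using m_nonneg[OF \<eta>] by simp
    finally show ?thesis .
  qed
  define Z where "Z \<eta> J = (\<Sum>j\<in>J. sc (of_real (b j)) (Y (T \<eta> j)))" for \<eta> J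
  have ZV: "Z \<eta> J \<in> V" if "\<eta> \<in> V" for \<eta> J using that by (simp add: Z_def sum_mem sc_mem YV TV)
  have nZ: "(nrm (Z \<eta> J))\<^sup>2 = D \<eta> J" if \<eta>: "\<eta> \<in> V" for \<eta> J
  proof -
    have "ip (Z \<eta> J) (Z \<eta> J) = (\<Sum>i\<in>J. \<Sum>j\<in>J. of_real (b i) * (of_real (b j) * of_real (e \<eta> (i + j))))"
      unfolding Z_def using \<eta> by (simp add: ip_sum ip_sum2 ip_sc ip_sc2 sum_mem sc_mem YV TV ipYT sum_distrib_left add.commute)
    also have "\<dots> = of_real (D \<eta> J)" by (simp add: D_def mult.assoc)
    finally show ?thesis using \<eta> by (simp add: nrm_sq ZV)
  qed
  define H where "H n = Z \<Omega> {..n}" for n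
  have HV: "H n \<in> V" for n by (simp add: H_def ZV \<Omega>)
  have Hd: "(nrm (H k - H n))\<^sup>2 \<le> m \<Omega> n" if "n \<le> k" for n k
  proof -
    have un: "{..k} = {..n} \<union> {n<..k}" using that by auto
    have "H k = H n + Z \<Omega> {n<..k}" unfolding H_def Z_def un by (rule sum.union_disjoint) auto
    then show ?thesis using nZ[OF \<Omega>] D_up[OF \<Omega>] by simp
  qed
  have "\<exists>h\<in>V. (\<lambda>n. nrm (H n - h)) \<longlonglongrightarrow> 0"
  proof (rule complete_nrm[OF HV])
    fix d :: real assume d: "d > 0"
    then have "0 < d\<^sup>2" by simp
    then have "eventually (\<lambda>j. m \<Omega> j < d\<^sup>2) sequentially" by (rule order_tendstoD(2)[OF m0])
    then obtain N where N: "\<And>j. j \<ge> N \<Longrightarrow> m \<Omega> j < d\<^sup>2" by (auto simp: eventually_sequentially)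
    have *: "nrm (H k - H n) < d" if "N \<le> n" "n \<le> k" for n k
    proof (rule power2_less_imp_less)
      show "(nrm (H k - H n))\<^sup>2 < d\<^sup>2" using Hd[OF that(2)] N[OF that(1)] by (rule le_less_trans)
    qed (use d in simp)
    show "\<exists>N. \<forall>i\<ge>N. \<forall>j\<ge>N. nrm (H i - H j) < d"
    proof (intro exI allI impI)
      fix i j assume "i \<ge> N" "j \<ge> N"
      then show "nrm (H i - H j) < d"
        using *[of i j] *[of j i] nrm_diff_commute[OF HV HV, of i j] by (metis nle_le)
    qed
  qed
  then obtain h where h: "h \<in> V" and Hh: "(\<lambda>n. nrm (H n - h)) \<longlonglongrightarrow> 0" by blast
  show thesis
  proof (rule that[OF h])
    fix Q Q' assume Q: "adjoint_pair Q Q'" and QY: "\<And>x. x \<in> V \<Longrightarrow> eqv (Q (Y x)) (Y x)"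
    note QV = adjoint_pairD(1)[OF Q]
    have QH: "eqv (Q (H n)) (H n)" for n
    proof -
      have "eqv (Q (H n)) (\<Sum>j\<le>n. sc (of_real (b j)) (Q (Y (T \<Omega> j))))"
        unfolding H_def Z_def using \<Omega> by (intro adjoint_sum_sc[OF Q]) (simp add: YV TV)
      also have "eqv \<dots> (H n)"
        unfolding H_def Z_def using \<Omega> by (intro eqv_sum) (auto intro!: eqv_sc QY simp: sc_mem QV YV TV)
      finally show ?thesis .
    qed
    show "eqv (Q h) h" unfolding eqv_def
    proof
      fix z assume z: "z \<in> V"
      have "(\<lambda>n. ip (H n) (Q' z)) \<longlonglongrightarrow> ip h (Q' z)"
        by (intro ip_tendsto HV h Hh adjoint_pairD(2)[OF Q] z)
      moreover have "ip (H n) (Q' z) = ip (H n) z" for n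
        using QH[of n] z adjoint_pairD(3)[OF Q HV z, of n] unfolding eqv_def by metis
      ultimately have "(\<lambda>n. ip (H n) z) \<longlonglongrightarrow> ip h (Q' z)" by simp
      then show "ip (Q h) z = ip h z"
        using ip_tendsto[OF HV h z Hh] LIMSEQ_unique adjoint_pairD(3)[OF Q h z] by metis
    qed
  next
    fix A A' c assume A: "adjoint_pair A A'" and bd: "\<And>x. x \<in> V \<Longrightarrow> nrm (A x) \<le> c * nrm x"
      and AX: "\<And>x. x \<in> V \<Longrightarrow> eqv (A (X x)) (X (A x))" and AY: "\<And>x. x \<in> V \<Longrightarrow> eqv (A (Y x)) (Y (A x))"
    note AV = adjoint_pairD(1)[OF A]
    \<comment> \<open>A commutes with X and Y, hence with S, so it carries the series for \<Omega>
      to the series for A \<Omega>, and \<open>D_low\<close> can be applied at A \<Omega>.\<close>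
    have AS: "eqv (A (S x)) (S (A x))" if x: "x \<in> V" for x
    proof -
      have "eqv (A (S x)) (A x - A (X (Y x)))"
        unfolding S_def using x by (intro adjoint_diff[OF A]) (auto simp: XV YV)
      also have "eqv \<dots> (A x - X (A (Y x)))"
        using x by (intro eqv_diff AX) (auto simp: AV XV YV)
      also have "eqv \<dots> (S (A x))" unfolding S_def
        using x by (intro eqv_diff adjoint_eqv[OF XY] AY) (auto simp: AV XV YV)
      finally show ?thesis .
    qed
    have Seqv: "eqv (S x) (S y)" if "eqv x y" "x \<in> V" "y \<in> V" for x y
      using that ipS SV by (simp add: eqv_def)
    have AT: "eqv (A (T \<Omega> j)) (T (A \<Omega>) j)" for j
    proof (induction j)
      case (Suc j)
      have "eqv (A (T \<Omega> (Suc j))) (S (A (T \<Omega> j)))" using AS[OF TV[OF \<Omega>]] by (simp add: TS)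
      also have "eqv \<dots> (S (T (A \<Omega>) j))" using Suc \<Omega> by (intro Seqv) (auto simp: AV TV)
      finally show ?case by (simp add: TS)
    qed (simp add: T0)
    have AO: "A \<Omega> \<in> V" using AV \<Omega> by blast
    have AH: "eqv (A (H n)) (Z (A \<Omega>) {..n})" for n
    proof -
      have "eqv (A (H n)) (\<Sum>j\<le>n. sc (of_real (b j)) (A (Y (T \<Omega> j))))"
        unfolding H_def Z_def using \<Omega> by (intro adjoint_sum_sc[OF A]) (simp add: YV TV)
      also have "eqv \<dots> (Z (A \<Omega>) {..n})" unfolding Z_def
      proof (intro eqv_sum conjI eqv_sc)
        fix j
        have "eqv (A (Y (T \<Omega> j))) (Y (A (T \<Omega> j)))" using \<Omega> by (intro AY TV)
        also have "eqv \<dots> (Y (T (A \<Omega>) j))" using \<Omega> AO by (intro adjoint_eqv[OF YX] AT AV TV)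
        finally show "eqv (A (Y (T \<Omega> j))) (Y (T (A \<Omega>) j))" .
      qed (use \<Omega> AO in \<open>auto simp: AV YV TV sc_mem\<close>)
      finally show ?thesis .
    qed
    have low: "m (A \<Omega>) 0 - m (A \<Omega>) (Suc n) \<le> (nrm (A (H n)))\<^sup>2" for n
    proof -
      have "nrm (A (H n)) = nrm (Z (A \<Omega>) {..n})" by (intro eqv_nrm AH AV HV ZV AO)
      then have "(nrm (A (H n)))\<^sup>2 = D (A \<Omega>) {..n}" unfolding nZ[OF AO, symmetric] by (rule arg_cong)
      then show ?thesis using D_low[OF AO, of n] by (simp only:)
    qed
    have nT0: "(\<lambda>j. nrm (T \<Omega> j)) \<longlonglongrightarrow> 0"
    proof -
      have "(\<lambda>j. sqrt (m \<Omega> (j + j))) \<longlonglongrightarrow> sqrt 0"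
        by (intro tendsto_real_sqrt LIMSEQ_subseq_LIMSEQ[OF m0, unfolded comp_def]) (auto simp: strict_mono_def)
      moreover have "sqrt (m \<Omega> (j + j)) = nrm (T \<Omega> j)" for j
        using nT[OF \<Omega>, of j] \<Omega> by (metis TV nrm_nonneg real_sqrt_unique)
      ultimately show ?thesis by simp
    qed
    \<comment> \<open>Boundedness of A transports the convergence S^j \<Omega> \<rightarrow> 0 to A
      \<Omega>, so the telescoped lower bound tends to the full \<parallel>A
      \<Omega>\<parallel>^2.\<close>
    have mA: "m (A \<Omega>) \<longlonglongrightarrow> 0"
    proof (rule Lim_null_comparison)
      show "(\<lambda>j. c * nrm (T \<Omega> j) * nrm (A \<Omega>)) \<longlonglongrightarrow> 0"
        using tendsto_mult_left[OF tendsto_mult_right[OF nT0, of "nrm (A \<Omega>)"], of c] by (simp add: mult.assoc)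
      show "\<forall>\<^sub>F j in sequentially. norm (m (A \<Omega>) j) \<le> c * nrm (T \<Omega> j) * nrm (A \<Omega>)"
      proof (intro always_eventually allI)
        fix j
        have "norm (m (A \<Omega>) j) \<le> cmod (ip (T (A \<Omega>) j) (A \<Omega>))" by (simp add: m_def abs_Re_le_cmod)
        also have "\<dots> \<le> nrm (T (A \<Omega>) j) * nrm (A \<Omega>)" by (intro Cauchy_Schwarz TV AO)
        also have "nrm (T (A \<Omega>) j) = nrm (A (T \<Omega> j))"
          using eqv_nrm[OF AT[of j]] by (simp add: AV TV AO \<Omega>)
        also have "\<dots> * nrm (A \<Omega>) \<le> c * nrm (T \<Omega> j) * nrm (A \<Omega>)"
          by (intro mult_right_mono bd TV \<Omega> nrm_nonneg AO)
        finally show "norm (m (A \<Omega>) j) \<le> c * nrm (T \<Omega> j) * nrm (A \<Omega>)" .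
      qed
    qed
    have "(\<lambda>n. nrm (A (H n))) \<longlonglongrightarrow> nrm (A h)"
    proof (rule nrm_tendsto)
      show "(\<lambda>n. nrm (A (H n) - A h)) \<longlonglongrightarrow> 0"
      proof (rule Lim_null_comparison)
        show "(\<lambda>n. c * nrm (H n - h)) \<longlonglongrightarrow> 0" using tendsto_mult_left[OF Hh, of c] by simp
        show "\<forall>\<^sub>F n in sequentially. norm (nrm (A (H n) - A h)) \<le> c * nrm (H n - h)"
        proof (intro always_eventually allI)
          fix n
          have "nrm (A (H n) - A h) = nrm (A (H n - h))"
            using adjoint_diff[OF A HV h, of n] by (intro eqv_nrm) (auto intro: eqv_sym simp: AV HV h diff_mem)
          also have "\<dots> \<le> c * nrm (H n - h)" by (intro bd diff_mem HV h)
          finally show "norm (nrm (A (H n) - A h)) \<le> c * nrm (H n - h)" by (simp add: AV HV h diff_mem)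
        qed
      qed
    qed (auto simp: AV HV h)
    then have lim1: "(\<lambda>n. (nrm (A (H n)))\<^sup>2) \<longlonglongrightarrow> (nrm (A h))\<^sup>2" by (rule tendsto_power)
    have lim2: "(\<lambda>n. m (A \<Omega>) 0 - m (A \<Omega>) (Suc n)) \<longlonglongrightarrow> m (A \<Omega>) 0 - 0"
      by (intro tendsto_diff tendsto_const LIMSEQ_Suc mA)
    have "m (A \<Omega>) 0 - 0 \<le> (nrm (A h))\<^sup>2" using low by (intro LIMSEQ_le[OF lim2 lim1]) blast
    moreover have "m (A \<Omega>) 0 = (nrm (A \<Omega>))\<^sup>2" unfolding m_def T0 nrm_sq[OF AO] ..
    ultimately have "(nrm (A \<Omega>))\<^sup>2 \<le> (nrm (A h))\<^sup>2" by simp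
    then show "nrm (A \<Omega>) \<le> nrm (A h)" by (rule power2_le_imp_le) (intro nrm_nonneg AV h)
  qed
qed

end

lemma mult_le_sum_squares: "a * b \<le> a\<^sup>2 + b\<^sup>2" for a b :: real
proof -
  have "2 * (a * b) \<le> a\<^sup>2 + b\<^sup>2" using sum_squares_bound[of a b] by (simp add: mult.assoc)
  moreover have "0 \<le> a\<^sup>2 + b\<^sup>2" by simp
  ultimately show ?thesis by linarith
qed

section \<open>Square summable sequences in a complete semi-inner product space\<close>

context semi_hilbert
begin

text \<open>The Hilbert direct sum of countably many copies of V, that is, \<ell>^2 \<otimes>
  V.\<close>

definition l2V :: "(nat \<Rightarrow> 'v) set" where
  "l2V = {F. (\<forall>n. F n \<in> V) \<and> summable (\<lambda>n. (nrm (F n))\<^sup>2)}"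

definition l2sc :: "complex \<Rightarrow> (nat \<Rightarrow> 'v) \<Rightarrow> nat \<Rightarrow> 'v" where
  "l2sc a F = (\<lambda>n. sc a (F n))"

definition l2ip :: "(nat \<Rightarrow> 'v) \<Rightarrow> (nat \<Rightarrow> 'v) \<Rightarrow> complex" where
  "l2ip F G = (\<Sum>n. ip (F n) (G n))"

lemma l2V_D: "F \<in> l2V \<Longrightarrow> F n \<in> V" "F \<in> l2V \<Longrightarrow> summable (\<lambda>n. (nrm (F n))\<^sup>2)"
  by (simp_all add: l2V_def)

lemma l2_summable_ip:
  assumes "F \<in> l2V" "G \<in> l2V"
  shows "summable (\<lambda>n. ip (F n) (G n))"
proof (rule summable_comparison_test')
  show "summable (\<lambda>n. (nrm (F n))\<^sup>2 + (nrm (G n))\<^sup>2)"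
    using assms by (intro summable_add l2V_D)
  fix n :: nat
  have "cmod (ip (F n) (G n)) \<le> nrm (F n) * nrm (G n)"
    using assms by (intro Cauchy_Schwarz l2V_D)
  also have "\<dots> \<le> (nrm (F n))\<^sup>2 + (nrm (G n))\<^sup>2"
    by (rule mult_le_sum_squares)
  finally show "cmod (ip (F n) (G n)) \<le> (nrm (F n))\<^sup>2 + (nrm (G n))\<^sup>2" .
qed

lemma l2V_add:
  assumes "F \<in> l2V" "G \<in> l2V"
  shows "F + G \<in> l2V"
  unfolding l2V_def
proof (intro CollectI conjI allI)
  show "(F + G) n \<in> V" for n using assms by (simp add: add_mem l2V_D)
  show "summable (\<lambda>n. (nrm ((F + G) n))\<^sup>2)"
  proof (rule summable_comparison_test')
    show "summable (\<lambda>n. 2 * (nrm (F n))\<^sup>2 + 2 * (nrm (G n))\<^sup>2)"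
      using assms by (intro summable_add summable_mult l2V_D)
    fix n :: nat
    have "(nrm (F n + G n))\<^sup>2 + (nrm (F n - G n))\<^sup>2 = 2 * (nrm (F n))\<^sup>2 + 2 * (nrm (G n))\<^sup>2"
      using assms by (intro parallelogram l2V_D)
    then have "(nrm (F n + G n))\<^sup>2 \<le> 2 * (nrm (F n))\<^sup>2 + 2 * (nrm (G n))\<^sup>2"
      using zero_le_power2[of "nrm (F n - G n)"] by linarith
    then show "norm ((nrm ((F + G) n))\<^sup>2) \<le> 2 * (nrm (F n))\<^sup>2 + 2 * (nrm (G n))\<^sup>2" by simp
  qed
qed

lemma l2V_sc: "F \<in> l2V \<Longrightarrow> l2sc a F \<in> l2V"
  by (auto simp: l2V_def l2sc_def sc_mem nrm_sc power_mult_distrib intro!: summable_mult)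

lemma l2ip_self: "F \<in> l2V \<Longrightarrow> Re (l2ip F F) = (\<Sum>n. (nrm (F n))\<^sup>2)"
  unfolding l2ip_def by (subst Re_suminf) (auto intro: l2_summable_ip simp: nrm_sq l2V_D)

lemma l2_component_le: "F \<in> l2V \<Longrightarrow> (nrm (F n))\<^sup>2 \<le> Re (l2ip F F)"
  using sum_le_suminf[of "\<lambda>n. (nrm (F n))\<^sup>2" "{n}"] by (simp add: l2ip_self l2V_D)

text \<open>For completeness, the components of a Cauchy sequence converge in V; the estimate for
  differences passes to the limit over finitely many components (\<open>part\<close>) and from there
  to the whole series.\<close>

lemma l2_semi_hilbert: "semi_hilbert l2V l2sc l2ip"
proof
  show "0 \<in> l2V" by (simp add: l2V_def zero_mem nrm_zero)
  show "F + G \<in> l2V" if "F \<in> l2V" "G \<in> l2V" for F G using that by (rule l2V_add)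
  show "l2sc a F \<in> l2V" if "F \<in> l2V" for a F using that by (rule l2V_sc)
  show "l2sc (-1) F = - F" for F by (simp add: l2sc_def sc_neg fun_eq_iff)
  show "l2ip (F + G) K = l2ip F K + l2ip G K" if "F \<in> l2V" "G \<in> l2V" "K \<in> l2V" for F G K
  proof -
    have "ip ((F + G) n) (K n) = ip (F n) (K n) + ip (G n) (K n)" for n
      using that by (simp add: ip_add l2V_D)
    then show ?thesis unfolding l2ip_def using that by (simp add: suminf_add[symmetric] l2_summable_ip)
  qed
  show "l2ip (l2sc a F) K = a * l2ip F K" if "F \<in> l2V" "K \<in> l2V" for F K a
  proof -
    have "ip (l2sc a F n) (K n) = a * ip (F n) (K n)" for n
      using that by (simp add: l2sc_def ip_sc l2V_D)
    then show ?thesis unfolding l2ip_def using that by (simp add: suminf_mult l2_summable_ip)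
  qed
  show "l2ip G F = cnj (l2ip F G)" if "F \<in> l2V" "G \<in> l2V" for F G
  proof -
    have "ip (G n) (F n) = cnj (ip (F n) (G n))" for n
      using that by (intro ip_cnj l2V_D)
    moreover have "(\<lambda>n. cnj (ip (F n) (G n))) sums cnj (\<Sum>n. ip (F n) (G n))"
      using summable_sums[OF l2_summable_ip[OF that]] by (simp add: sums_cnj)
    ultimately show ?thesis unfolding l2ip_def by (simp add: sums_unique[symmetric])
  qed
  show "0 \<le> Re (l2ip F F)" if "F \<in> l2V" for F using that by (simp add: l2ip_self suminf_nonneg l2V_D)
next
  fix X :: "nat \<Rightarrow> nat \<Rightarrow> 'v"
  assume X: "\<And>k. X k \<in> l2V"
    and C: "\<And>e. 0 < e \<Longrightarrow> \<exists>N. \<forall>m\<ge>N. \<forall>n\<ge>N. Re (l2ip (X m - X n) (X m - X n)) < e"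
  have neg: "F - G \<in> l2V" if "F \<in> l2V" "G \<in> l2V" for F G
  proof -
    have "l2sc (-1) G = - G" by (simp add: l2sc_def sc_neg fun_eq_iff)
    then show ?thesis using l2V_add[OF that(1) l2V_sc[OF that(2), of "-1"]] by simp
  qed
  have "\<exists>x\<in>V. (\<lambda>k. nrm (X k n - x)) \<longlonglongrightarrow> 0" for n
  proof (rule complete_nrm)
    show "X k n \<in> V" for k by (rule l2V_D[OF X])
    fix e :: real assume e: "e > 0"
    then obtain N where N: "\<forall>k\<ge>N. \<forall>l\<ge>N. Re (l2ip (X k - X l) (X k - X l)) < e\<^sup>2" using C[of "e\<^sup>2"] by auto
    show "\<exists>N. \<forall>k\<ge>N. \<forall>l\<ge>N. nrm (X k n - X l n) < e"
    proof (intro exI allI impI)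
      fix k l assume "k \<ge> N" "l \<ge> N"
      then have "(nrm ((X k - X l) n))\<^sup>2 < e\<^sup>2"
        using N l2_component_le[OF neg[OF X X], of k l n] by (meson le_less_trans)
      then show "nrm (X k n - X l n) < e" using e by (simp add: power2_less_imp_less)
    qed
  qed
  then obtain F where FV: "\<And>n. F n \<in> V" and F: "\<And>n. (\<lambda>k. nrm (X k n - F n)) \<longlonglongrightarrow> 0"
    by metis
  have XV: "X k n \<in> V" for k n by (rule l2V_D[OF X])
  have main: "\<exists>N. \<forall>k\<ge>N. X k - F \<in> l2V \<and> Re (l2ip (X k - F) (X k - F)) \<le> e" if e: "e > 0" for e
  proof -
    obtain N where N: "\<forall>k\<ge>N. \<forall>l\<ge>N. Re (l2ip (X k - X l) (X k - X l)) < e" using C[OF e] by auto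
    have "X k - F \<in> l2V \<and> Re (l2ip (X k - F) (X k - F)) \<le> e" if k: "k \<ge> N" for k
    proof -
      have part: "(\<Sum>n<J. (nrm (X k n - F n))\<^sup>2) \<le> e" for J
      proof (rule LIMSEQ_le_const2)
        show "(\<lambda>l. \<Sum>n<J. (nrm (X k n - X l n))\<^sup>2) \<longlonglongrightarrow> (\<Sum>n<J. (nrm (X k n - F n))\<^sup>2)"
        proof (intro tendsto_sum tendsto_power nrm_tendsto diff_mem XV FV)
          fix n
          have "X k n - X l n - (X k n - F n) = - (X l n - F n)" for l by simp
          then have "nrm (X k n - X l n - (X k n - F n)) = nrm (X l n - F n)" for l
            using nrm_neg[OF diff_mem[OF XV[of l n] FV[of n]]] by metis
          then show "(\<lambda>l. nrm (X k n - X l n - (X k n - F n))) \<longlonglongrightarrow> 0" using F[of n] by simp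
        qed
        show "\<exists>N. \<forall>l\<ge>N. (\<Sum>n<J. (nrm (X k n - X l n))\<^sup>2) \<le> e"
        proof (intro exI allI impI)
          fix l assume l: "l \<ge> N"
          have "(\<Sum>n<J. (nrm ((X k - X l) n))\<^sup>2) \<le> (\<Sum>n. (nrm ((X k - X l) n))\<^sup>2)"
            by (intro sum_le_suminf l2V_D neg X) auto
          also have "\<dots> = Re (l2ip (X k - X l) (X k - X l))" by (rule l2ip_self[symmetric, OF neg[OF X X]])
          also have "\<dots> \<le> e" using N k l by (meson less_imp_le)
          finally show "(\<Sum>n<J. (nrm (X k n - X l n))\<^sup>2) \<le> e" by simp
        qed
      qed
      have mem: "X k - F \<in> l2V"
        unfolding l2V_def using part XV FV by (auto intro!: summableI_nonneg_bounded[where x = e] diff_mem)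
      moreover have "(\<Sum>n. (nrm ((X k - F) n))\<^sup>2) \<le> e"
        using part by (intro suminf_le_const l2V_D mem) auto
      ultimately show ?thesis by (simp add: l2ip_self)
    qed
    then show ?thesis by blast
  qed
  have Fl: "F \<in> l2V"
  proof -
    obtain N where "X N - F \<in> l2V" using main[of 1] by auto
    then have "X N - (X N - F) \<in> l2V" by (rule neg[OF X])
    then show ?thesis by simp
  qed
  show "\<exists>x\<in>l2V. (\<lambda>n. Re (l2ip (X n - x) (X n - x))) \<longlonglongrightarrow> 0"
  proof (intro bexI[OF _ Fl] LIMSEQ_I)
    fix e :: real assume e: "e > 0"
    then obtain N where "\<forall>k\<ge>N. X k - F \<in> l2V \<and> Re (l2ip (X k - F) (X k - F)) \<le> e / 2" using main[of "e/2"] by auto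
    moreover have "0 \<le> Re (l2ip G G)" if "G \<in> l2V" for G using that by (simp add: l2ip_self suminf_nonneg l2V_D)
    ultimately show "\<exists>N. \<forall>k\<ge>N. norm (Re (l2ip (X k - F) (X k - F)) - 0) < e"
      using e by (intro exI[of _ N]) force
  qed
qed

end

section \<open>The space of square integrable functions\<close>

lemma L2_funD:
  assumes "f \<in> L2_fun M"
  shows "f \<in> borel_measurable M" "integrable M (\<lambda>x. (cmod (f x))\<^sup>2)"
  using assms by (auto simp: L2_fun_def)

lemma L2_fun_iff_nn:
  "f \<in> L2_fun M \<longleftrightarrow> f \<in> borel_measurable M \<and> (\<integral>\<^sup>+x. ennreal ((cmod (f x))\<^sup>2) \<partial>M) < \<infinity>"
  by (auto simp: L2_fun_def integrable_iff_bounded)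

lemma L2_fun_bound:
  assumes "f \<in> borel_measurable M" "integrable M g" "\<And>x. x \<in> space M \<Longrightarrow> (cmod (f x))\<^sup>2 \<le> g x"
  shows "f \<in> L2_fun M"
proof -
  have "0 \<le> g x" if "x \<in> space M" for x using assms(3)[OF that] zero_le_power2[of "cmod (f x)"] by linarith
  then have "integrable M (\<lambda>x. (cmod (f x))\<^sup>2)"
    using assms by (intro Bochner_Integration.integrable_bound[OF assms(2)]) (auto intro!: AE_I2)
  then show ?thesis using assms by (simp add: L2_fun_def)
qed

lemma cmod_add_sq_le: "(cmod (a + b))\<^sup>2 \<le> 2 * (cmod a)\<^sup>2 + 2 * (cmod b)\<^sup>2"
proof -
  have "(cmod (a + b))\<^sup>2 \<le> (cmod a + cmod b)\<^sup>2" by (intro power_mono norm_triangle_ineq) simp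
  moreover have "0 \<le> (cmod a - cmod b)\<^sup>2" by simp
  ultimately show ?thesis by (simp add: power2_sum power2_diff)
qed

lemma L2_fun_add:
  assumes f: "f \<in> L2_fun M" and g: "g \<in> L2_fun M"
  shows "f + g \<in> L2_fun M"
proof (rule L2_fun_bound)
  note [measurable] = L2_funD(1)[OF f] L2_funD(1)[OF g]
  show "f + g \<in> borel_measurable M" unfolding plus_fun_def by measurable
  show "integrable M (\<lambda>x. 2 * (cmod (f x))\<^sup>2 + 2 * (cmod (g x))\<^sup>2)"
    by (intro Bochner_Integration.integrable_add integrable_mult_right L2_funD(2) f g)
qed (simp add: cmod_add_sq_le)

lemma L2_fun_scale:
  assumes f: "f \<in> L2_fun M"
  shows "(\<lambda>x. a * f x) \<in> L2_fun M"
  using L2_funD[OF f] by (auto simp: L2_fun_def norm_mult power_mult_distrib)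

lemma borel_measurable_cnj [measurable]: "cnj \<in> borel_measurable borel"
  by (intro borel_measurable_continuous_onI continuous_intros)

lemma L2_fun_integrable_inner:
  assumes f: "f \<in> L2_fun M" and g: "g \<in> L2_fun M"
  shows "integrable M (\<lambda>x. f x * cnj (g x))"
proof (rule Bochner_Integration.integrable_bound)
  note [measurable] = L2_funD(1)[OF f] L2_funD(1)[OF g]
  show "integrable M (\<lambda>x. (cmod (f x))\<^sup>2 + (cmod (g x))\<^sup>2)"
    by (intro Bochner_Integration.integrable_add L2_funD(2) f g)
  show "(\<lambda>x. f x * cnj (g x)) \<in> borel_measurable M" by measurable
  show "AE x in M. norm (f x * cnj (g x)) \<le> norm ((cmod (f x))\<^sup>2 + (cmod (g x))\<^sup>2)"
  proof (rule AE_I2)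
    fix x
    have "cmod (f x) * cmod (g x) \<le> (cmod (f x))\<^sup>2 + (cmod (g x))\<^sup>2" by (rule mult_le_sum_squares)
    then show "norm (f x * cnj (g x)) \<le> norm ((cmod (f x))\<^sup>2 + (cmod (g x))\<^sup>2)" by (simp add: norm_mult)
  qed
qed

lemma Re_L2_inner_self: "f \<in> L2_fun M \<Longrightarrow> Re (L2_inner M f f) = (\<integral>x. (cmod (f x))\<^sup>2 \<partial>M)"
proof -
  assume "f \<in> L2_fun M"
  have "L2_inner M f f = (\<integral>x. complex_of_real ((cmod (f x))\<^sup>2) \<partial>M)"
    unfolding L2_inner_def by (simp only: complex_norm_square)
  then show ?thesis by (simp only: integral_complex_of_real Re_complex_of_real)
qed

lemma nn_L2: "f \<in> L2_fun M \<Longrightarrow> (\<integral>\<^sup>+x. ennreal ((cmod (f x))\<^sup>2) \<partial>M) = ennreal (Re (L2_inner M f f))"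
  by (simp add: Re_L2_inner_self nn_integral_eq_integral L2_funD)

text \<open>Riesz-Fischer for representatives: the limit has to be an actual measurable function,
  and it is the pointwise limit of a rapidly converging subsequence.\<close>

lemma L2_complete:
  assumes X: "\<And>n. X n \<in> L2_fun M"
    and C: "\<And>e. 0 < e \<Longrightarrow> \<exists>N. \<forall>m\<ge>N. \<forall>n\<ge>N. Re (L2_inner M (X m - X n) (X m - X n)) < e"
  shows "\<exists>f\<in>L2_fun M. (\<lambda>n. Re (L2_inner M (X n - f) (X n - f))) \<longlonglongrightarrow> 0"
proof -
  note Xm [measurable] = L2_funD(1)[OF X]
  have diff: "f - g \<in> L2_fun M" if "f \<in> L2_fun M" "g \<in> L2_fun M" for f g :: "'a \<Rightarrow> complex"
  proof -
    have "f - g = f + (\<lambda>x. (-1) * g x)" by (simp add: fun_eq_iff)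
    then show ?thesis using L2_fun_add[OF that(1) L2_fun_scale[OF that(2)]] by metis
  qed
  define d where "d m n = (\<integral>\<^sup>+x. ennreal ((cmod (X m x - X n x))\<^sup>2) \<partial>M)" for m n
  have d: "d m n = ennreal (Re (L2_inner M (X m - X n) (X m - X n)))" for m n
    using nn_L2[OF diff[OF X X], of m n] by (simp add: d_def)
  have "\<exists>N. \<forall>m\<ge>N. \<forall>n\<ge>N. d m n < ennreal ((1/4) ^ k)" for k
  proof -
    have "(0::real) < (1/4) ^ k" by simp
    then show ?thesis using C[of "(1/4) ^ k"] unfolding d by (meson ennreal_lessI)
  qed
  then obtain N where N: "\<And>k m n. m \<ge> N k \<Longrightarrow> n \<ge> N k \<Longrightarrow> d m n < ennreal ((1/4) ^ k)" by metis
  \<comment> \<open>r k dominates N i for all i \<le> k, so consecutive terms of the subsequence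
    differ by less than (1/4)^k in squared norm.\<close>
  define r where "r k = (\<Sum>i\<le>k. N i) + k" for k
  have rN: "N k \<le> r j" if "k \<le> j" for k j
  proof -
    have "N k \<le> (\<Sum>i\<le>j. N i)" using that by (intro member_le_sum) auto
    then show ?thesis by (simp add: r_def)
  qed
  define g where "g k x = cmod (X (r (Suc k)) x - X (r k) x)" for k x
  have gm [measurable]: "g k \<in> borel_measurable M" for k unfolding g_def by measurable
  \<comment> \<open>Against (1/4)^k the weight 2^k still leaves a convergent series. Finiteness
    almost everywhere then bounds g k x by a constant times 2^(-k/2), which is summable.\<close>
  have "(\<integral>\<^sup>+x. (\<Sum>k. ennreal (2 ^ k * (g k x)\<^sup>2)) \<partial>M) = (\<Sum>k. \<integral>\<^sup>+x. ennreal (2 ^ k * (g k x)\<^sup>2) \<partial>M)"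
    by (intro nn_integral_suminf) measurable
  also have "\<dots> = (\<Sum>k. ennreal (2 ^ k) * d (r (Suc k)) (r k))"
    by (simp add: d_def g_def ennreal_mult nn_integral_cmult)
  also have "\<dots> \<le> (\<Sum>k. ennreal ((1/2) ^ k))"
  proof (intro suminf_le allI)
    fix k
    have "ennreal (2 ^ k) * d (r (Suc k)) (r k) \<le> ennreal (2 ^ k) * ennreal ((1/4) ^ k)"
      by (intro mult_left_mono less_imp_le[OF N[OF rN rN]]) auto
    also have "\<dots> = ennreal ((1/2) ^ k)"
      by (simp add: ennreal_mult[symmetric] power_mult_distrib[symmetric])
    finally show "ennreal (2 ^ k) * d (r (Suc k)) (r k) \<le> ennreal ((1/2) ^ k)" .
  qed auto
  also have "\<dots> = ennreal (\<Sum>k. (1/2) ^ k)"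
    by (intro suminf_ennreal2) (auto simp: summable_geometric)
  also have "\<dots> < \<infinity>" by simp
  finally have fin: "(\<integral>\<^sup>+x. (\<Sum>k. ennreal (2 ^ k * (g k x)\<^sup>2)) \<partial>M) < \<infinity>" .
  have "AE x in M. (\<Sum>k. ennreal (2 ^ k * (g k x)\<^sup>2)) \<noteq> \<infinity>"
    using fin by (intro nn_integral_noteq_infinite) auto
  then have conv: "AE x in M. convergent (\<lambda>k. X (r k) x)"
  proof eventually_elim
    case (elim x)
    define S where "S = enn2real (\<Sum>k. ennreal (2 ^ k * (g k x)\<^sup>2))"
    have gb: "g k x \<le> sqrt S * sqrt (1/2) ^ k" for k
    proof -
      have "ennreal (2 ^ k * (g k x)\<^sup>2) \<le> (\<Sum>k. ennreal (2 ^ k * (g k x)\<^sup>2))"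
      proof -
        define F where "F k = ennreal (2 ^ k * (g k x)\<^sup>2)" for k
        have "sum F {k} \<le> suminf F" by (intro sum_le_suminf summableI) auto
        then show ?thesis by (simp add: F_def[symmetric])
      qed
      also have "\<dots> = ennreal S"
        unfolding S_def using elim unfolding infinity_ennreal_def less_top by (rule ennreal_enn2real[symmetric])
      finally have "2 ^ k * (g k x)\<^sup>2 \<le> S" by (simp add: S_def)
      then have "(g k x)\<^sup>2 \<le> S * (1/2) ^ k" by (simp add: field_simps)
      then have "g k x \<le> sqrt (S * (1/2) ^ k)" by (rule real_le_rsqrt)
      then show ?thesis by (simp add: real_sqrt_mult real_sqrt_power)
    qed
    have "summable (\<lambda>k. g k x)"
    proof (rule summable_comparison_test')
      have "sqrt (1/2) < sqrt (1 :: real)" by (rule real_sqrt_less_mono) simp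
      then show "summable (\<lambda>k. sqrt S * sqrt (1/2) ^ k)" by (intro summable_mult summable_geometric) simp
      show "norm (g k x) \<le> sqrt S * sqrt (1/2) ^ k" for k using gb[of k] by (simp add: g_def)
    qed
    then have "summable (\<lambda>k. X (r (Suc k)) x - X (r k) x)"
      unfolding g_def by (rule summable_norm_cancel)
    then obtain s where "(\<lambda>n. \<Sum>k<n. X (r (Suc k)) x - X (r k) x) \<longlonglongrightarrow> s"
      by (auto simp: summable_def sums_def)
    then have "(\<lambda>n. X (r n) x - X (r 0) x) \<longlonglongrightarrow> s"
      using sum_lessThan_telescope[of "\<lambda>k. X (r k) x"] by simp
    then have "(\<lambda>n. (X (r n) x - X (r 0) x) + X (r 0) x) \<longlonglongrightarrow> s + X (r 0) x"
      by (intro tendsto_add tendsto_const)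
    then show ?case by (auto simp: convergent_def)
  qed
  define f where "f x = lim (\<lambda>k. X (r k) x)" for x
  have fm [measurable]: "f \<in> borel_measurable M" unfolding f_def[abs_def]
    by (rule borel_measurable_lim_metric) measurable
  \<comment> \<open>Fatou's lemma along the subsequence. The integral is nonnegative extended, since
    integrability of f is only deduced from this estimate.\<close>
  have fb: "(\<integral>\<^sup>+x. ennreal ((cmod (X n x - f x))\<^sup>2) \<partial>M) \<le> ennreal ((1/4) ^ k)" if n: "n \<ge> N k" for n k
  proof -
    have "(\<integral>\<^sup>+x. ennreal ((cmod (X n x - f x))\<^sup>2) \<partial>M)
        = (\<integral>\<^sup>+x. liminf (\<lambda>j. ennreal ((cmod (X n x - X (r j) x))\<^sup>2)) \<partial>M)"
    proof (rule nn_integral_cong_AE)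
      show "AE x in M. ennreal ((cmod (X n x - f x))\<^sup>2) = liminf (\<lambda>j. ennreal ((cmod (X n x - X (r j) x))\<^sup>2))"
        using conv
      proof eventually_elim
        case (elim x)
        then have "(\<lambda>j. X (r j) x) \<longlonglongrightarrow> f x" by (simp add: f_def convergent_LIMSEQ_iff)
        then have "(\<lambda>j. ennreal ((cmod (X n x - X (r j) x))\<^sup>2)) \<longlonglongrightarrow> ennreal ((cmod (X n x - f x))\<^sup>2)"
          by (intro tendsto_intros)
        then show ?case by (intro lim_imp_Liminf[symmetric]) auto
      qed
    qed
    also have "\<dots> \<le> liminf (\<lambda>j. d n (r j))"
      unfolding d_def by (intro nn_integral_liminf) measurable
    also have "\<dots> \<le> liminf (\<lambda>j. ennreal ((1/4) ^ k))"
    proof (intro Liminf_mono eventually_sequentiallyI[of k])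
      fix j assume "k \<le> j"
      then show "d n (r j) \<le> ennreal ((1/4) ^ k)" using N[OF n rN] by (intro less_imp_le) auto
    qed
    also have "\<dots> = ennreal ((1/4) ^ k)" by (simp add: Liminf_const)
    finally show ?thesis .
  qed
  have dX: "X n - f \<in> L2_fun M" if n: "n \<ge> N k" for n k
  proof -
    have "(\<integral>\<^sup>+x. ennreal ((cmod ((X n - f) x))\<^sup>2) \<partial>M) < \<infinity>" using fb[OF n] by (simp add: le_less_trans)
    moreover have "X n - f \<in> borel_measurable M" unfolding fun_diff_def by measurable
    ultimately show ?thesis by (simp add: L2_fun_iff_nn)
  qed
  have f: "f \<in> L2_fun M"
  proof -
    have "X (N 0) - (X (N 0) - f) \<in> L2_fun M" by (intro diff X dX[of 0]) simp
    then show ?thesis by simp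
  qed
  show ?thesis
  proof (intro bexI[OF _ f] LIMSEQ_I)
    fix e :: real assume e: "e > 0"
    obtain k where k: "(1/4) ^ k < e" using real_arch_pow_inv[OF e, of "1/4"] by auto
    show "\<exists>n0. \<forall>n\<ge>n0. norm (Re (L2_inner M (X n - f) (X n - f)) - 0) < e"
    proof (intro exI allI impI)
      fix n assume n: "n \<ge> N k"
      have "ennreal (Re (L2_inner M (X n - f) (X n - f))) \<le> ennreal ((1/4) ^ k)"
        using fb[OF n] nn_L2[OF dX[OF n]] by simp
      then have "Re (L2_inner M (X n - f) (X n - f)) \<le> (1/4) ^ k" by (simp add: ennreal_le_iff)
      moreover have "0 \<le> Re (L2_inner M (X n - f) (X n - f))" by (simp add: Re_L2_inner_self[OF dX[OF n]])
      ultimately show "norm (Re (L2_inner M (X n - f) (X n - f)) - 0) < e" using k by simp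
    qed
  qed
qed

lemma L2_semi_hilbert: "semi_hilbert (L2_fun M) (\<lambda>a f x. a * f x) (L2_inner M)"
proof
  show "0 \<in> L2_fun M" by (simp add: L2_fun_def zero_fun_def)
  show "f + g \<in> L2_fun M" if "f \<in> L2_fun M" "g \<in> L2_fun M" for f g :: "'a \<Rightarrow> complex" using that by (rule L2_fun_add)
  show "(\<lambda>x. a * f x) \<in> L2_fun M" if "f \<in> L2_fun M" for f :: "'a \<Rightarrow> complex" and a using that by (rule L2_fun_scale)
  show "(\<lambda>x. - 1 * f x) = - f" for f :: "'a \<Rightarrow> complex" by (simp add: fun_eq_iff)
  show "L2_inner M (f + g) h = L2_inner M f h + L2_inner M g h"
    if "f \<in> L2_fun M" "g \<in> L2_fun M" "h \<in> L2_fun M" for f g h :: "'a \<Rightarrow> complex"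
    using that by (simp add: L2_inner_def distrib_right Bochner_Integration.integral_add L2_fun_integrable_inner)
  show "L2_inner M (\<lambda>x. a * f x) h = a * L2_inner M f h"
    if "f \<in> L2_fun M" "h \<in> L2_fun M" for a and f h :: "'a \<Rightarrow> complex"
    using that by (simp add: L2_inner_def mult.assoc)
  show "L2_inner M g f = cnj (L2_inner M f g)"
    if "f \<in> L2_fun M" "g \<in> L2_fun M" for f g :: "'a \<Rightarrow> complex"
    using Bochner_Integration.integral_cnj[of M "\<lambda>x. f x * cnj (g x)"] by (simp add: L2_inner_def mult.commute)
  show "0 \<le> Re (L2_inner M f f)" if "f \<in> L2_fun M" for f :: "'a \<Rightarrow> complex"
    using that by (simp add: Re_L2_inner_self)
qed (rule L2_complete)

section \<open>The regular representation and the duality with the group von Neumann algebra\<close>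

lemma sum_fun_apply: "(\<Sum>i\<in>I. f i) x = (\<Sum>i\<in>I. f i x)"
  for f :: "'i \<Rightarrow> 'x \<Rightarrow> 'y::comm_monoid_add"
  by (induction I rule: infinite_finite_induct) auto

text \<open>The part of the theory of \<lambda> that involves no topology. Counting measure on the
  subgroup is a second instance (\<open>count_space_left_invariant\<close>), so G and the discrete
  group share these lemmas.\<close>

locale left_invariant_measure = group G for G (structure) +
  fixes M :: "'a measure"
  assumes space_M: "space M = carrier G"
    and l_coset_sets: "x \<in> carrier G \<Longrightarrow> A \<in> sets M \<Longrightarrow> x <# A \<in> sets M"
    and l_coset_emeasure: "x \<in> carrier G \<Longrightarrow> A \<in> sets M \<Longrightarrow> emeasure M (x <# A) = emeasure M A"
begin

sublocale L2: semi_hilbert "L2_fun M" "\<lambda>a f x. a * f x" "L2_inner M"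
  by (rule L2_semi_hilbert)

abbreviation lreg :: "'a \<Rightarrow> ('a \<Rightarrow> complex) \<Rightarrow> 'a \<Rightarrow> complex" where
  "lreg \<equiv> left_regular G"

text \<open>The image under \<lambda> of the group algebra element with coefficients c on F.\<close>

definition lcomb :: "'a set \<Rightarrow> ('a \<Rightarrow> complex) \<Rightarrow> ('a \<Rightarrow> complex) \<Rightarrow> 'a \<Rightarrow> complex" where
  "lcomb F c = (\<lambda>f y. \<Sum>x\<in>F. c x * lreg x f y)"

lemma left_regular_span_iff: "A \<in> left_regular_span G \<longleftrightarrow> (\<exists>F c. A = lcomb F c \<and> finite F \<and> F \<subseteq> carrier G)"
  by (auto simp: left_regular_span_def lcomb_def)

lemma L2_norm_nrm: "f \<in> L2_fun M \<Longrightarrow> L2_norm M f = L2.nrm f"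
  by (simp add: L2_norm_def L2.nrm_def Re_L2_inner_self)

lemma L2_inner_cong:
  assumes "\<And>x. x \<in> carrier G \<Longrightarrow> f x = f' x" "\<And>x. x \<in> carrier G \<Longrightarrow> g x = g' x"
  shows "L2_inner M f g = L2_inner M f' g'"
  unfolding L2_inner_def using assms by (intro Bochner_Integration.integral_cong) (auto simp: space_M)

lemma translation_measurable: "x \<in> carrier G \<Longrightarrow> (\<lambda>y. x \<otimes> y) \<in> measurable M M"
proof (rule measurableI)
  fix A assume x: "x \<in> carrier G" and A: "A \<in> sets M"
  then have AG: "A \<subseteq> carrier G" using sets.sets_into_space space_M by blast
  have "(\<lambda>y. x \<otimes> y) -` A \<inter> space M = inv x <# A"
  proof (intro equalityI subsetI)
    fix y assume "y \<in> (\<lambda>y. x \<otimes> y) -` A \<inter> space M"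
    then have "x \<otimes> y \<in> A" "y = inv x \<otimes> (x \<otimes> y)" using x by (auto simp: space_M m_assoc[symmetric])
    then show "y \<in> inv x <# A" unfolding l_coset_def by blast
  next
    fix y assume "y \<in> inv x <# A"
    then obtain a where a: "a \<in> A" "y = inv x \<otimes> a" by (auto simp: l_coset_def)
    then have "a \<in> carrier G" using AG by blast
    then show "y \<in> (\<lambda>y. x \<otimes> y) -` A \<inter> space M" using a x by (simp add: space_M m_assoc[symmetric])
  qed
  then show "(\<lambda>y. x \<otimes> y) -` A \<inter> space M \<in> sets M" using x A l_coset_sets by simp
qed (simp add: space_M)

lemma distr_translation:
  assumes x: "x \<in> carrier G"
  shows "distr M M (\<lambda>y. x \<otimes> y) = M"
proof (rule measure_eqI)
  fix A assume "A \<in> sets (distr M M (\<lambda>y. x \<otimes> y))"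
  then have A: "A \<in> sets M" by simp
  then have AG: "A \<subseteq> carrier G" using sets.sets_into_space space_M by blast
  define B where "B = (\<lambda>y. x \<otimes> y) -` A \<inter> space M"
  have B: "B \<in> sets M" unfolding B_def by (rule measurable_sets[OF translation_measurable[OF x] A])
  have "x <# B = A"
  proof (intro equalityI subsetI)
    fix a assume a: "a \<in> A"
    then have "inv x \<otimes> a \<in> B" "a = x \<otimes> (inv x \<otimes> a)"
      using AG x by (auto simp: B_def space_M m_assoc[symmetric] subset_iff)
    then show "a \<in> x <# B" unfolding l_coset_def by blast
  qed (auto simp: B_def l_coset_def)
  then have "emeasure M B = emeasure M A" using l_coset_emeasure[OF x B] by simp
  then show "emeasure (distr M M (\<lambda>y. x \<otimes> y)) A = emeasure M A"
    using A by (simp add: emeasure_distr translation_measurable x B_def)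
qed simp

lemma nn_integral_translation:
  assumes "x \<in> carrier G" "g \<in> borel_measurable M"
  shows "(\<integral>\<^sup>+y. g (x \<otimes> y) \<partial>M) = (\<integral>\<^sup>+y. g y \<partial>M)"
proof -
  have "(\<integral>\<^sup>+y. g y \<partial>M) = (\<integral>\<^sup>+y. g y \<partial>distr M M (\<lambda>y. x \<otimes> y))" using distr_translation[OF assms(1)] by simp
  also have "\<dots> = (\<integral>\<^sup>+y. g (x \<otimes> y) \<partial>M)" using assms by (intro nn_integral_distr translation_measurable) auto
  finally show ?thesis by simp
qed

lemma integral_translation:
  fixes g :: "'a \<Rightarrow> complex"
  assumes "x \<in> carrier G" "g \<in> borel_measurable M"
  shows "(\<integral>y. g (x \<otimes> y) \<partial>M) = (\<integral>y. g y \<partial>M)"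
proof -
  have "(\<integral>y. g y \<partial>M) = (\<integral>y. g y \<partial>distr M M (\<lambda>y. x \<otimes> y))" using distr_translation[OF assms(1)] by simp
  also have "\<dots> = (\<integral>y. g (x \<otimes> y) \<partial>M)" using assms by (intro integral_distr translation_measurable) auto
  finally show ?thesis by simp
qed

lemma lreg_L2:
  assumes x: "x \<in> carrier G" and f: "f \<in> L2_fun M"
  shows "lreg x f \<in> L2_fun M"
proof -
  have [measurable]: "lreg x f \<in> borel_measurable M"
    unfolding left_regular_def using measurable_compose[OF translation_measurable[of "inv x"] L2_funD(1)[OF f]] x by simp
  have [measurable]: "f \<in> borel_measurable M" by (rule L2_funD[OF f])
  have "(\<integral>\<^sup>+y. ennreal ((cmod (lreg x f y))\<^sup>2) \<partial>M) = (\<integral>\<^sup>+y. ennreal ((cmod (f y))\<^sup>2) \<partial>M)"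
    unfolding left_regular_def using x by (intro nn_integral_translation) auto
  then show ?thesis using f by (simp add: L2_fun_iff_nn)
qed

lemma lreg_inner:
  assumes x: "x \<in> carrier G" and f: "f \<in> L2_fun M" and g: "g \<in> L2_fun M"
  shows "L2_inner M (lreg x f) (lreg x g) = L2_inner M f g"
proof -
  have [measurable]: "f \<in> borel_measurable M" "g \<in> borel_measurable M" using L2_funD f g by auto
  show ?thesis
    unfolding L2_inner_def left_regular_def using x by (intro integral_translation[of "inv x" "\<lambda>y. f y * cnj (g y)"]) auto
qed

lemma lreg_mult: "x \<in> carrier G \<Longrightarrow> y \<in> carrier G \<Longrightarrow> z \<in> carrier G \<Longrightarrow> lreg x (lreg y f) z = lreg (x \<otimes> y) f z"
  by (simp add: left_regular_def inv_mult_group m_assoc)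

lemma lreg_one: "z \<in> carrier G \<Longrightarrow> lreg \<one> f z = f z"
  by (simp add: left_regular_def)

lemma lreg_adjoint:
  assumes x: "x \<in> carrier G" and f: "f \<in> L2_fun M" and g: "g \<in> L2_fun M"
  shows "L2_inner M (lreg x f) g = L2_inner M f (lreg (inv x) g)"
proof -
  have "L2_inner M (lreg x f) g = L2_inner M (lreg (inv x) (lreg x f)) (lreg (inv x) g)"
    using x f g by (simp add: lreg_inner lreg_L2)
  also have "\<dots> = L2_inner M f (lreg (inv x) g)"
    using x by (intro L2_inner_cong) (simp_all add: lreg_mult lreg_one)
  finally show ?thesis .
qed

lemma lreg_nrm: "x \<in> carrier G \<Longrightarrow> f \<in> L2_fun M \<Longrightarrow> L2.nrm (lreg x f) = L2.nrm f"
  by (simp add: L2.nrm_def lreg_inner)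

lemma lcomb_sum: "lcomb F c f = (\<Sum>x\<in>F. (\<lambda>y. c x * lreg x f y))"
  by (rule ext) (simp add: lcomb_def sum_fun_apply)

lemma lcomb_L2: "F \<subseteq> carrier G \<Longrightarrow> f \<in> L2_fun M \<Longrightarrow> lcomb F c f \<in> L2_fun M"
  unfolding lcomb_sum by (intro L2.sum_mem L2.sc_mem lreg_L2) auto

lemma lcomb_inner: "F \<subseteq> carrier G \<Longrightarrow> f \<in> L2_fun M \<Longrightarrow> g \<in> L2_fun M \<Longrightarrow>
    L2_inner M (lcomb F c f) g = (\<Sum>x\<in>F. c x * L2_inner M (lreg x f) g)"
  unfolding lcomb_sum by (subst L2.ip_sum) (auto intro!: L2.sc_mem lreg_L2 sum.cong L2.ip_sc)

lemma lcomb_bound: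
  assumes "F \<subseteq> carrier G" "f \<in> L2_fun M"
  shows "L2.nrm (lcomb F c f) \<le> (\<Sum>x\<in>F. cmod (c x)) * L2.nrm f"
proof -
  have "L2.nrm (lcomb F c f) \<le> (\<Sum>x\<in>F. L2.nrm (\<lambda>y. c x * lreg x f y))"
    unfolding lcomb_sum using assms by (intro L2.nrm_sum L2.sc_mem lreg_L2) auto
  also have "\<dots> = (\<Sum>x\<in>F. cmod (c x)) * L2.nrm f"
    unfolding sum_distrib_right using assms
    by (intro sum.cong refl) (auto simp: L2.nrm_sc lreg_L2 lreg_nrm subset_iff)
  finally show ?thesis .
qed

lemma lcomb_adjoint:
  assumes F: "finite F" "F \<subseteq> carrier G"
  shows "L2.adjoint_pair (lcomb F c) (lcomb (m_inv G ` F) (\<lambda>x. cnj (c (inv x))))"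
proof -
  have F': "m_inv G ` F \<subseteq> carrier G" using F by auto
  have "L2_inner M (lcomb F c f) g = L2_inner M f (lcomb (m_inv G ` F) (\<lambda>x. cnj (c (inv x))) g)"
    if f: "f \<in> L2_fun M" and g: "g \<in> L2_fun M" for f g
  proof -
    have inj: "inj_on (m_inv G) F" using F by (intro inj_onI) (metis inv_inv subset_iff)
    have "L2_inner M (lcomb (m_inv G ` F) (\<lambda>x. cnj (c (inv x))) g) f = (\<Sum>x\<in>F. cnj (c x) * L2_inner M (lreg (inv x) g) f)"
      using F by (simp add: lcomb_inner F' f g sum.reindex[OF inj]) (auto intro!: sum.cong simp: subset_iff)
    then have "cnj (L2_inner M (lcomb (m_inv G ` F) (\<lambda>x. cnj (c (inv x))) g) f) = (\<Sum>x\<in>F. c x * cnj (L2_inner M (lreg (inv x) g) f))"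
      by simp
    also have "\<dots> = (\<Sum>x\<in>F. c x * L2_inner M (lreg x f) g)"
    proof (intro sum.cong refl)
      fix x assume "x \<in> F"
      then have x: "x \<in> carrier G" using F by blast
      show "c x * cnj (L2_inner M (lreg (inv x) g) f) = c x * L2_inner M (lreg x f) g"
        using lreg_adjoint[OF x f g] L2.ip_cnj[of "lreg (inv x) g" f] x f g by (simp add: lreg_L2)
    qed
    also have "\<dots> = L2_inner M (lcomb F c f) g" using F f g by (simp add: lcomb_inner)
    finally show ?thesis using L2.ip_cnj[of "lcomb (m_inv G ` F) (\<lambda>x. cnj (c (inv x))) g" f] F' f g by (simp add: lcomb_L2)
  qed
  then show ?thesis unfolding L2.adjoint_pair_def using F F' by (auto intro: lcomb_L2)
qed

lemma lcomb_add:
  assumes F: "finite F" "F \<subseteq> carrier G" and F': "finite F'" "F' \<subseteq> carrier G"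
  obtains c'' where "\<And>f. lcomb F c f + lcomb F' c' f = lcomb (F \<union> F') c'' f"
proof -
  define d where "d x = (if x \<in> F then c x else 0) + (if x \<in> F' then c' x else 0)" for x
  have "lcomb F c f + lcomb F' c' f = lcomb (F \<union> F') d f" for f
  proof
    fix y
    have "lcomb (F \<union> F') d f y = (\<Sum>x\<in>F \<union> F'. (if x \<in> F then c x else 0) * lreg x f y) + (\<Sum>x\<in>F \<union> F'. (if x \<in> F' then c' x else 0) * lreg x f y)"
      by (simp add: lcomb_def d_def distrib_right sum.distrib)
    also have "(\<Sum>x\<in>F \<union> F'. (if x \<in> F then c x else 0) * lreg x f y) = lcomb F c f y"
      unfolding lcomb_def using F F' by (intro sum.mono_neutral_cong_right) auto
    also have "(\<Sum>x\<in>F \<union> F'. (if x \<in> F' then c' x else 0) * lreg x f y) = lcomb F' c' f y"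
      unfolding lcomb_def using F F' by (intro sum.mono_neutral_cong_right) auto
    finally show "(lcomb F c f + lcomb F' c' f) y = lcomb (F \<union> F') d f y" by simp
  qed
  then show thesis by (rule that)
qed

lemma lcomb_scale: "(\<lambda>y. a * lcomb F c f y) = lcomb F (\<lambda>x. a * c x) f"
  by (simp add: lcomb_def sum_distrib_left mult.assoc)

lemma lcomb_operator:
  assumes F: "finite F" "F \<subseteq> carrier G"
  shows "lcomb F c \<in> L2_operators M"
  unfolding L2_operators_def
proof (intro CollectI conjI ballI allI)
  show "lcomb F c f \<in> L2_fun M" if "f \<in> L2_fun M" for f using F that by (simp add: lcomb_L2)
  show "AE x in M. lcomb F c (\<lambda>y. a * f y + b * g y) x = a * lcomb F c f x + b * lcomb F c g x" for f g a b
    by (simp add: lcomb_def left_regular_def algebra_simps sum.distrib sum_distrib_left)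
  show "\<exists>C. \<forall>f\<in>L2_fun M. L2_norm M (lcomb F c f) \<le> C * L2_norm M f"
    using lcomb_bound[OF F(2)] F by (intro exI[of _ "\<Sum>x\<in>F. cmod (c x)"]) (simp add: L2_norm_nrm lcomb_L2)
qed

section \<open>Weak operator limits and the norm of the Fourier algebra\<close>

lemma L2_wot_topspace: "topspace (L2_wot M) = L2_operators M"
  by (auto simp: L2_wot_def topspace_pullback_topology)

lemma vN_operator: "A \<in> group_vN_algebra G M \<Longrightarrow> A \<in> L2_operators M"
  unfolding group_vN_algebra_def using closure_of_subset_topspace[of "L2_wot M"] L2_wot_topspace by blast

lemma lcomb_vN:
  assumes F: "finite F" "F \<subseteq> carrier G"
  shows "lcomb F c \<in> group_vN_algebra G M"
proof -
  have "topspace (L2_wot M) \<inter> left_regular_span G \<subseteq> group_vN_algebra G M"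
    unfolding group_vN_algebra_def by (subst closure_of_restrict) (rule closure_of_subset, auto)
  moreover have "lcomb F c \<in> left_regular_span G" using F left_regular_span_iff by blast
  ultimately show ?thesis using lcomb_operator[OF F] L2_wot_topspace by blast
qed

lemma L2_wot_continuous:
  assumes "f \<in> L2_fun M" "g \<in> L2_fun M"
  shows "continuous_map (L2_wot M) euclidean (\<lambda>A. L2_inner M (A f) g)"
proof -
  let ?\<Phi> = "\<lambda>A. restrict (\<lambda>(f, g). L2_inner M (A f) g) (L2_fun M \<times> L2_fun M)"
  have "continuous_map (product_topology (\<lambda>_. euclidean) (L2_fun M \<times> L2_fun M)) euclidean (\<lambda>h. h (f, g) :: complex)"
    using assms by (intro continuous_map_product_projection) auto
  then have "continuous_map (L2_wot M) euclidean ((\<lambda>h. h (f, g)) \<circ> ?\<Phi>)"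
    unfolding L2_wot_def by (rule continuous_map_pullback)
  then show ?thesis using assms by (simp add: comp_def)
qed

text \<open>Both sides are weak operator continuous in A, and they agree on the span of the
  \<lambda>(x). One statement serves twice: with a zero second pair it shows that the pairing is
  well defined, and in general it shows that the pairing is additive in u.\<close>

lemma vN_inner_add:
  assumes L: "f1 \<in> L2_fun M" "g1 \<in> L2_fun M" "f2 \<in> L2_fun M" "g2 \<in> L2_fun M" "f \<in> L2_fun M" "g \<in> L2_fun M"
    and eq: "\<And>x. x \<in> carrier G \<Longrightarrow> L2_inner M (lreg x f1) g1 + L2_inner M (lreg x f2) g2 = L2_inner M (lreg x f) g"
    and A: "A \<in> group_vN_algebra G M"
  shows "L2_inner M (A f1) g1 + L2_inner M (A f2) g2 = L2_inner M (A f) g"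
proof -
  define D where "D A = L2_inner M (A f1) g1 + L2_inner M (A f2) g2 - L2_inner M (A f) g" for A
  have "continuous_map (L2_wot M) euclidean D"
    unfolding D_def by (intro continuous_map_diff continuous_map_add L2_wot_continuous L)
  then have cl: "closedin (L2_wot M) {A \<in> topspace (L2_wot M). D A \<in> {0}}"
    by (rule closedin_continuous_map_preimage) simp
  have "topspace (L2_wot M) \<inter> left_regular_span G \<subseteq> {A \<in> topspace (L2_wot M). D A \<in> {0}}"
  proof
    fix B assume B: "B \<in> topspace (L2_wot M) \<inter> left_regular_span G"
    then obtain F c where F: "B = lcomb F c" "finite F" "F \<subseteq> carrier G" by (auto simp: left_regular_span_iff)
    have "D B = (\<Sum>x\<in>F. c x * (L2_inner M (lreg x f1) g1 + L2_inner M (lreg x f2) g2 - L2_inner M (lreg x f) g))"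
      using F L by (simp add: D_def lcomb_inner sum.distrib[symmetric] sum_subtractf[symmetric] algebra_simps)
    also have "\<dots> = 0" using F eq by (intro sum.neutral) auto
    finally show "B \<in> {A \<in> topspace (L2_wot M). D A \<in> {0}}" using B by simp
  qed
  then have "L2_wot M closure_of left_regular_span G \<subseteq> {A \<in> topspace (L2_wot M). D A \<in> {0}}"
    by (subst closure_of_restrict) (rule closure_of_minimal[OF _ cl])
  then have "D A = 0" using A unfolding group_vN_algebra_def by blast
  then show ?thesis by (simp add: D_def)
qed

lemma L2_zero: "(\<lambda>x. 0) \<in> L2_fun M" "L2_inner M (\<lambda>x. 0) g = 0" "L2_inner M g (\<lambda>x. 0) = 0"
  by (auto simp: L2_fun_def L2_inner_def)

lemma matrix_coefficient_apply: "x \<in> carrier G \<Longrightarrow> matrix_coefficient G M f g x = L2_inner M (lreg x f) g"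
  by (simp add: matrix_coefficient_def zero_extension_def)

lemma fourier_pairing_eq:
  assumes f: "f \<in> L2_fun M" and g: "g \<in> L2_fun M" and A: "A \<in> group_vN_algebra G M"
  shows "fourier_pairing G M (matrix_coefficient G M f g) A = L2_inner M (A f) g"
  unfolding fourier_pairing_def
proof (rule the_equality)
  fix c assume "\<exists>f'\<in>L2_fun M. \<exists>g'\<in>L2_fun M. matrix_coefficient G M f g = matrix_coefficient G M f' g' \<and> c = L2_inner M (A f') g'"
  then obtain f' g' where f': "f' \<in> L2_fun M" "g' \<in> L2_fun M" "matrix_coefficient G M f g = matrix_coefficient G M f' g'"
    and c: "c = L2_inner M (A f') g'" by blast
  \<comment> \<open>Independence of the representing vectors, as the case of a zero second
    summand.\<close>
  have "L2_inner M (A f') g' + L2_inner M (A (\<lambda>x. 0)) (\<lambda>x. 0) = L2_inner M (A f) g"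
  proof (rule vN_inner_add[OF _ _ _ _ f g _ A])
    fix x assume "x \<in> carrier G"
    then show "L2_inner M (lreg x f') g' + L2_inner M (lreg x (\<lambda>x. 0)) (\<lambda>x. 0) = L2_inner M (lreg x f) g"
      using fun_cong[OF f'(3), of x] by (simp add: matrix_coefficient_apply L2_zero)
  qed (use f' L2_zero in auto)
  then show "c = L2_inner M (A f) g" using c by (simp add: L2_zero)
qed (use f g in blast)

lemma opnorm_bound:
  assumes A: "A \<in> L2_operators M" and f: "f \<in> L2_fun M"
  shows "L2_norm M (A f) \<le> L2_opnorm M A * L2_norm M f"
proof -
  let ?S = "{C. 0 \<le> C \<and> (\<forall>f\<in>L2_fun M. L2_norm M (A f) \<le> C * L2_norm M f)}"
  have nn: "0 \<le> L2_norm M g" for g by (simp add: L2_norm_def)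
  obtain C where C: "\<forall>f\<in>L2_fun M. L2_norm M (A f) \<le> C * L2_norm M f" using A by (auto simp: L2_operators_def)
  have "max C 0 \<in> ?S"
  proof (intro CollectI conjI ballI)
    fix g assume g: "g \<in> L2_fun M"
    have "L2_norm M (A g) \<le> C * L2_norm M g" using C g by blast
    also have "\<dots> \<le> max C 0 * L2_norm M g" by (intro mult_right_mono nn) simp
    finally show "L2_norm M (A g) \<le> max C 0 * L2_norm M g" .
  qed simp
  then have ne: "?S \<noteq> {}" by blast
  show ?thesis
  proof (cases "L2_norm M f = 0")
    case True
    then show ?thesis using C f by fastforce
  next
    case False
    then have pos: "0 < L2_norm M f" using nn[of f] by simp
    have "L2_norm M (A f) / L2_norm M f \<le> L2_opnorm M A"
      unfolding L2_opnorm_def using f pos by (intro cInf_greatest ne) (auto simp: divide_le_eq)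
    then show ?thesis using pos by (simp add: divide_le_eq)
  qed
qed

lemma opnorm_le:
  assumes "0 \<le> C" "\<And>f. f \<in> L2_fun M \<Longrightarrow> L2_norm M (A f) \<le> C * L2_norm M f"
  shows "L2_opnorm M A \<le> C"
  unfolding L2_opnorm_def using assms by (intro cInf_lower bdd_belowI[of _ 0]) auto

lemma fourier_pairing_bound:
  assumes f: "f \<in> L2_fun M" and g: "g \<in> L2_fun M" and A: "A \<in> group_vN_algebra G M" "L2_opnorm M A \<le> 1"
  shows "cmod (fourier_pairing G M (matrix_coefficient G M f g) A) \<le> L2.nrm f * L2.nrm g"
proof -
  have Af: "A f \<in> L2_fun M" using vN_operator[OF A(1)] f by (auto simp: L2_operators_def)
  have "L2_norm M (A f) \<le> L2_opnorm M A * L2_norm M f" by (intro opnorm_bound vN_operator A f)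
  also have "\<dots> \<le> 1 * L2_norm M f" by (intro mult_right_mono A) (simp add: L2_norm_def)
  finally have le: "L2.nrm (A f) \<le> L2.nrm f" using Af f by (simp add: L2_norm_nrm)
  have "cmod (L2_inner M (A f) g) \<le> L2.nrm (A f) * L2.nrm g" by (intro L2.Cauchy_Schwarz Af g)
  also have "\<dots> \<le> L2.nrm f * L2.nrm g" using le g by (intro mult_right_mono) auto
  finally show ?thesis by (simp add: fourier_pairing_eq f g A)
qed

lemma fourier_algebraE:
  assumes "u \<in> fourier_algebra G M"
  obtains f g where "f \<in> L2_fun M" "g \<in> L2_fun M" "u = matrix_coefficient G M f g"
  using assms by (auto simp: fourier_algebra_def)

lemma fourier_pairing_le_norm:
  assumes u: "u \<in> fourier_algebra G M" and A: "A \<in> group_vN_algebra G M" "L2_opnorm M A \<le> 1"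
  shows "cmod (fourier_pairing G M u A) \<le> fourier_norm G M u"
proof -
  obtain f g where fg: "f \<in> L2_fun M" "g \<in> L2_fun M" "u = matrix_coefficient G M f g" using fourier_algebraE[OF u] .
  show ?thesis unfolding fourier_norm_def
  proof (rule cSup_upper)
    show "bdd_above {cmod (fourier_pairing G M u A) |A. A \<in> group_vN_algebra G M \<and> L2_opnorm M A \<le> 1}"
      using fourier_pairing_bound[OF fg(1,2)] unfolding fg(3) by (intro bdd_aboveI[of _ "L2.nrm f * L2.nrm g"]) auto
  qed (use A in blast)
qed

text \<open>The zero operator makes the supremum in \<open>fourier_norm\<close> range over a
  nonempty set and gives its nonnegativity.\<close>

lemma zero_operator: "lcomb {} c \<in> group_vN_algebra G M" "L2_opnorm M (lcomb {} c) \<le> 1"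
proof -
  show "lcomb {} c \<in> group_vN_algebra G M" by (rule lcomb_vN) auto
  show "L2_opnorm M (lcomb {} c) \<le> 1" by (rule opnorm_le) (auto simp: lcomb_def L2_norm_def)
qed

lemma fourier_norm_le:
  assumes "\<And>A. A \<in> group_vN_algebra G M \<Longrightarrow> L2_opnorm M A \<le> 1 \<Longrightarrow> cmod (fourier_pairing G M u A) \<le> C"
  shows "fourier_norm G M u \<le> C"
  unfolding fourier_norm_def using zero_operator assms by (intro cSup_least) blast+

lemma fourier_norm_nonneg: "u \<in> fourier_algebra G M \<Longrightarrow> 0 \<le> fourier_norm G M u"
  using fourier_pairing_le_norm[OF _ zero_operator] norm_ge_zero order_trans by blast

lemma fourier_norm_coefficient_le:
  "f \<in> L2_fun M \<Longrightarrow> g \<in> L2_fun M \<Longrightarrow> fourier_norm G M (matrix_coefficient G M f g) \<le> L2.nrm f * L2.nrm g"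
  by (intro fourier_norm_le fourier_pairing_bound)

text \<open>Membership of the sum is a hypothesis, because A(G) is defined by single coefficients;
  for the projection it comes from \<open>fourier_algebra_add\<close>.\<close>

lemma fourier_norm_add_le:
  assumes u: "u1 \<in> fourier_algebra G M" "u2 \<in> fourier_algebra G M" "(\<lambda>x. u1 x + u2 x) \<in> fourier_algebra G M"
  shows "fourier_norm G M (\<lambda>x. u1 x + u2 x) \<le> fourier_norm G M u1 + fourier_norm G M u2"
proof (rule fourier_norm_le)
  fix A assume A: "A \<in> group_vN_algebra G M" "L2_opnorm M A \<le> 1"
  obtain f1 g1 where 1: "f1 \<in> L2_fun M" "g1 \<in> L2_fun M" "u1 = matrix_coefficient G M f1 g1" using fourier_algebraE[OF u(1)] .
  obtain f2 g2 where 2: "f2 \<in> L2_fun M" "g2 \<in> L2_fun M" "u2 = matrix_coefficient G M f2 g2" using fourier_algebraE[OF u(2)] .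
  obtain f g where 3: "f \<in> L2_fun M" "g \<in> L2_fun M" "(\<lambda>x. u1 x + u2 x) = matrix_coefficient G M f g" using fourier_algebraE[OF u(3)] .
  have "L2_inner M (A f1) g1 + L2_inner M (A f2) g2 = L2_inner M (A f) g"
  proof (rule vN_inner_add[OF 1(1,2) 2(1,2) 3(1,2) _ A(1)])
    fix x assume "x \<in> carrier G"
    then show "L2_inner M (lreg x f1) g1 + L2_inner M (lreg x f2) g2 = L2_inner M (lreg x f) g"
      using fun_cong[OF 3(3), of x] by (simp add: 1(3) 2(3) matrix_coefficient_apply)
  qed
  then have "fourier_pairing G M (\<lambda>x. u1 x + u2 x) A = fourier_pairing G M u1 A + fourier_pairing G M u2 A"
    unfolding 3(3) unfolding 1(3) 2(3) by (simp add: fourier_pairing_eq 1 2 3 A)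
  then have "cmod (fourier_pairing G M (\<lambda>x. u1 x + u2 x) A) \<le> cmod (fourier_pairing G M u1 A) + cmod (fourier_pairing G M u2 A)"
    by (simp add: norm_triangle_ineq)
  also have "\<dots> \<le> fourier_norm G M u1 + fourier_norm G M u2"
    by (intro add_mono fourier_pairing_le_norm u A)
  finally show "cmod (fourier_pairing G M (\<lambda>x. u1 x + u2 x) A) \<le> fourier_norm G M u1 + fourier_norm G M u2" .
qed

text \<open>Division by K puts the operator into the unit ball of VN(G), and its pairing with u is
  the sum divided by K. This is the passage from operator norms back to A(G).\<close>

lemma fourier_norm_dual_bound:
  assumes u: "u \<in> fourier_algebra G M" and F: "finite F" "F \<subseteq> carrier G" and K: "0 < K"
    and bd: "\<And>f. f \<in> L2_fun M \<Longrightarrow> L2.nrm (lcomb F c f) \<le> K * L2.nrm f"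
  shows "cmod (\<Sum>x\<in>F. c x * u x) \<le> K * fourier_norm G M u"
proof -
  obtain f g where fg: "f \<in> L2_fun M" "g \<in> L2_fun M" "u = matrix_coefficient G M f g" using fourier_algebraE[OF u] .
  define B where "B = lcomb F (\<lambda>x. of_real (1 / K) * c x)"
  have BvN: "B \<in> group_vN_algebra G M" unfolding B_def by (rule lcomb_vN[OF F])
  have BL: "B h = (\<lambda>y. of_real (1 / K) * lcomb F c h y)" for h unfolding B_def by (rule lcomb_scale[symmetric])
  have "L2_opnorm M B \<le> 1"
  proof (rule opnorm_le)
    fix h assume h: "h \<in> L2_fun M"
    have "L2.nrm (B h) = 1 / K * L2.nrm (lcomb F c h)"
      unfolding BL using K h F by (subst L2.nrm_sc) (auto simp: lcomb_L2 norm_divide)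
    also have "\<dots> \<le> 1 * L2.nrm h" using bd[OF h] K by (simp add: divide_le_eq mult.commute)
    finally show "L2_norm M (B h) \<le> 1 * L2_norm M h"
      using h F by (simp add: L2_norm_nrm B_def lcomb_L2)
  qed simp
  then have "cmod (fourier_pairing G M u B) \<le> fourier_norm G M u" by (intro fourier_pairing_le_norm u BvN)
  moreover have "fourier_pairing G M u B = of_real (1 / K) * (\<Sum>x\<in>F. c x * u x)"
  proof -
    have "fourier_pairing G M u B = L2_inner M (B f) g" unfolding fg(3) by (rule fourier_pairing_eq[OF fg(1,2) BvN])
    also have "\<dots> = of_real (1 / K) * L2_inner M (lcomb F c f) g"
      unfolding BL using fg F by (intro L2.ip_sc lcomb_L2)
    also have "L2_inner M (lcomb F c f) g = (\<Sum>x\<in>F. c x * u x)"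
      using F fg by (subst lcomb_inner) (auto simp: matrix_coefficient_apply intro!: sum.cong)
    finally show ?thesis .
  qed
  ultimately show ?thesis using K by (simp add: norm_mult norm_divide divide_le_eq mult.commute)
qed

end

section \<open>Approximation with respect to Haar measure\<close>

context left_invariant_measure
begin

lemma indicator_L2:
  assumes "B \<in> sets M" "emeasure M B < \<infinity>"
  shows "(indicator B :: 'a \<Rightarrow> complex) \<in> L2_fun M" "(L2.nrm (indicator B))\<^sup>2 = measure M B"
proof -
  have eq: "(cmod (indicator B x))\<^sup>2 = indicator B x" for x by (simp add: indicator_def)
  show 1: "(indicator B :: 'a \<Rightarrow> complex) \<in> L2_fun M"
    using assms by (simp add: L2_fun_def eq borel_measurable_indicator)
  show "(L2.nrm (indicator B))\<^sup>2 = measure M B"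
    using assms sets.sets_into_space[OF assms(1)] by (simp add: L2.nrm_sq 1 Re_L2_inner_self eq Int_absorb2)
qed

lemma indicator_diff_nrm:
  assumes B: "B \<in> sets M" "emeasure M B < \<infinity>" and C: "C \<in> sets M" "emeasure M C < \<infinity>"
  shows "(L2.nrm (indicator B - indicator C))\<^sup>2 = measure M (B - C) + measure M (C - B)"
proof -
  have fin: "emeasure M (B - C) < \<infinity>" "emeasure M (C - B) < \<infinity>"
    using emeasure_mono[OF Diff_subset B(1), of C] emeasure_mono[OF Diff_subset C(1), of B] B C by (auto intro: le_less_trans)
  have eq: "(cmod (indicator B x - indicator C x))\<^sup>2 = indicator (B - C) x + indicator (C - B) x" for x
    by (simp add: indicator_def)
  have "(L2.nrm (indicator B - indicator C))\<^sup>2 = (\<integral>x. indicator (B - C) x + indicator (C - B) x \<partial>M)"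
    using indicator_L2(1)[OF B] indicator_L2(1)[OF C] by (simp add: L2.nrm_sq L2.diff_mem Re_L2_inner_self eq)
  also have "\<dots> = measure M ((B - C) \<inter> space M) + measure M ((C - B) \<inter> space M)"
    using fin B C by (subst Bochner_Integration.integral_add) auto
  also have "\<dots> = measure M (B - C) + measure M (C - B)"
    using sets.sets_into_space[OF B(1)] sets.sets_into_space[OF C(1)] by (simp add: Int_absorb2 subset_iff)
  finally show ?thesis .
qed

lemma nrm_cong: "(\<And>x. x \<in> carrier G \<Longrightarrow> f x = g x) \<Longrightarrow> L2.nrm f = L2.nrm g"
  unfolding L2.nrm_def using L2_inner_cong[of f g f g] by simp

text \<open>The rule reduces claims about square integrable functions to sets of finite measure. The
  limit clause is formulated with approximation in norm, so that simple functions approximating f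
  are enough.\<close>

lemma L2_induct [consumes 1, case_names indicator add scale limit]:
  assumes f: "f \<in> L2_fun M"
    and ind: "\<And>B. B \<in> sets M \<Longrightarrow> emeasure M B < \<infinity> \<Longrightarrow> P (indicator B)"
    and add: "\<And>f g. f \<in> L2_fun M \<Longrightarrow> g \<in> L2_fun M \<Longrightarrow> P f \<Longrightarrow> P g \<Longrightarrow> P (f + g)"
    and scale: "\<And>f a. f \<in> L2_fun M \<Longrightarrow> P f \<Longrightarrow> P (\<lambda>x. a * f x)"
    and limit: "\<And>f. f \<in> L2_fun M \<Longrightarrow> (\<And>e. e > 0 \<Longrightarrow> \<exists>g\<in>L2_fun M. P g \<and> L2.nrm (f - g) < e) \<Longrightarrow> P f"
  shows "P f"
proof (rule limit[OF f])
  fix e :: real assume e: "e > 0"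
  note [measurable] = L2_funD(1)[OF f]
  obtain s where s: "\<And>i. simple_function M (s i)" "\<And>x. x \<in> space M \<Longrightarrow> (\<lambda>i. s i x) \<longlonglongrightarrow> f x"
    "\<And>i x. x \<in> space M \<Longrightarrow> cmod (s i x) \<le> 2 * cmod (f x)"
    using borel_measurable_implies_sequence_metric[OF L2_funD(1)[OF f], of 0] unfolding dist_0_norm[symmetric]
    by (simp add: dist_commute) metis
  have sm [measurable]: "s i \<in> borel_measurable M" for i using s(1) by (rule borel_measurable_simple_function)
  \<comment> \<open>The approximants satisfy |s i| \<le> 2 |f|, so |f - s i| \<le> 3 |f|; this is
    the origin of the factor 9.\<close>
  have "(\<lambda>i. \<integral>x. (cmod (f x - s i x))\<^sup>2 \<partial>M) \<longlonglongrightarrow> (\<integral>x. 0 \<partial>M)"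
  proof (rule integral_dominated_convergence[where w = "\<lambda>x. 9 * (cmod (f x))\<^sup>2"])
    show "integrable M (\<lambda>x. 9 * (cmod (f x))\<^sup>2)" using L2_funD(2)[OF f] by simp
    show "AE x in M. (\<lambda>i. (cmod (f x - s i x))\<^sup>2) \<longlonglongrightarrow> 0"
    proof (rule AE_I2)
      fix x assume "x \<in> space M"
      then have "(\<lambda>i. (cmod (f x - s i x))\<^sup>2) \<longlonglongrightarrow> (cmod (f x - f x))\<^sup>2" by (intro tendsto_intros s(2))
      then show "(\<lambda>i. (cmod (f x - s i x))\<^sup>2) \<longlonglongrightarrow> 0" by simp
    qed
    show "AE x in M. norm ((cmod (f x - s i x))\<^sup>2) \<le> 9 * (cmod (f x))\<^sup>2" for i
    proof (rule AE_I2)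
      fix x assume "x \<in> space M"
      then have "cmod (f x - s i x) \<le> 3 * cmod (f x)" using s(3)[of x i] norm_triangle_ineq4[of "f x" "s i x"] by simp
      then have "(cmod (f x - s i x))\<^sup>2 \<le> (3 * cmod (f x))\<^sup>2" by (intro power_mono) auto
      then show "norm ((cmod (f x - s i x))\<^sup>2) \<le> 9 * (cmod (f x))\<^sup>2" by (simp add: power_mult_distrib)
    qed
  qed measurable
  then have "eventually (\<lambda>i. (\<integral>x. (cmod (f x - s i x))\<^sup>2 \<partial>M) < e\<^sup>2) sequentially"
    using e by (intro order_tendstoD(2)[of _ 0]) auto
  then obtain i where i: "(\<integral>x. (cmod (f x - s i x))\<^sup>2 \<partial>M) < e\<^sup>2" by (auto simp: eventually_sequentially)
  \<comment> \<open>The value 0 is removed because its level set may have infinite measure; the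
    others have finite measure by comparison with the integral of |f|^2.\<close>
  define C where "C = s i ` space M - {0}"
  define B where "B c = s i -` {c} \<inter> space M" for c
  have finC: "finite C" using s(1)[of i] by (simp add: C_def simple_function_def)
  have Bm: "B c \<in> sets M" for c unfolding B_def by measurable
  have Bfin: "emeasure M (B c) < \<infinity>" if c: "c \<in> C" for c
  proof -
    have c0: "c \<noteq> 0" using c by (simp add: C_def)
    have "ennreal ((cmod c)\<^sup>2) * emeasure M (B c) = (\<integral>\<^sup>+x. ennreal ((cmod c)\<^sup>2) * indicator (B c) x \<partial>M)"
      using Bm by (simp add: nn_integral_cmult_indicator)
    also have "\<dots> \<le> (\<integral>\<^sup>+x. ennreal (4 * (cmod (f x))\<^sup>2) \<partial>M)"
    proof (rule nn_integral_mono)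
      fix x assume x: "x \<in> space M"
      have "(cmod (s i x))\<^sup>2 \<le> (2 * cmod (f x))\<^sup>2" using s(3)[OF x] by (intro power_mono) auto
      then show "ennreal ((cmod c)\<^sup>2) * indicator (B c) x \<le> ennreal (4 * (cmod (f x))\<^sup>2)"
        by (auto simp: indicator_def B_def power_mult_distrib)
    qed
    also have "\<dots> < \<infinity>" using L2_funD(2)[OF f] by (subst nn_integral_eq_integral) auto
    finally have "ennreal ((cmod c)\<^sup>2) * emeasure M (B c) < \<infinity>" .
    then show ?thesis using c0 by (auto simp: ennreal_mult_less_top)
  qed
  define t where "t = (\<Sum>c\<in>C. (\<lambda>x. c * indicator (B c) x))"
  have tL: "t \<in> L2_fun M" unfolding t_def by (intro L2.sum_mem L2.sc_mem indicator_L2 Bm Bfin)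
  have "P (\<Sum>c\<in>D. (\<lambda>x. c * indicator (B c) x))" if "finite D" "D \<subseteq> C" for D
    using that
  proof (induction D)
    case empty
    have "P (indicator {})" by (rule ind) auto
    moreover have "(indicator {} :: 'a \<Rightarrow> complex) = (\<Sum>c\<in>{}. (\<lambda>x. c * indicator (B c) x))"
      by (simp add: fun_eq_iff)
    ultimately show ?case by metis
  next
    case (insert c D)
    then have eq: "(\<Sum>c\<in>insert c D. (\<lambda>x. c * indicator (B c) x))
        = (\<lambda>x. c * indicator (B c) x) + (\<Sum>c\<in>D. (\<lambda>x. c * indicator (B c) x))"
      by (intro sum.insert)
    show ?case unfolding eq using insert
      by (intro add scale ind Bm Bfin L2.sum_mem L2.sc_mem indicator_L2) auto
  qed
  then have Pt: "P t" unfolding t_def using finC by blast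
  have ts: "t x = s i x" if x: "x \<in> space M" for x
  proof -
    have "t x = (\<Sum>c\<in>C. if c = s i x then c else 0)"
      unfolding t_def sum_fun_apply using x by (intro sum.cong refl) (auto simp: B_def indicator_def)
    also have "\<dots> = s i x" using finC x by (auto simp: sum.delta C_def)
    finally show ?thesis .
  qed
  have "(L2.nrm (f - t))\<^sup>2 = (\<integral>x. (cmod (f x - t x))\<^sup>2 \<partial>M)"
    using f tL by (simp add: L2.nrm_sq L2.diff_mem Re_L2_inner_self)
  also have "\<dots> = (\<integral>x. (cmod (f x - s i x))\<^sup>2 \<partial>M)" by (intro Bochner_Integration.integral_cong) (auto simp: ts)
  also have "\<dots> < e\<^sup>2" by (rule i)
  finally have "L2.nrm (f - t) < e" using e by (simp add: power2_less_imp_less)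
  then show "\<exists>g\<in>L2_fun M. P g \<and> L2.nrm (f - g) < e" using tL Pt by blast
qed

end

section \<open>Regularity of Haar measure and continuity of translation\<close>

locale haar_group = locally_compact_group G T for G (structure) and T :: "'a topology" +
  fixes M :: "'a measure"
  assumes haar: "left_haar_measure G T M"
begin

lemma space_carrier: "space M = carrier G"
  using haar topspace_eq by (simp add: left_haar_measure_def)

lemma sets_borel: "sets M = sigma_sets (carrier G) {U. openin T U}"
  using haar topspace_eq by (simp add: left_haar_measure_def)

lemma openin_subset_carrier: "openin T U \<Longrightarrow> U \<subseteq> carrier G"
  using openin_subset[of T U] topspace_eq by simp

lemma openin_sets: "openin T U \<Longrightarrow> U \<in> sets M"
  by (simp add: sets_borel sigma_sets.Basic)

lemma compactin_subset_carrier: "compactin T K \<Longrightarrow> K \<subseteq> carrier G"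
  using compactin_subset_topspace topspace_eq by blast

lemma compactin_sets:
  assumes "compactin T K"
  shows "K \<in> sets M"
proof -
  have "closedin T K" using Hausdorff assms by (rule compactin_imp_closedin)
  then have "openin T (carrier G - K)" by (simp add: closedin_def topspace_eq)
  then have "space M - (carrier G - K) \<in> sets M" by (intro sets.compl_sets openin_sets)
  moreover have "space M - (carrier G - K) = K" using compactin_subset_carrier[OF assms] by (auto simp: space_carrier)
  ultimately show ?thesis by simp
qed

lemma compactin_finite: "compactin T K \<Longrightarrow> emeasure M K < \<infinity>"
  using haar by (simp add: left_haar_measure_def)

lemma continuous_left_mult:
  assumes x: "x \<in> carrier G"
  shows "continuous_map T T (\<lambda>y. x \<otimes> y)"
proof -
  have "continuous_map T (prod_topology T T) (\<lambda>y. (x, y))"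
    using x by (intro continuous_map_pairedI) (auto simp: topspace_eq)
  from continuous_map_compose[OF this continuous_mult] show ?thesis by (simp add: comp_def)
qed

lemma continuous_right_mult:
  assumes x: "x \<in> carrier G"
  shows "continuous_map T T (\<lambda>y. y \<otimes> x)"
proof -
  have "continuous_map T (prod_topology T T) (\<lambda>y. (y, x))"
    using x by (intro continuous_map_pairedI) (auto simp: topspace_eq)
  from continuous_map_compose[OF this continuous_mult] show ?thesis by (simp add: comp_def)
qed

lemma l_coset_preimage:
  assumes "x \<in> carrier G" "A \<subseteq> carrier G"
  shows "x <# A = {y \<in> carrier G. inv x \<otimes> y \<in> A}"
proof (intro equalityI subsetI)
  fix y assume "y \<in> {y \<in> carrier G. inv x \<otimes> y \<in> A}"
  then have "inv x \<otimes> y \<in> A" "y = x \<otimes> (inv x \<otimes> y)" using assms by (auto simp: m_assoc[symmetric])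
  then show "y \<in> x <# A" unfolding l_coset_def by blast
qed (use assms in \<open>auto simp: l_coset_def m_assoc[symmetric] subset_iff\<close>)

lemma openin_l_coset: "x \<in> carrier G \<Longrightarrow> openin T U \<Longrightarrow> openin T (x <# U)"
  using openin_continuous_map_preimage[OF continuous_left_mult[of "inv x"], of U]
  by (simp add: l_coset_preimage openin_subset_carrier topspace_eq)

lemma openin_r_coset:
  assumes "x \<in> carrier G" "openin T U"
  shows "openin T (U #> x)"
proof -
  have "U #> x = {y \<in> topspace T. y \<otimes> inv x \<in> U}"
  proof (intro equalityI subsetI)
    fix y assume "y \<in> {y \<in> topspace T. y \<otimes> inv x \<in> U}"
    then have "y \<otimes> inv x \<in> U" "y = (y \<otimes> inv x) \<otimes> x" using assms by (auto simp: m_assoc topspace_eq)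
    then show "y \<in> U #> x" unfolding r_coset_def by blast
  qed (use assms openin_subset_carrier[OF assms(2)] in \<open>auto simp: r_coset_def m_assoc topspace_eq subset_iff\<close>)
  then show ?thesis using openin_continuous_map_preimage[OF continuous_right_mult[of "inv x"], of U] assms by simp
qed

lemma l_coset_in_sets:
  assumes x: "x \<in> carrier G" and A: "A \<in> sets M"
  shows "x <# A \<in> sets M"
proof -
  have "(\<lambda>y. inv x \<otimes> y) \<in> measurable M M"
  proof (rule measurable_sigma_sets[OF sets_borel])
    show "{U. openin T U} \<subseteq> Pow (carrier G)" using openin_subset_carrier by blast
    show "(\<lambda>y. inv x \<otimes> y) \<in> space M \<rightarrow> carrier G" using x by (auto simp: space_carrier)
    fix U assume "U \<in> {U. openin T U}"
    then have "openin T {y \<in> topspace T. inv x \<otimes> y \<in> U}"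
      using x by (intro openin_continuous_map_preimage[OF continuous_left_mult]) auto
    moreover have "(\<lambda>y. inv x \<otimes> y) -` U \<inter> space M = {y \<in> topspace T. inv x \<otimes> y \<in> U}"
      by (auto simp: space_carrier topspace_eq)
    ultimately show "(\<lambda>y. inv x \<otimes> y) -` U \<inter> space M \<in> sets M" by (simp add: openin_sets)
  qed
  from measurable_sets[OF this A] have "(\<lambda>y. inv x \<otimes> y) -` A \<inter> space M \<in> sets M" .
  moreover have "(\<lambda>y. inv x \<otimes> y) -` A \<inter> space M = x <# A"
    using l_coset_preimage[OF x, of A] sets.sets_into_space[OF A] by (auto simp: space_carrier)
  ultimately show ?thesis by simp
qed

sublocale left_invariant_measure G M
proof
  show "space M = carrier G" by (rule space_carrier)
  show "x <# A \<in> sets M" if "x \<in> carrier G" "A \<in> sets M" for x A using that by (rule l_coset_in_sets)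
  show "emeasure M (x <# A) = emeasure M A" if "x \<in> carrier G" "A \<in> sets M" for x A
    using haar that by (simp add: left_haar_measure_def)
qed

lemma continuous_measurable:
  assumes "continuous_map T euclidean (f :: 'a \<Rightarrow> complex)"
  shows "f \<in> borel_measurable M"
proof (rule borel_measurableI)
  fix S :: "complex set" assume "open S"
  then have "openin T {x \<in> topspace T. f x \<in> S}"
    using assms by (intro openin_continuous_map_preimage) auto
  moreover have "f -` S \<inter> space M = {x \<in> topspace T. f x \<in> S}" by (auto simp: space_carrier topspace_eq)
  ultimately show "f -` S \<inter> space M \<in> sets M" by (simp add: openin_sets)
qed

text \<open>Finitely many translates of U cover any given compact set. If U were null, all compact
  sets would be null, and inner regularity on the whole space would make the measure zero.\<close>

lemma open_emeasure_pos:
  assumes U: "openin T U" and x: "x \<in> U"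
  shows "emeasure M U > 0"
proof (rule ccontr)
  assume "\<not> emeasure M U > 0"
  then have U0: "emeasure M U = 0" by (simp add: zero_less_iff_neq_zero)
  have xG: "x \<in> carrier G" using openin_subset_carrier[OF U] x by blast
  have K0: "emeasure M K = 0" if K: "compactin T K" for K
  proof -
    define W where "W k = (k \<otimes> inv x) <# U" for k
    have KG: "K \<subseteq> carrier G" by (rule compactin_subset_carrier[OF K])
    have W: "openin T (W k)" "k \<in> W k" "emeasure M (W k) = 0" if "k \<in> K" for k
    proof -
      have k: "k \<in> carrier G" using KG that by blast
      show "openin T (W k)" unfolding W_def using k xG U by (intro openin_l_coset) auto
      have "k = (k \<otimes> inv x) \<otimes> x" using k xG by (simp add: m_assoc)
      then show "k \<in> W k" unfolding W_def l_coset_def using x by blast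
      show "emeasure M (W k) = 0" unfolding W_def using k xG U U0 by (subst l_coset_emeasure) (auto intro: openin_sets)
    qed
    obtain \<F> where \<F>: "finite \<F>" "\<F> \<subseteq> W ` K" "K \<subseteq> \<Union>\<F>"
      using compactinD[OF K, of "W ` K"] W by blast
    have "\<Union>\<F> \<in> null_sets M"
      using \<F> W by (intro null_sets_UN'[of \<F> "\<lambda>A. A", simplified]) (auto intro!: null_setsI openin_sets countable_finite)
    then show ?thesis using \<F>(3) compactin_sets[OF K] null_sets_subset by blast
  qed
  have "openin T (topspace T)" by simp
  then have "emeasure M (topspace T) = (SUP K\<in>{K. compactin T K \<and> K \<subseteq> topspace T}. emeasure M K)"
    using haar unfolding left_haar_measure_def by blast
  also have "\<dots> = 0" using K0 by (intro SUP_eq_const) auto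
  finally have "emeasure M (topspace T) = 0" .
  moreover have "emeasure M (space M) \<noteq> 0" "space M = topspace T" using haar unfolding left_haar_measure_def by blast+
  ultimately show False by simp
qed

text \<open>Outer regularity at B yields W, then inner regularity at W yields K. The set K lies in W
  rather than in B because inner regularity is available for open sets.\<close>

lemma finite_measure_approx:
  assumes B: "B \<in> sets M" "emeasure M B < \<infinity>" and d: "0 < (d::real)"
  obtains W K where "openin T W" "compactin T K" "B \<subseteq> W" "K \<subseteq> W" "emeasure M W < \<infinity>"
    "measure M (W - B) < d" "measure M (W - K) < d"
proof -
  have "emeasure M B = (INF U\<in>{U. openin T U \<and> B \<subseteq> U}. emeasure M U)"
    using haar B unfolding left_haar_measure_def by blast
  moreover have "emeasure M B < emeasure M B + ennreal d"
    using B d by (simp add: ennreal_add_left_cancel_less)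
  ultimately have "(INF U\<in>{U. openin T U \<and> B \<subseteq> U}. emeasure M U) < emeasure M B + ennreal d" by simp
  then obtain W where W: "openin T W" "B \<subseteq> W" "emeasure M W < emeasure M B + ennreal d"
    unfolding INF_less_iff by blast
  have "emeasure M B + ennreal d < \<infinity>" using B(2) by (simp add: ennreal_add_less_top)
  then have Wf: "emeasure M W < \<infinity>" using W(3) by (rule less_trans[rotated])
  have Wm: "W \<in> sets M" by (rule openin_sets[OF W(1)])
  have emW: "emeasure M W = ennreal (measure M W)" "emeasure M B = ennreal (measure M B)"
    using Wf B by (auto simp: emeasure_eq_ennreal_measure)
  have "measure M W < measure M B + d"
    using W(3) d unfolding emW by (simp add: ennreal_plus[symmetric] ennreal_less_iff del: ennreal_plus)
  moreover have diff: "measure M (W - A) = measure M W - measure M A" if "A \<in> sets M" "A \<subseteq> W" for A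
    using that Wf Wm by (intro measure_Diff) auto
  ultimately have 1: "measure M (W - B) < d" using B W by simp
  \<comment> \<open>The distinction keeps measure M W - d / 2 nonnegative, as its conversion to
    \<open>ennreal\<close> requires.\<close>
  show thesis
  proof (cases "measure M W < d")
    case True
    show thesis by (rule that[OF W(1) _ W(2) _ Wf 1, of "{}"]) (use True in auto)
  next
    case False
    have "ennreal (measure M W - d / 2) < emeasure M W"
      unfolding emW using False d by (subst ennreal_less_iff) auto
    also have "\<dots> = (SUP K\<in>{K. compactin T K \<and> K \<subseteq> W}. emeasure M K)"
      using haar W(1) unfolding left_haar_measure_def by blast
    finally obtain K where K: "compactin T K" "K \<subseteq> W" "ennreal (measure M W - d / 2) < emeasure M K"
      unfolding less_SUP_iff by blast
    have "emeasure M K = ennreal (measure M K)"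
      using compactin_finite[OF K(1)] by (auto simp: emeasure_eq_ennreal_measure)
    then have "measure M W - d / 2 < measure M K" using K(3) False d by (simp add: ennreal_less_iff)
    then have "measure M (W - K) < d" using diff[OF compactin_sets[OF K(1)] K(2)] d by simp
    then show thesis by (rule that[OF W(1) K(1) W(2) K(2) Wf 1])
  qed
qed

lemma lreg_indicator: "x \<in> carrier G \<Longrightarrow> B \<subseteq> carrier G \<Longrightarrow> y \<in> carrier G \<Longrightarrow> lreg x (indicator B) y = indicator (x <# B) y"
  by (simp add: left_regular_def l_coset_preimage indicator_def)

text \<open>The tube lemma for {\<one>} \<times> K inside the preimage of W under
  multiplication.\<close>

lemma compact_translate_inside:
  assumes K: "compactin T K" and W: "openin T W" "K \<subseteq> W"
  obtains N where "openin T N" "\<one> \<in> N" "\<And>x. x \<in> N \<Longrightarrow> x <# K \<subseteq> W"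
proof -
  define Q where "Q = {p \<in> topspace (prod_topology T T). (\<lambda>(x, y). x \<otimes> y) p \<in> W}"
  have Q: "openin (prod_topology T T) Q"
    unfolding Q_def by (rule openin_continuous_map_preimage[OF continuous_mult W(1)])
  have "{\<one>} \<times> K \<subseteq> Q"
    using W(2) compactin_subset_carrier[OF K] by (auto simp: Q_def topspace_eq subset_iff)
  then obtain N V where NV: "openin T N" "openin T V" "{\<one>} \<subseteq> N" "K \<subseteq> V" "N \<times> V \<subseteq> Q"
    using Wallace_theorem_prod_topology[OF _ K Q, of "{\<one>}"] by (auto simp: topspace_eq)
  show thesis
  proof (rule that[OF NV(1)])
    show "\<one> \<in> N" using NV by blast
    show "x <# K \<subseteq> W" if "x \<in> N" for x
      using NV(4,5) that unfolding l_coset_def Q_def by fastforce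
  qed
qed

text \<open>For an indicator, B is replaced by a compact K inside an open W of almost the same
  measure; for x near \<one> the translate x K stays inside W and so differs little from K. The
  remaining cases follow from translations being isometric.\<close>

lemma translation_continuous:
  assumes f: "f \<in> L2_fun M" and e: "e > 0"
  shows "\<exists>N. openin T N \<and> \<one> \<in> N \<and> (\<forall>x\<in>N. L2.nrm (lreg x f - f) < e)"
  using f e
proof (induction arbitrary: e rule: L2_induct)
  case (indicator B)
  \<comment> \<open>A symmetric difference of measure below 2 * d = e^2 / 16 has an indicator of
    norm at most e / 4, and three such terms are added at the end.\<close>
  define d where "d = e\<^sup>2 / 32"
  have d: "d > 0" using indicator by (simp add: d_def)
  obtain W K where WK: "openin T W" "compactin T K" "B \<subseteq> W" "K \<subseteq> W" "emeasure M W < \<infinity>"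
    "measure M (W - B) < d" "measure M (W - K) < d"
    using finite_measure_approx[OF indicator(1,2) d] .
  obtain N where N: "openin T N" "\<one> \<in> N" "\<And>x. x \<in> N \<Longrightarrow> x <# K \<subseteq> W"
    using compact_translate_inside[OF WK(2,1,4)] by blast
  note Wm = openin_sets[OF WK(1)] and Km = compactin_sets[OF WK(2)] and Kf = compactin_finite[OF WK(2)]
  have mono: "measure M A \<le> measure M (W - C)" if "A \<subseteq> W - C" "A \<in> sets M" "C \<in> sets M" for A C
  proof (rule measure_mono_fmeasurable[OF that(1,2)])
    have "emeasure M (W - C) \<le> emeasure M W" using Wm by (intro emeasure_mono) auto
    then show "W - C \<in> fmeasurable M" using WK(5) Wm that(3) by (intro fmeasurableI) (auto intro: le_less_trans)
  qed
  have small: "r \<le> e / 4" if "r\<^sup>2 < 2 * d" for r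
  proof -
    have "r\<^sup>2 \<le> (e / 4)\<^sup>2" using that by (simp add: d_def power2_eq_square)
    then show ?thesis by (rule power2_le_imp_le) (use indicator in simp)
  qed
  have BK: "L2.nrm (indicator B - indicator K) \<le> e / 4"
  proof (rule small)
    have "measure M (B - K) \<le> measure M (W - K)" "measure M (K - B) \<le> measure M (W - B)"
      using WK(3,4) indicator Km by (auto intro!: mono)
    then have "measure M (B - K) < d" "measure M (K - B) < d" using WK(6,7) by simp_all
    then show "(L2.nrm (indicator B - indicator K))\<^sup>2 < 2 * d"
      unfolding indicator_diff_nrm[OF indicator(1,2) Km Kf] by linarith
  qed
  have BL: "indicator B \<in> L2_fun M" and KL: "indicator K \<in> L2_fun M" using indicator Km Kf by (auto intro: indicator_L2)
  have "L2.nrm (lreg x (indicator B) - indicator B) < e" if x: "x \<in> N" for x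
  proof -
    have xG: "x \<in> carrier G" using openin_subset_carrier N(1) x by blast
    have xK: "x <# K \<in> sets M" "emeasure M (x <# K) = emeasure M K" using l_coset_sets l_coset_emeasure xG Km by auto
    have KK: "L2.nrm (lreg x (indicator K) - indicator K) \<le> e / 4"
    proof (rule small)
      have "measure M ((x <# K) - K) \<le> measure M (W - K)"
        using N(3)[OF x] xK Km by (intro mono) auto
      then have "measure M ((x <# K) - K) < d" using WK(7) by simp
      \<comment> \<open>Only x K - K is controlled by W; the opposite difference has the same
        measure because K and x K do.\<close>
      moreover have "measure M (K - (x <# K)) = measure M ((x <# K) - K)"
      proof -
        have "K - (x <# K) = K - (K \<inter> (x <# K))" "(x <# K) - K = (x <# K) - (K \<inter> (x <# K))" by auto
        moreover have "measure M (K - (K \<inter> (x <# K))) = measure M K - measure M (K \<inter> (x <# K))"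
          using Km xK Kf by (intro measure_Diff) auto
        moreover have "measure M ((x <# K) - (K \<inter> (x <# K))) = measure M (x <# K) - measure M (K \<inter> (x <# K))"
          using Km xK Kf by (intro measure_Diff) auto
        moreover have "measure M (x <# K) = measure M K" using xK by (simp add: measure_def)
        ultimately show ?thesis by simp
      qed
      ultimately have "(L2.nrm (indicator (x <# K) - indicator K))\<^sup>2 < 2 * d"
        using xK Km Kf by (simp add: indicator_diff_nrm)
      moreover have "L2.nrm (lreg x (indicator K) - indicator K) = L2.nrm (indicator (x <# K) - indicator K)"
        using xG compactin_subset_carrier[OF WK(2)] by (intro nrm_cong) (simp add: lreg_indicator)
      ultimately show "(L2.nrm (lreg x (indicator K) - indicator K))\<^sup>2 < 2 * d" by simp
    qed
    have "lreg x (indicator B) - lreg x (indicator K) = lreg x (indicator B - indicator K)"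
      by (simp add: left_regular_def fun_eq_iff)
    then have xBK: "L2.nrm (lreg x (indicator B) - lreg x (indicator K)) \<le> e / 4"
      using BK BL KL xG by (simp add: lreg_nrm L2.diff_mem)
    have "L2.nrm (lreg x (indicator B) - indicator B)
      \<le> L2.nrm (lreg x (indicator B) - lreg x (indicator K)) + L2.nrm (lreg x (indicator K) - indicator B)"
      by (intro L2.nrm_triangle3 lreg_L2 BL KL xG)
    also have "L2.nrm (lreg x (indicator K) - indicator B) \<le> L2.nrm (lreg x (indicator K) - indicator K) + L2.nrm (indicator K - indicator B)"
      by (intro L2.nrm_triangle3 lreg_L2 BL KL xG)
    also have "L2.nrm (indicator K - indicator B) = L2.nrm (indicator B - indicator K)"
      by (intro L2.nrm_diff_commute BL KL)
    finally show ?thesis using xBK KK BK indicator by linarith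
  qed
  then show ?case using N by blast
next
  case (add f g)
  obtain N N' where N: "openin T N" "\<one> \<in> N" "\<forall>x\<in>N. L2.nrm (lreg x f - f) < e / 2"
    and N': "openin T N'" "\<one> \<in> N'" "\<forall>x\<in>N'. L2.nrm (lreg x g - g) < e / 2"
    using add.IH[of "e / 2"] add.prems by (meson half_gt_zero)
  have "L2.nrm (lreg x (f + g) - (f + g)) < e" if x: "x \<in> N \<inter> N'" for x
  proof -
    have xG: "x \<in> carrier G" using openin_subset_carrier N(1) x by blast
    have eq: "lreg x (f + g) - (f + g) = (lreg x f - f) + (lreg x g - g)" by (simp add: left_regular_def fun_eq_iff)
    have "L2.nrm (lreg x (f + g) - (f + g)) \<le> L2.nrm (lreg x f - f) + L2.nrm (lreg x g - g)"
      unfolding eq using add.hyps xG by (intro L2.nrm_triangle L2.diff_mem lreg_L2)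
    moreover have "L2.nrm (lreg x f - f) < e / 2" "L2.nrm (lreg x g - g) < e / 2" using N(3) N'(3) x by blast+
    ultimately show ?thesis by linarith
  qed
  then show ?case using N(1,2) N'(1,2) openin_Int[of T N N'] by blast
next
  case (scale f a)
  have pos: "e / (cmod a + 1) > 0" using scale.prems by (simp add: add_nonneg_pos)
  obtain N where N: "openin T N" "\<one> \<in> N" "\<forall>x\<in>N. L2.nrm (lreg x f - f) < e / (cmod a + 1)"
    using scale.IH[OF pos] by blast
  have "L2.nrm (lreg x (\<lambda>y. a * f y) - (\<lambda>y. a * f y)) < e" if x: "x \<in> N" for x
  proof -
    have xG: "x \<in> carrier G" using openin_subset_carrier N(1) x by blast
    have eq: "lreg x (\<lambda>y. a * f y) - (\<lambda>y. a * f y) = (\<lambda>y. a * (lreg x f - f) y)"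
      by (simp add: left_regular_def fun_eq_iff right_diff_distrib)
    have "L2.nrm (lreg x (\<lambda>y. a * f y) - (\<lambda>y. a * f y)) = cmod a * L2.nrm (lreg x f - f)"
      unfolding eq using scale.hyps xG by (intro L2.nrm_sc L2.diff_mem lreg_L2)
    also have "\<dots> \<le> cmod a * (e / (cmod a + 1))"
      by (intro mult_left_mono less_imp_le[OF N(3)[rule_format, OF x]]) simp
    also have "\<dots> < (cmod a + 1) * (e / (cmod a + 1))" using pos by (intro mult_strict_right_mono) auto
    also have "\<dots> = e"
    proof -
      have "cmod a + 1 \<noteq> 0" using norm_ge_zero[of a] by linarith
      then show ?thesis by simp
    qed
    finally show ?thesis .
  qed
  then show ?case using N by blast
next
  case (limit f)
  obtain g where g: "g \<in> L2_fun M" "L2.nrm (f - g) < e / 3"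
    "\<And>e. e > 0 \<Longrightarrow> \<exists>N. openin T N \<and> \<one> \<in> N \<and> (\<forall>x\<in>N. L2.nrm (lreg x g - g) < e)"
    using limit.IH[of "e / 3"] limit.prems by (metis zero_less_divide_iff zero_less_numeral)
  obtain N where N: "openin T N" "\<one> \<in> N" "\<forall>x\<in>N. L2.nrm (lreg x g - g) < e / 3"
    using g(3)[of "e / 3"] limit.prems by auto
  have "L2.nrm (lreg x f - f) < e" if x: "x \<in> N" for x
  proof -
    have xG: "x \<in> carrier G" using openin_subset_carrier N(1) x by blast
    have "lreg x f - lreg x g = lreg x (f - g)" by (simp add: left_regular_def fun_eq_iff)
    then have 1: "L2.nrm (lreg x f - lreg x g) < e / 3" using g limit.hyps xG by (simp add: lreg_nrm L2.diff_mem)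
    have "L2.nrm (lreg x f - f) \<le> L2.nrm (lreg x f - lreg x g) + L2.nrm (lreg x g - f)"
      using g limit.hyps xG by (intro L2.nrm_triangle3 lreg_L2)
    also have "L2.nrm (lreg x g - f) \<le> L2.nrm (lreg x g - g) + L2.nrm (g - f)"
      using g limit.hyps xG by (intro L2.nrm_triangle3 lreg_L2)
    also have "L2.nrm (g - f) = L2.nrm (f - g)" using g limit.hyps by (intro L2.nrm_diff_commute)
    finally show ?thesis using 1 g(2) N(3)[rule_format, OF x] by linarith
  qed
  then show ?case using N by blast
qed

section \<open>Cutting functions down to compact sets\<close>

definition cut :: "'a set \<Rightarrow> ('a \<Rightarrow> complex) \<Rightarrow> 'a \<Rightarrow> complex" where
  "cut K f = (\<lambda>x. indicator K x * f x)"

lemma L2_mono: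
  assumes f: "f \<in> L2_fun M" and g: "g \<in> borel_measurable M" "\<And>x. cmod (g x) \<le> cmod (f x)"
  shows "g \<in> L2_fun M" "L2.nrm g \<le> L2.nrm f"
proof -
  have le: "(cmod (g x))\<^sup>2 \<le> (cmod (f x))\<^sup>2" for x using g(2)[of x] by (intro power_mono) auto
  show gL: "g \<in> L2_fun M" by (rule L2_fun_bound[OF g(1) L2_funD(2)[OF f] le])
  show "L2.nrm g \<le> L2.nrm f"
    unfolding L2.nrm_def Re_L2_inner_self[OF f] Re_L2_inner_self[OF gL]
    by (intro real_sqrt_le_mono integral_mono L2_funD(2)[OF f] L2_funD(2)[OF gL] le)
qed

lemma cut_measurable: "K \<in> sets M \<Longrightarrow> f \<in> L2_fun M \<Longrightarrow> cut K f \<in> borel_measurable M"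
  unfolding cut_def by (intro borel_measurable_times borel_measurable_indicator L2_funD)

lemma cut_L2:
  assumes "K \<in> sets M" "f \<in> L2_fun M"
  shows "cut K f \<in> L2_fun M" "L2.nrm (cut K f) \<le> L2.nrm f"
  using L2_mono[OF assms(2) cut_measurable[OF assms]] by (auto simp: cut_def indicator_def)

lemma cut_mono:
  assumes "K \<in> sets M" "K' \<in> sets M" "K \<subseteq> K'" "f \<in> L2_fun M"
  shows "L2.nrm (f - cut K' f) \<le> L2.nrm (f - cut K f)"
proof (rule L2_mono)
  show "f - cut K f \<in> L2_fun M" using assms by (intro L2.diff_mem cut_L2)
  have "f - cut K' f \<in> L2_fun M" using assms by (intro L2.diff_mem cut_L2)
  then show "f - cut K' f \<in> borel_measurable M" by (rule L2_funD)
  show "cmod ((f - cut K' f) x) \<le> cmod ((f - cut K f) x)" for x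
    using assms by (auto simp: cut_def indicator_def)
qed

text \<open>A substitute for \<sigma>-compactness: each single square integrable function is nearly
  carried by a compact set. The approximant is a cut-off of f itself, so its norm does not exceed
  that of f.\<close>

lemma compact_support_approx:
  assumes "f \<in> L2_fun M" "e > 0"
  shows "\<exists>K. compactin T K \<and> L2.nrm (f - cut K f) < e"
  using assms
proof (induction arbitrary: e rule: L2_induct)
  case (indicator B)
  have e2: "e\<^sup>2 > 0" using indicator by simp
  obtain W K where WK: "openin T W" "compactin T K" "B \<subseteq> W" "K \<subseteq> W" "emeasure M W < \<infinity>"
    "measure M (W - B) < e\<^sup>2" "measure M (W - K) < e\<^sup>2"
    using finite_measure_approx[OF indicator(1,2) e2] .
  have Km: "K \<in> sets M" by (rule compactin_sets[OF WK(2)])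
  have BKm: "B - K \<in> sets M" using indicator Km by simp
  have fin: "emeasure M (B - K) < \<infinity>" using emeasure_mono[of "B - K" B M] indicator by (auto intro: le_less_trans)
  have "emeasure M (W - K) \<le> emeasure M W" using openin_sets[OF WK(1)] by (intro emeasure_mono) auto
  then have "W - K \<in> fmeasurable M" using WK(5) openin_sets[OF WK(1)] Km by (intro fmeasurableI) (auto intro: le_less_trans)
  then have "measure M (B - K) \<le> measure M (W - K)"
    using WK BKm by (intro measure_mono_fmeasurable) auto
  moreover have eq: "indicator B - cut K (indicator B) = (indicator (B - K) :: 'a \<Rightarrow> complex)"
    by (auto simp: cut_def indicator_def fun_eq_iff)
  ultimately have "(L2.nrm (indicator B - cut K (indicator B)))\<^sup>2 < e\<^sup>2"
    using WK(7) unfolding eq indicator_L2(2)[OF BKm fin] by linarith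
  then have "L2.nrm (indicator B - cut K (indicator B)) < e" using indicator by (simp add: power2_less_imp_less)
  then show ?case using WK(2) by blast
next
  case (add f g)
  obtain K K' where K: "compactin T K" "L2.nrm (f - cut K f) < e / 2"
    and K': "compactin T K'" "L2.nrm (g - cut K' g) < e / 2"
    using add.IH[of "e / 2"] add.prems by (meson half_gt_zero)
  have KK: "compactin T (K \<union> K')" using K K' by (intro compactin_Un)
  note sm = compactin_sets[OF K(1)] compactin_sets[OF K'(1)] compactin_sets[OF KK]
  have eq: "(f + g) - cut (K \<union> K') (f + g) = (f - cut (K \<union> K') f) + (g - cut (K \<union> K') g)"
    by (simp add: cut_def fun_eq_iff distrib_left)
  have "L2.nrm ((f + g) - cut (K \<union> K') (f + g)) \<le> L2.nrm (f - cut (K \<union> K') f) + L2.nrm (g - cut (K \<union> K') g)"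
    unfolding eq using add.hyps sm by (intro L2.nrm_triangle L2.diff_mem cut_L2)
  also have "\<dots> \<le> L2.nrm (f - cut K f) + L2.nrm (g - cut K' g)"
    using add.hyps sm by (intro add_mono cut_mono) auto
  finally have "L2.nrm ((f + g) - cut (K \<union> K') (f + g)) < e" using K(2) K'(2) by linarith
  then show ?case using KK by blast
next
  case (scale f a)
  have pos: "e / (cmod a + 1) > 0" using scale.prems by (simp add: add_nonneg_pos)
  obtain K where K: "compactin T K" "L2.nrm (f - cut K f) < e / (cmod a + 1)" using scale.IH[OF pos] by blast
  have eq: "(\<lambda>y. a * f y) - cut K (\<lambda>y. a * f y) = (\<lambda>y. a * (f - cut K f) y)"
    by (simp add: cut_def fun_eq_iff right_diff_distrib)
  have "L2.nrm ((\<lambda>y. a * f y) - cut K (\<lambda>y. a * f y)) = cmod a * L2.nrm (f - cut K f)"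
    unfolding eq using scale.hyps compactin_sets[OF K(1)] by (intro L2.nrm_sc L2.diff_mem cut_L2)
  also have "\<dots> \<le> cmod a * (e / (cmod a + 1))" by (intro mult_left_mono less_imp_le[OF K(2)]) simp
  also have "\<dots> < (cmod a + 1) * (e / (cmod a + 1))" using pos by (intro mult_strict_right_mono) auto
  also have "\<dots> = e"
  proof -
    have "cmod a + 1 \<noteq> 0" using norm_ge_zero[of a] by linarith
    then show ?thesis by simp
  qed
  finally show ?case using K by blast
next
  case (limit f)
  obtain g where g: "g \<in> L2_fun M" "L2.nrm (f - g) < e / 3"
    "\<And>e. e > 0 \<Longrightarrow> \<exists>K. compactin T K \<and> L2.nrm (g - cut K g) < e"
    using limit.IH[of "e / 3"] limit.prems by (metis zero_less_divide_iff zero_less_numeral)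
  obtain K where K: "compactin T K" "L2.nrm (g - cut K g) < e / 3" using g(3)[of "e / 3"] limit.prems by auto
  note Km = compactin_sets[OF K(1)]
  have "cut K g - cut K f = cut K (g - f)" by (simp add: cut_def fun_eq_iff right_diff_distrib)
  then have 1: "L2.nrm (cut K g - cut K f) \<le> L2.nrm (f - g)"
    using cut_L2(2)[OF Km, of "g - f"] g limit.hyps L2.nrm_diff_commute[of f g] by (simp add: L2.diff_mem)
  have "L2.nrm (f - cut K f) \<le> L2.nrm (f - g) + L2.nrm (g - cut K f)"
    using g limit.hyps Km by (intro L2.nrm_triangle3 cut_L2)
  also have "L2.nrm (g - cut K f) \<le> L2.nrm (g - cut K g) + L2.nrm (cut K g - cut K f)"
    using g limit.hyps Km by (intro L2.nrm_triangle3 cut_L2)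
  finally have "L2.nrm (f - cut K f) < e" using 1 g(2) K(2) by linarith
  then show ?case using K(1) by blast
qed

lemma coefficient_continuous:
  assumes f: "f \<in> L2_fun M" and g: "g \<in> L2_fun M"
  shows "continuous_map T euclidean (\<lambda>x. L2_inner M (lreg x f) g)"
  unfolding continuous_map_def
proof (intro conjI allI impI)
  fix S :: "complex set" assume "openin euclidean S"
  then have S: "open S" by simp
  let ?\<phi> = "\<lambda>x. L2_inner M (lreg x f) g"
  show "openin T {x \<in> topspace T. ?\<phi> x \<in> S}"
  proof (subst openin_subopen, intro ballI)
    fix x0 assume "x0 \<in> {x \<in> topspace T. ?\<phi> x \<in> S}"
    then have x0: "x0 \<in> carrier G" "?\<phi> x0 \<in> S" by (auto simp: topspace_eq)
    obtain d where d: "d > 0" "ball (?\<phi> x0) d \<subseteq> S" using S x0 by (meson openE)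
    have pos: "d / (L2.nrm g + 1) > 0" using d g by (simp add: add_nonneg_pos)
    obtain N where N: "openin T N" "\<one> \<in> N" "\<forall>x\<in>N. L2.nrm (lreg x f - f) < d / (L2.nrm g + 1)"
      using translation_continuous[OF f pos] by blast
    have "x \<in> {x \<in> topspace T. ?\<phi> x \<in> S}" if "x \<in> x0 <# N" for x
    proof -
      obtain n where n: "n \<in> N" "x = x0 \<otimes> n" using \<open>x \<in> x0 <# N\<close> by (auto simp: l_coset_def)
      have nG: "n \<in> carrier G" using openin_subset_carrier N(1) n by blast
      have xG: "x \<in> carrier G" using n nG x0 by simp
      have "?\<phi> x = L2_inner M (lreg x0 (lreg n f)) g"
        using n nG x0 by (intro L2_inner_cong) (simp_all add: lreg_mult)
      then have "?\<phi> x - ?\<phi> x0 = L2_inner M (lreg x0 (lreg n f) - lreg x0 f) g"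
        using f g x0 nG by (simp add: L2.ip_diff lreg_L2)
      also have "lreg x0 (lreg n f) - lreg x0 f = lreg x0 (lreg n f - f)" by (simp add: left_regular_def fun_eq_iff)
      finally have "cmod (?\<phi> x - ?\<phi> x0) \<le> L2.nrm (lreg x0 (lreg n f - f)) * L2.nrm g"
        using f g x0 nG by (simp add: L2.Cauchy_Schwarz L2.diff_mem lreg_L2)
      also have "\<dots> = L2.nrm (lreg n f - f) * L2.nrm g" using f x0 nG by (simp add: lreg_nrm L2.diff_mem lreg_L2)
      also have "\<dots> \<le> d / (L2.nrm g + 1) * L2.nrm g"
          by (intro mult_right_mono less_imp_le[OF N(3)[rule_format, OF n(1)]] L2.nrm_nonneg g)
      also have "\<dots> < d / (L2.nrm g + 1) * (L2.nrm g + 1)" using pos by (intro mult_strict_left_mono) auto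
      also have "\<dots> = d"
      proof -
        have "L2.nrm g + 1 \<noteq> 0" using L2.nrm_nonneg[OF g] by linarith
        then show ?thesis by simp
      qed
      finally have "?\<phi> x \<in> ball (?\<phi> x0) d" by (simp add: dist_norm norm_minus_commute)
      then show ?thesis using d xG by (auto simp: topspace_eq)
    qed
    moreover have "x0 \<in> x0 <# N" unfolding l_coset_def using N(2) x0 by (auto intro!: bexI[of _ \<one>])
    ultimately show "\<exists>Ta. openin T Ta \<and> x0 \<in> Ta \<and> Ta \<subseteq> {x \<in> topspace T. ?\<phi> x \<in> S}"
      using openin_l_coset[OF x0(1) N(1)] by (intro exI[of _ "x0 <# N"]) blast
  qed
qed auto

end

section \<open>Sums of matrix coefficients\<close>

context left_invariant_measure
begin

lemma lreg_lcomb: "lreg x = lcomb {x} (\<lambda>_. 1)"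
  by (simp add: lcomb_def fun_eq_iff)

lemma lcomb_zero: "lcomb F c 0 = 0"
  by (simp add: lcomb_def left_regular_def fun_eq_iff)

sublocale S: semi_hilbert L2.l2V L2.l2sc L2.l2ip
  by (rule L2.l2_semi_hilbert)

text \<open>The amplification 1 \<otimes> A of an operator A to \<ell>^2 \<otimes> L^2.\<close>

definition lift :: "(('a \<Rightarrow> complex) \<Rightarrow> 'a \<Rightarrow> complex) \<Rightarrow> (nat \<Rightarrow> 'a \<Rightarrow> complex) \<Rightarrow> nat \<Rightarrow> 'a \<Rightarrow> complex" where
  "lift A Z = (\<lambda>n. A (Z n))"

lemma S_nrm_sq: "Z \<in> L2.l2V \<Longrightarrow> (S.nrm Z)\<^sup>2 = (\<Sum>n. (L2.nrm (Z n))\<^sup>2)"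
  by (simp add: S.nrm_sq L2.l2ip_self)

lemma S_component: "Z \<in> L2.l2V \<Longrightarrow> L2.nrm (Z n) \<le> S.nrm Z"
  using L2.l2_component_le[of Z n] S.nrm_nonneg[of Z] by (auto simp flip: S.nrm_sq dest: power2_le_imp_le)

lemma lift_lcomb_mem:
  assumes F: "F \<subseteq> carrier G" and Z: "Z \<in> L2.l2V"
  shows "lift (lcomb F c) Z \<in> L2.l2V"
    and "S.nrm (lift (lcomb F c) Z) \<le> (\<Sum>x\<in>F. cmod (c x)) * S.nrm Z"
proof -
  let ?C = "\<Sum>x\<in>F. cmod (c x)"
  have C: "0 \<le> ?C" by (intro sum_nonneg) auto
  have mem: "lift (lcomb F c) Z n \<in> L2_fun M" for n using F Z by (simp add: lift_def lcomb_L2 L2.l2V_D)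
  have le: "(L2.nrm (lift (lcomb F c) Z n))\<^sup>2 \<le> ?C\<^sup>2 * (L2.nrm (Z n))\<^sup>2" for n
  proof -
    have "(L2.nrm (lift (lcomb F c) Z n))\<^sup>2 \<le> (?C * L2.nrm (Z n))\<^sup>2"
      using lcomb_bound[OF F L2.l2V_D(1)[OF Z], of c n] mem[of n] by (intro power_mono) (auto simp: lift_def)
    then show ?thesis by (simp add: power_mult_distrib)
  qed
  have sm: "summable (\<lambda>n. ?C\<^sup>2 * (L2.nrm (Z n))\<^sup>2)" by (intro summable_mult L2.l2V_D Z)
  have sm': "summable (\<lambda>n. (L2.nrm (lift (lcomb F c) Z n))\<^sup>2)"
    by (rule summable_comparison_test'[OF sm]) (use le in simp)
  show m: "lift (lcomb F c) Z \<in> L2.l2V" using mem sm' by (simp add: L2.l2V_def)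
  have "(S.nrm (lift (lcomb F c) Z))\<^sup>2 \<le> (\<Sum>n. ?C\<^sup>2 * (L2.nrm (Z n))\<^sup>2)"
    unfolding S_nrm_sq[OF m] by (intro suminf_le le sm sm')
  also have "\<dots> = (?C * S.nrm Z)\<^sup>2"
    by (simp add: suminf_mult L2.l2V_D Z S_nrm_sq power_mult_distrib)
  finally show "S.nrm (lift (lcomb F c) Z) \<le> ?C * S.nrm Z"
    by (rule power2_le_imp_le) (use C Z in auto)
qed

lemma lift_lcomb_adjoint:
  assumes F: "finite F" "F \<subseteq> carrier G"
  shows "S.adjoint_pair (lift (lcomb F c)) (lift (lcomb (m_inv G ` F) (\<lambda>x. cnj (c (inv x)))))"
proof -
  have F': "m_inv G ` F \<subseteq> carrier G" using F by auto
  show ?thesis unfolding S.adjoint_pair_def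
  proof (intro conjI ballI)
    fix Z Z' assume Z: "Z \<in> L2.l2V" "Z' \<in> L2.l2V"
    show "L2.l2ip (lift (lcomb F c) Z) Z' = L2.l2ip Z (lift (lcomb (m_inv G ` F) (\<lambda>x. cnj (c (inv x)))) Z')"
      unfolding L2.l2ip_def lift_def using L2.adjoint_pairD(3)[OF lcomb_adjoint[OF F]] Z by (simp add: L2.l2V_D)
  qed (use F F' in \<open>auto intro: lift_lcomb_mem\<close>)
qed

lemma lift_lreg_mem: "x \<in> carrier G \<Longrightarrow> Z \<in> L2.l2V \<Longrightarrow> lift (lreg x) Z \<in> L2.l2V"
  using lift_lcomb_mem(1)[of "{x}" Z "\<lambda>_. 1"] by (simp add: lreg_lcomb)

lemma lift_lreg_nrm: "x \<in> carrier G \<Longrightarrow> Z \<in> L2.l2V \<Longrightarrow> S.nrm (lift (lreg x) Z) = S.nrm Z"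
proof -
  assume xZ: "x \<in> carrier G" "Z \<in> L2.l2V"
  then have "L2.l2ip (lift (lreg x) Z) (lift (lreg x) Z) = L2.l2ip Z Z"
    unfolding L2.l2ip_def lift_def by (simp add: lreg_inner L2.l2V_D)
  then show ?thesis by (simp add: S.nrm_def)
qed

lemma single_mem:
  assumes "f \<in> L2_fun M"
  shows "(\<lambda>n. if n = k then f else 0) \<in> L2.l2V" "S.nrm (\<lambda>n. if n = k then f else 0) = L2.nrm f"
proof -
  have eq: "(L2.nrm (if n = k then f else 0))\<^sup>2 = (if n = k then (L2.nrm f)\<^sup>2 else 0)" for n
    by (simp add: L2.nrm_zero)
  have s: "(\<lambda>n. (L2.nrm (if n = k then f else 0))\<^sup>2) sums (L2.nrm f)\<^sup>2"
    unfolding eq by (rule sums_single)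
  show m: "(\<lambda>n. if n = k then f else 0) \<in> L2.l2V"
    using assms sums_summable[OF s] by (simp add: L2.l2V_def L2.zero_mem)
  have "(S.nrm (\<lambda>n. if n = k then f else 0))\<^sup>2 = (L2.nrm f)\<^sup>2"
    unfolding S_nrm_sq[OF m] using s by (rule sums_unique[symmetric])
  then show "S.nrm (\<lambda>n. if n = k then f else 0) = L2.nrm f"
    using assms m by (simp add: power2_eq_iff_nonneg)
qed

end

section \<open>One vector dominating several others\<close>

context haar_group
begin

text \<open>Only finitely many neighbourhoods can be intersected, so the tail of Z is estimated
  uniformly in x by \<parallel>\<lambda>(x) z - z\<parallel> \<le> 2 \<parallel>z\<parallel>. Head
  and tail each contribute at most e^2 / 2 to the square, which fixes the constants.\<close>

lemma lift_translation_continuous: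
  assumes Z: "Z \<in> L2.l2V" and e: "e > 0"
  obtains N where "openin T N" "\<one> \<in> N" "\<forall>x\<in>N. S.nrm (lift (lreg x) Z - Z) < e"
proof -
  have "summable (\<lambda>n. (L2.nrm (Z n))\<^sup>2)" by (rule L2.l2V_D[OF Z])
  then have "(\<lambda>k. \<Sum>n. (L2.nrm (Z (n + k)))\<^sup>2) \<longlonglongrightarrow> 0" by (rule suminf_exist_split2)
  then have "eventually (\<lambda>k. (\<Sum>n. (L2.nrm (Z (n + k)))\<^sup>2) < e\<^sup>2 / 8) sequentially"
    using e by (intro order_tendstoD(2)[of _ 0]) auto
  then obtain k where k: "(\<Sum>n. (L2.nrm (Z (n + k)))\<^sup>2) < e\<^sup>2 / 8" by (auto simp: eventually_sequentially)
  define d where "d = sqrt (e\<^sup>2 / (2 * (real k + 1)))"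
  have d: "d > 0" using e by (simp add: d_def)
  have "\<forall>n. \<exists>N. openin T N \<and> \<one> \<in> N \<and> (\<forall>x\<in>N. L2.nrm (lreg x (Z n) - Z n) < d)"
    using translation_continuous[OF L2.l2V_D(1)[OF Z] d] by blast
  then obtain N where N: "\<And>n. openin T (N n)" "\<And>n. \<one> \<in> N n" "\<And>n x. x \<in> N n \<Longrightarrow> L2.nrm (lreg x (Z n) - Z n) < d"
    by metis
  define N0 where "N0 = topspace T \<inter> (\<Inter>n\<in>{..<k}. N n)"
  have N0: "openin T N0" unfolding N0_def
    by (cases "k = 0") (auto intro!: openin_Int openin_Inter N)
  have "S.nrm (lift (lreg x) Z - Z) < e" if x: "x \<in> N0" for x
  proof -
    have xG: "x \<in> carrier G" using x by (simp add: N0_def topspace_eq)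
    have mem: "lift (lreg x) Z - Z \<in> L2.l2V" using xG Z by (intro S.diff_mem lift_lreg_mem)
    define a where "a n = (L2.nrm (lreg x (Z n) - Z n))\<^sup>2" for n
    have aZ: "a n \<le> 4 * (L2.nrm (Z n))\<^sup>2" for n
    proof -
      have "L2.nrm (lreg x (Z n) - Z n) \<le> 2 * L2.nrm (Z n)"
        using L2.nrm_triangle_diff[of "lreg x (Z n)" "Z n"] xG Z by (simp add: lreg_nrm lreg_L2 L2.l2V_D)
      then have "a n \<le> (2 * L2.nrm (Z n))\<^sup>2"
        unfolding a_def using xG Z by (intro power_mono L2.nrm_nonneg L2.diff_mem lreg_L2 L2.l2V_D)
      then show ?thesis by (simp add: power_mult_distrib)
    qed
    have sa: "summable a" using L2.l2V_D(2)[OF mem] by (simp add: a_def[abs_def] lift_def)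
    have tot: "(S.nrm (lift (lreg x) Z - Z))\<^sup>2 = (\<Sum>n. a n)"
      unfolding S_nrm_sq[OF mem] by (simp add: a_def lift_def)
    have split: "(\<Sum>n. a n) = (\<Sum>n. a (n + k)) + (\<Sum>n<k. a n)" by (rule suminf_split_initial_segment[OF sa])
    have "(\<Sum>n. a (n + k)) \<le> (\<Sum>n. 4 * (L2.nrm (Z (n + k)))\<^sup>2)"
      by (intro suminf_le aZ summable_mult summable_ignore_initial_segment[OF sa]
          summable_ignore_initial_segment[OF L2.l2V_D(2)[OF Z]])
    also have "\<dots> = 4 * (\<Sum>n. (L2.nrm (Z (n + k)))\<^sup>2)"
      by (intro suminf_mult summable_ignore_initial_segment[OF L2.l2V_D(2)[OF Z]])
    also have "\<dots> < e\<^sup>2 / 2" using k by simp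
    finally have tail: "(\<Sum>n. a (n + k)) < e\<^sup>2 / 2" .
    have "(\<Sum>n<k. a n) \<le> (\<Sum>n<k. d\<^sup>2)"
    proof (intro sum_mono)
      fix n assume "n \<in> {..<k}"
      then have "L2.nrm (lreg x (Z n) - Z n) < d" using x by (intro N) (auto simp: N0_def)
      then show "a n \<le> d\<^sup>2" unfolding a_def
        using xG Z by (intro power_mono L2.nrm_nonneg L2.diff_mem lreg_L2 L2.l2V_D) auto
    qed
    also have "\<dots> = real k * (e\<^sup>2 / (2 * (real k + 1)))" using e by (simp add: d_def)
    also have "\<dots> \<le> e\<^sup>2 / 2" by (simp add: field_simps)
    finally have "(\<Sum>n<k. a n) \<le> e\<^sup>2 / 2" .
    then have "(S.nrm (lift (lreg x) Z - Z))\<^sup>2 < e\<^sup>2" unfolding tot split using tail by linarith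
    then show ?thesis by (rule power2_less_imp_less) (use e in simp)
  qed
  moreover have "\<one> \<in> N0" using N(2) by (simp add: N0_def topspace_eq)
  ultimately show thesis using N0 that by blast
qed

lemma compact_quotient: "compactin T K \<Longrightarrow> compactin T ((\<lambda>(x, y). x \<otimes> inv y) ` (K \<times> K))"
proof -
  assume K: "compactin T K"
  have "continuous_map (prod_topology T T) (prod_topology T T) (\<lambda>(x, y). (x, inv y))"
    using continuous_map_prod_top[of T T T T "\<lambda>x. x" "\<lambda>y. inv y"] continuous_inv by simp
  from continuous_map_compose[OF this continuous_mult]
  have "continuous_map (prod_topology T T) T (\<lambda>(x, y). x \<otimes> inv y)" by (simp add: comp_def case_prod_unfold)
  then show ?thesis using image_compactin[of "prod_topology T T" "K \<times> K"] K by (simp add: compactin_Times)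
qed

text \<open>The coefficient is bounded by \<parallel>f\<parallel>^2 and vanishes off the compact set
  of all x y^(-1) with x and y in K.\<close>

lemma compact_support_coefficient:
  assumes f: "f \<in> L2_fun M" and K: "compactin T K" "\<And>x. x \<notin> K \<Longrightarrow> f x = 0"
  shows "(\<lambda>x. L2_inner M f (lreg x f)) \<in> L2_fun M"
proof -
  define Q where "Q = (\<lambda>(x, y). x \<otimes> inv y) ` (K \<times> K)"
  have Q: "compactin T Q" unfolding Q_def by (rule compact_quotient[OF K(1)])
  have KG: "K \<subseteq> carrier G" by (rule compactin_subset_carrier[OF K(1)])
  show ?thesis
  proof (rule L2_fun_bound[where g = "\<lambda>x. ((L2.nrm f)\<^sup>2)\<^sup>2 * indicator Q x"])
    have "(\<lambda>x. cnj (L2_inner M (lreg x f) f)) \<in> borel_measurable M"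
      using continuous_measurable[OF coefficient_continuous[OF f f]] by measurable
    moreover have "cnj (L2_inner M (lreg x f) f) = L2_inner M f (lreg x f)" if "x \<in> space M" for x
      using that f by (simp add: L2.ip_cnj[of "lreg x f" f] lreg_L2 space_M)
    ultimately show "(\<lambda>x. L2_inner M f (lreg x f)) \<in> borel_measurable M"
      by (subst measurable_cong[where g = "\<lambda>x. cnj (L2_inner M (lreg x f) f)"]) auto
    show "integrable M (\<lambda>x. ((L2.nrm f)\<^sup>2)\<^sup>2 * indicator Q x)"
      using compactin_sets[OF Q] compactin_finite[OF Q] by (intro integrable_mult_right integrable_real_indicator)
    fix x assume "x \<in> space M"
    then have x: "x \<in> carrier G" by (simp add: space_M)
    show "(cmod (L2_inner M f (lreg x f)))\<^sup>2 \<le> ((L2.nrm f)\<^sup>2)\<^sup>2 * indicator Q x"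
    proof (cases "x \<in> Q")
      case True
      have "cmod (L2_inner M f (lreg x f)) \<le> L2.nrm f * L2.nrm (lreg x f)" by (intro L2.Cauchy_Schwarz f lreg_L2 x)
      also have "\<dots> = (L2.nrm f)\<^sup>2" using f x by (simp add: lreg_nrm power2_eq_square)
      finally have "(cmod (L2_inner M f (lreg x f)))\<^sup>2 \<le> ((L2.nrm f)\<^sup>2)\<^sup>2" by (intro power_mono) auto
      then show ?thesis using True by simp
    next
      case False
      have "f y * cnj (lreg x f y) = 0" if y: "y \<in> carrier G" for y
      proof (rule ccontr)
        assume "f y * cnj (lreg x f y) \<noteq> 0"
        then have "f y \<noteq> 0" "f (inv x \<otimes> y) \<noteq> 0" by (auto simp: left_regular_def)
        then have "y \<in> K" "inv x \<otimes> y \<in> K" using K(2) by blast+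
        moreover have "x = y \<otimes> inv (inv x \<otimes> y)" using x y by (simp add: inv_mult_group m_assoc[symmetric])
        ultimately have "x \<in> Q" unfolding Q_def by force
        then show False using False by simp
      qed
      then have "L2_inner M f (lreg x f) = 0"
        unfolding L2_inner_def using Bochner_Integration.integral_cong[of M M "\<lambda>y. f y * cnj (lreg x f y)" "\<lambda>_. 0"]
        by (simp add: space_M)
      then show ?thesis by simp
    qed
  qed
qed

text \<open>The densely defined map \<open>\<xi> \<mapsto> (x \<mapsto> \<langle>\<xi>, \<lambda>(x) \<Psi>\<rangle>)\<close> from sequences to functions
  intertwines the translations and is closed. Its graph is \<open>W\<close>, with the function stored in
  component \<open>0\<close>. Off its kernel, which is orthogonal to \<open>\<Psi>\<close>, the polar decomposition yields an
  isometric intertwiner, and \<open>h\<close> is the image of \<open>\<Psi>\<close>. Compact supports make the map densely defined.\<close>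

lemma dominating_vector:
  assumes \<Psi>: "\<And>n. \<Psi> n \<in> L2_fun M" and \<Psi>0: "\<Psi> 0 = 0"
    and supp: "\<And>n. \<exists>K. compactin T K \<and> (\<forall>x. x \<notin> K \<longrightarrow> \<Psi> n x = 0)"
    and sm: "summable (\<lambda>n. (L2.nrm (\<Psi> n))\<^sup>2)"
  obtains h where "h \<in> L2_fun M"
    "\<And>F c n. finite F \<Longrightarrow> F \<subseteq> carrier G \<Longrightarrow> L2.nrm (lcomb F c (\<Psi> n)) \<le> L2.nrm (lcomb F c h)"
proof -
  have \<Psi>V: "\<Psi> \<in> L2.l2V" using \<Psi> sm by (simp add: L2.l2V_def)
  \<comment> \<open>Since \<open>\<Psi> 0 = 0\<close>, component 0 does not enter the inner product
    with translates of \<Psi>, so it is free to hold the value of the map.\<close>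
  define W where "W = {Z \<in> L2.l2V. \<forall>x\<in>carrier G. Z 0 x = L2.l2ip Z (lift (lreg x) \<Psi>)}"
  have WV: "W \<subseteq> L2.l2V" by (auto simp: W_def)
  have sc0: "L2.l2sc a Z 0 x = a * Z 0 x" for a Z x by (simp add: L2.l2sc_def)
  have W: "S.subspace_of W"
    unfolding S.subspace_of_def W_def
    by (auto simp: S.zero_mem S.add_mem S.sc_mem S.ip_zero S.ip_add S.ip_sc lift_lreg_mem \<Psi>V sc0)
  obtain P where P: "S.projection_onto W P" using S.projection_exists[OF W] .
  note PP = S.projection_adjoint[OF W P] and Pc = S.projection_contraction[OF W P]
  define Q0 :: "(nat \<Rightarrow> 'a \<Rightarrow> complex) \<Rightarrow> nat \<Rightarrow> 'a \<Rightarrow> complex" where "Q0 Z = (\<lambda>n. if n = 0 then Z 0 else 0)" for Z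
  define Q1 :: "(nat \<Rightarrow> 'a \<Rightarrow> complex) \<Rightarrow> nat \<Rightarrow> 'a \<Rightarrow> complex" where "Q1 Z = (\<lambda>n. if n = 0 then 0 else Z n)" for Z
  have Qs: "Q Z \<in> L2.l2V \<and> S.nrm (Q Z) \<le> S.nrm Z" if Z: "Z \<in> L2.l2V" and Q: "\<And>n. Q Z n = Z n \<or> Q Z n = 0"
    for Q :: "(nat \<Rightarrow> 'a \<Rightarrow> complex) \<Rightarrow> nat \<Rightarrow> 'a \<Rightarrow> complex" and Z
  proof -
    have le: "(L2.nrm (Q Z n))\<^sup>2 \<le> (L2.nrm (Z n))\<^sup>2" for n using Q[of n] by (auto simp: L2.nrm_zero)
    have mem: "Q Z n \<in> L2_fun M" for n using Q[of n] Z by (auto simp: L2.l2V_D L2.zero_mem)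
    have s: "summable (\<lambda>n. (L2.nrm (Q Z n))\<^sup>2)"
      by (rule summable_comparison_test'[OF L2.l2V_D(2)[OF Z]]) (use le in simp)
    have m: "Q Z \<in> L2.l2V" using mem s by (simp add: L2.l2V_def)
    have "(S.nrm (Q Z))\<^sup>2 \<le> (S.nrm Z)\<^sup>2"
      unfolding S_nrm_sq[OF m] S_nrm_sq[OF Z] by (intro suminf_le le s L2.l2V_D Z)
    then have "S.nrm (Q Z) \<le> S.nrm Z" by (rule power2_le_imp_le) (rule S.nrm_nonneg[OF Z])
    then show ?thesis using m by blast
  qed
  have Q0m: "Q0 Z \<in> L2.l2V" "S.nrm (Q0 Z) \<le> S.nrm Z" if "Z \<in> L2.l2V" for Z
    using Qs[of Z Q0] that by (auto simp: Q0_def)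
  have Q1m: "Q1 Z \<in> L2.l2V" "S.nrm (Q1 Z) \<le> S.nrm Z" if "Z \<in> L2.l2V" for Z
    using Qs[of Z Q1] that by (auto simp: Q1_def)
  have Q0Z: "L2.l2ip (Q0 Z) Z' = L2_inner M (Z 0) (Z' 0)" if "Z' \<in> L2.l2V" for Z Z'
    unfolding L2.l2ip_def using that
    by (subst suminf_finite[of "{0}"]) (auto simp: Q0_def L2.ip_zero L2.l2V_D)
  have Q0Z': "L2.l2ip Z (Q0 Z') = L2_inner M (Z 0) (Z' 0)" if "Z \<in> L2.l2V" for Z Z'
    unfolding L2.l2ip_def using that
    by (subst suminf_finite[of "{0}"]) (auto simp: Q0_def L2.ip_zero2 L2.l2V_D)
  have A0: "S.adjoint_pair Q0 Q0" unfolding S.adjoint_pair_def by (auto simp: Q0m Q0Z Q0Z')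
  have A1: "S.adjoint_pair Q1 Q1"
  proof -
    have "L2_inner M (Q1 Z n) (Z' n) = L2_inner M (Z n) (Q1 Z' n)" if "Z \<in> L2.l2V" "Z' \<in> L2.l2V" for Z Z' n
      using that by (auto simp: Q1_def L2.ip_zero L2.ip_zero2 L2.l2V_D)
    then show ?thesis unfolding S.adjoint_pair_def by (auto simp: Q1m L2.l2ip_def)
  qed
  \<comment> \<open>Q0 and Q1 select the value and the argument of the map t with graph W. Thus Y is
    t (1 + t*t)^(-1), the corner of P from arguments to values, and X is its adjoint.\<close>
  define X where "X Z = Q1 (P (Q0 Z))" for Z
  define Y where "Y Z = Q0 (P (Q1 Z))" for Z
  have PV: "P Z \<in> L2.l2V" if "Z \<in> L2.l2V" for Z using S.adjoint_pairD(1)[OF PP] that .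
  have XY: "S.adjoint_pair X Y"
    unfolding X_def[abs_def] Y_def[abs_def]
    by (rule S.adjoint_pair_comp[OF A1 S.adjoint_pair_comp[OF PP A0]])
  have Xc: "S.nrm (X Z) \<le> S.nrm Z" if "Z \<in> L2.l2V" for Z
    unfolding X_def using that Q0m[OF that] Q1m[OF PV[OF Q0m(1)[OF that]]] Pc[OF Q0m(1)[OF that]] by linarith
  have Yc: "S.nrm (Y Z) \<le> S.nrm Z" if "Z \<in> L2.l2V" for Z
    unfolding Y_def using that Q1m[OF that] Q0m[OF PV[OF Q1m(1)[OF that]]] Pc[OF Q1m(1)[OF that]] by linarith

  have ker: "L2.l2ip q \<Psi> = 0" if q: "q \<in> L2.l2V" and Yq: "S.nrm (Y q) = 0" for q
  proof -
    define q1 where "q1 = Q1 q"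
    define p where "p = P q1"
    have q1V: "q1 \<in> L2.l2V" and pV: "p \<in> L2.l2V" by (auto simp: q1_def p_def Q1m PV q)
    have p0: "L2.nrm (p 0) = 0"
    proof -
      have "L2.nrm (Y q 0) \<le> S.nrm (Y q)" by (intro S_component S.adjoint_pairD(2)[OF XY] q)
      moreover have "Y q 0 = p 0" by (simp add: Y_def Q0_def p_def q1_def)
      ultimately show ?thesis using Yq L2.nrm_nonneg[OF L2.l2V_D(1)[OF pV, of 0]] by simp
    qed
    \<comment> \<open>Heuristically t p = 0, so the continuous function x \<mapsto> \<langle>p |
      \<lambda>(x) \<Psi>\<rangle> vanishes, in particular at \<one>. Since p is only a limit of
      graph vectors, a nearby w is used: if the value at \<one> were nonzero, \<open>w 0\<close>
      would be bounded below on a neighbourhood N, against its small norm.\<close>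
    have 1: "L2.l2ip p \<Psi> = 0"
    proof (rule ccontr)
      define \<delta> where "\<delta> = cmod (L2.l2ip p \<Psi>)"
      assume "L2.l2ip p \<Psi> \<noteq> 0"
      then have \<delta>: "\<delta> > 0" by (simp add: \<delta>_def)
      have e1: "\<delta> / 4 / (S.nrm p + 1) > 0" using \<delta> pV by (simp add: add_nonneg_pos)
      obtain N where N: "openin T N" "\<one> \<in> N" "\<forall>x\<in>N. S.nrm (lift (lreg x) \<Psi> - \<Psi>) < \<delta> / 4 / (S.nrm p + 1)"
        using lift_translation_continuous[OF \<Psi>V e1] .
      have "emeasure M N > 0" by (rule open_emeasure_pos[OF N(1,2)])
      \<comment> \<open>N may have infinite measure; r is a finite positive number below it.\<close>
      then obtain z where z: "0 < z" "z < emeasure M N" using dense by blast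
      define r where "r = enn2real z"
      have zr: "z = ennreal r" "r > 0"
        using z by (auto simp: r_def enn2real_positive_iff less_top[symmetric] dest: less_le_trans[OF _ top_greatest])
      \<comment> \<open>The first bound keeps \<langle>w - p | \<lambda>(x) \<Psi>\<rangle> below
        \<delta> / 4, leaving |w 0 x| \<ge> \<delta> / 2 on N. The second makes the squared norm of
        \<open>w 0\<close> at most a quarter of (\<delta> / 2)^2 * r, which is the
        contradiction.\<close>
      define e where "e = min (\<delta> / 4 / (S.nrm \<Psi> + 1)) (\<delta> * sqrt r / 4)"
      have e: "e > 0" using \<delta> zr \<Psi>V by (simp add: e_def add_nonneg_pos)
      obtain w where w: "w \<in> W" "S.nrm (w - p) < e" using P q1V e unfolding S.projection_onto_def p_def by blast
      have wV: "w \<in> L2.l2V" using w WV by blast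
      have low: "\<delta> / 2 \<le> cmod (w 0 x)" if x: "x \<in> N" for x
      proof -
        have xG: "x \<in> carrier G" using openin_subset_carrier N(1) x by blast
        let ?U = "lift (lreg x) \<Psi>"
        have U: "?U \<in> L2.l2V" using xG \<Psi>V by (rule lift_lreg_mem)
        have w0: "w 0 x = L2.l2ip w ?U" using w xG by (simp add: W_def)
        have "cmod (L2.l2ip p (?U - \<Psi>)) \<le> S.nrm p * S.nrm (?U - \<Psi>)" by (intro S.Cauchy_Schwarz pV S.diff_mem U \<Psi>V)
        also have "\<dots> \<le> (S.nrm p + 1) * (\<delta> / 4 / (S.nrm p + 1))"
          using N(3)[rule_format, OF x] pV by (intro mult_mono S.nrm_nonneg S.diff_mem U \<Psi>V) auto
        also have "\<dots> = \<delta> / 4"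
        proof -
          have "S.nrm p + 1 \<noteq> 0" using S.nrm_nonneg[OF pV] by linarith
          then show ?thesis by (metis nonzero_mult_div_cancel_left times_divide_eq_right)
        qed
        finally have a: "cmod (L2.l2ip p (?U - \<Psi>)) \<le> \<delta> / 4" .
        have "cmod (L2.l2ip (w - p) ?U) \<le> S.nrm (w - p) * S.nrm ?U" by (intro S.Cauchy_Schwarz pV wV S.diff_mem U)
        also have "\<dots> = S.nrm (w - p) * S.nrm \<Psi>" using xG \<Psi>V by (simp add: lift_lreg_nrm)
        also have "\<dots> \<le> \<delta> / 4 / (S.nrm \<Psi> + 1) * (S.nrm \<Psi> + 1)"
          using w(2) \<Psi>V \<delta> by (intro mult_mono) (auto simp: e_def add_nonneg_nonneg)
        also have "\<dots> = \<delta> / 4"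
        proof -
          have "S.nrm \<Psi> + 1 \<noteq> 0" using S.nrm_nonneg[OF \<Psi>V] by linarith
          then show ?thesis by (metis nonzero_eq_divide_eq)
        qed
        finally have b: "cmod (L2.l2ip (w - p) ?U) \<le> \<delta> / 4" .
        have "L2.l2ip p \<Psi> = L2.l2ip w ?U - L2.l2ip p (?U - \<Psi>) - L2.l2ip (w - p) ?U"
          using U pV wV \<Psi>V by (simp add: S.ip_diff S.ip_diff2)
        then have "cmod (L2.l2ip p \<Psi>) = cmod (L2.l2ip w ?U - L2.l2ip p (?U - \<Psi>) - L2.l2ip (w - p) ?U)"
          by (rule arg_cong)
        then have "\<delta> \<le> cmod (L2.l2ip w ?U) + cmod (L2.l2ip p (?U - \<Psi>)) + cmod (L2.l2ip (w - p) ?U)"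
          using norm_triangle_ineq4[of "L2.l2ip w ?U - L2.l2ip p (?U - \<Psi>)" "L2.l2ip (w - p) ?U"]
            norm_triangle_ineq4[of "L2.l2ip w ?U" "L2.l2ip p (?U - \<Psi>)"] unfolding \<delta>_def by linarith
        then show ?thesis using a b w0 by simp
      qed
      have "ennreal ((\<delta> / 2)\<^sup>2) * ennreal r \<le> ennreal ((\<delta> / 2)\<^sup>2) * emeasure M N"
        using z zr by (intro mult_left_mono) auto
      also have "\<dots> = (\<integral>\<^sup>+x. ennreal ((\<delta> / 2)\<^sup>2) * indicator N x \<partial>M)"
        using openin_sets[OF N(1)] by (simp add: nn_integral_cmult_indicator)
      also have "\<dots> \<le> (\<integral>\<^sup>+x. ennreal ((cmod (w 0 x))\<^sup>2) \<partial>M)"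
      proof (rule nn_integral_mono)
        fix x
        show "ennreal ((\<delta> / 2)\<^sup>2) * indicator N x \<le> ennreal ((cmod (w 0 x))\<^sup>2)"
          using low[of x] \<delta> by (cases "x \<in> N") (auto intro!: ennreal_leI power_mono)
      qed
      also have "\<dots> = ennreal ((L2.nrm (w 0))\<^sup>2)" using wV by (simp add: nn_L2 L2.l2V_D L2.nrm_sq)
      also have "\<dots> \<le> ennreal (e\<^sup>2)"
      proof (intro ennreal_leI power_mono L2.nrm_nonneg L2.l2V_D wV)
        have "L2.nrm (w 0) \<le> L2.nrm (w 0 - p 0) + L2.nrm (p 0)"
          using L2.nrm_triangle[of "w 0 - p 0" "p 0"] wV pV by (simp add: L2.l2V_D L2.diff_mem)
        also have "\<dots> \<le> S.nrm (w - p)" using S_component[OF S.diff_mem[OF wV pV], of 0] p0 by simp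
        finally show "L2.nrm (w 0) \<le> e" using w(2) by linarith
      qed
      finally have "(\<delta> / 2)\<^sup>2 * r \<le> e\<^sup>2" using zr by (simp add: ennreal_mult[symmetric])
      also have "\<dots> \<le> (\<delta> * sqrt r / 4)\<^sup>2"
      proof (rule power_mono)
        show "e \<le> \<delta> * sqrt r / 4" unfolding e_def by (rule min.cobounded2)
      qed (use e in simp)
      also have "\<dots> = (\<delta> / 2)\<^sup>2 * r / 4" using zr by (simp add: power_mult_distrib power_divide)
      finally show False using \<delta> zr by simp
    qed
    \<comment> \<open>The vector q1 - p is orthogonal to W, and its component 0 is null. By compact
      supports, each truncation of \<Psi> has a square integrable image c, so together with c in
      component 0 it lies in W and is orthogonal to q1 - p; then the truncation is released.\<close>
    have 2: "L2.l2ip \<Psi> (q1 - p) = 0"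
    proof -
      define z where "z = q1 - p"
      have zV: "z \<in> L2.l2V" unfolding z_def by (intro S.diff_mem q1V pV)
      have z0: "L2_inner M f (z 0) = 0" if f: "f \<in> L2_fun M" for f
      proof -
        have "z 0 = - p 0" by (simp add: z_def q1_def Q1_def)
        then have "L2.nrm (z 0) = 0" using p0 L2.nrm_neg[OF L2.l2V_D(1)[OF pV]] by simp
        then show ?thesis using L2.Cauchy_Schwarz[OF f L2.l2V_D(1)[OF zV, of 0]] by simp
      qed
      have part: "(\<Sum>m<Suc n. L2_inner M (\<Psi> m) (z m)) = 0" for n
      proof -
        define c where "c = (\<Sum>m\<in>{1..n}. (\<lambda>x. L2_inner M (\<Psi> m) (lreg x (\<Psi> m))))"
        have cL: "c \<in> L2_fun M" unfolding c_def using supp compact_support_coefficient[OF \<Psi>] by (intro L2.sum_mem) blast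
        define \<Phi> where "\<Phi> m = (if m = 0 then c else if m \<le> n then \<Psi> m else 0)" for m
        have \<Phi>V: "\<Phi> \<in> L2.l2V"
          unfolding L2.l2V_def
        proof (intro CollectI conjI allI)
          show "\<Phi> m \<in> L2_fun M" for m using cL \<Psi> by (simp add: \<Phi>_def L2.zero_mem)
          show "summable (\<lambda>m. (L2.nrm (\<Phi> m))\<^sup>2)"
            by (rule summable_finite[of "{..n}"]) (auto simp: \<Phi>_def L2.nrm_zero)
        qed
        have \<Phi>0: "\<Phi> 0 = c" by (simp add: \<Phi>_def)
        have ip\<Phi>: "L2.l2ip \<Phi> v = L2_inner M c (v 0) + (\<Sum>m\<in>{1..n}. L2_inner M (\<Psi> m) (v m))" if v: "v \<in> L2.l2V" for v
        proof -
          have "L2.l2ip \<Phi> v = (\<Sum>m\<in>{0..n}. L2_inner M (\<Phi> m) (v m))"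
            unfolding L2.l2ip_def using v by (intro suminf_finite) (auto simp: \<Phi>_def L2.ip_zero L2.l2V_D)
          also have "\<dots> = L2_inner M (\<Phi> 0) (v 0) + (\<Sum>m\<in>{1..n}. L2_inner M (\<Phi> m) (v m))"
            by (simp add: sum.atLeast_Suc_atMost)
          also have "(\<Sum>m\<in>{1..n}. L2_inner M (\<Phi> m) (v m)) = (\<Sum>m\<in>{1..n}. L2_inner M (\<Psi> m) (v m))"
            by (intro sum.cong) (auto simp: \<Phi>_def)
          finally show ?thesis unfolding \<Phi>0 .
        qed
        have "\<Phi> \<in> W" unfolding W_def
        proof (intro CollectI conjI ballI \<Phi>V)
          fix x assume x: "x \<in> carrier G"
          have "lreg x (\<Psi> 0) = 0" by (simp add: \<Psi>0 left_regular_def fun_eq_iff)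
          then show "\<Phi> 0 x = L2.l2ip \<Phi> (lift (lreg x) \<Psi>)"
            using ip\<Phi>[OF lift_lreg_mem[OF x \<Psi>V]] cL by (simp add: lift_def L2.ip_zero2 \<Phi>_def c_def sum_fun_apply)
        qed
        then have "L2.l2ip \<Phi> z = 0"
          using P q1V pV \<Phi>V by (simp add: z_def S.ip_diff2 S.projection_onto_def p_def)
        then have "(\<Sum>m\<in>{1..n}. L2_inner M (\<Psi> m) (z m)) = 0" using ip\<Phi>[OF zV] z0[OF cL] by simp
        moreover have "(\<Sum>m<Suc n. L2_inner M (\<Psi> m) (z m)) = L2_inner M (\<Psi> 0) (z 0) + (\<Sum>m\<in>{1..n}. L2_inner M (\<Psi> m) (z m))"
          unfolding lessThan_Suc_atMost atMost_atLeast0 by (simp add: sum.atLeast_Suc_atMost)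
        ultimately show ?thesis using z0[OF \<Psi>[of 0]] by simp
      qed
      have "(\<lambda>n. \<Sum>m<n. L2_inner M (\<Psi> m) (z m)) \<longlonglongrightarrow> L2.l2ip \<Psi> z"
        unfolding L2.l2ip_def by (rule summable_LIMSEQ[OF L2.l2_summable_ip[OF \<Psi>V zV]])
      then have "(\<lambda>n. \<Sum>m<Suc n. L2_inner M (\<Psi> m) (z m)) \<longlonglongrightarrow> L2.l2ip \<Psi> z" by (rule LIMSEQ_Suc)
      then have "(\<lambda>n. 0 :: complex) \<longlonglongrightarrow> L2.l2ip \<Psi> z" unfolding part .
      then show ?thesis by (simp add: LIMSEQ_const_iff z_def)
    qed
    have "L2.l2ip q \<Psi> = L2.l2ip q1 \<Psi>"
      unfolding L2.l2ip_def using q \<Psi>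
      by (intro suminf_cong) (auto simp: q1_def Q1_def \<Psi>0 L2.ip_zero L2.ip_zero2 L2.l2V_D L2.zero_mem)
    also have "\<dots> = L2.l2ip (q1 - p) \<Psi> + L2.l2ip p \<Psi>" using q1V pV \<Psi>V by (simp add: S.ip_diff)
    also have "L2.l2ip (q1 - p) \<Psi> = 0" using 2 S.ip_cnj[OF \<Psi>V S.diff_mem[OF q1V pV]] by simp
    finally show ?thesis using 1 by simp
  qed

  obtain H where H: "H \<in> L2.l2V"
    and HQ: "\<And>Q Q'. S.adjoint_pair Q Q' \<Longrightarrow> (\<And>Z. Z \<in> L2.l2V \<Longrightarrow> S.eqv (Q (Y Z)) (Y Z)) \<Longrightarrow> S.eqv (Q H) H"
    and HA: "\<And>A A' c. S.adjoint_pair A A' \<Longrightarrow> (\<And>Z. Z \<in> L2.l2V \<Longrightarrow> S.nrm (A Z) \<le> c * S.nrm Z) \<Longrightarrow>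
      (\<And>Z. Z \<in> L2.l2V \<Longrightarrow> S.eqv (A (X Z)) (X (A Z))) \<Longrightarrow> (\<And>Z. Z \<in> L2.l2V \<Longrightarrow> S.eqv (A (Y Z)) (Y (A Z))) \<Longrightarrow>
      S.nrm (A \<Psi>) \<le> S.nrm (A H)"
    using S.polar_vector[OF XY Xc Yc \<Psi>V ker] by blast
  \<comment> \<open>The range of Y is carried by component 0, hence so is H up to norm zero, and
    \<open>H 0\<close> retains the whole norm of H under every lifted operator.\<close>
  have QH: "S.eqv (Q0 H) H" by (rule HQ[OF A0]) (simp add: Y_def Q0_def)

  show thesis
  proof (rule that)
    show "H 0 \<in> L2_fun M" using H by (simp add: L2.l2V_D)
    fix F :: "'a set" and c n assume F: "finite F" "F \<subseteq> carrier G"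
    let ?A = "lift (lcomb F c)" and ?A' = "lift (lcomb (m_inv G ` F) (\<lambda>x. cnj (c (inv x))))"
    have F': "finite (m_inv G ` F)" "m_inv G ` F \<subseteq> carrier G" using F by auto
    note AA = lift_lcomb_adjoint[OF F, of c]
    \<comment> \<open>Translating a graph vector by y moves its value function along:
      \<langle>\<lambda>(y) w | \<lambda>(x) \<Psi>\<rangle> = \<langle>w | \<lambda>(y^(-1) x)
      \<Psi>\<rangle>, which is w 0 at y^(-1) x. With \<open>projection_commute\<close> this makes P
      commute with the lifted operators.\<close>
    have AW: "lift (lcomb F c) w \<in> W" if F: "finite F" "F \<subseteq> carrier G" and w: "w \<in> W" for F c w
    proof -
      have wV: "w \<in> L2.l2V" and w0: "\<And>x. x \<in> carrier G \<Longrightarrow> w 0 x = L2.l2ip w (lift (lreg x) \<Psi>)"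
        using w by (auto simp: W_def)
      show ?thesis unfolding W_def
      proof (intro CollectI conjI ballI lift_lcomb_mem F wV)
        fix x assume x: "x \<in> carrier G"
        have yx: "inv y \<otimes> x \<in> carrier G" if "y \<in> F" for y using that F x by auto
        have sm: "summable (\<lambda>n. c y * L2_inner M (w n) (lreg (inv y \<otimes> x) (\<Psi> n)))" if "y \<in> F" for y
          using L2.l2_summable_ip[OF wV lift_lreg_mem[OF yx[OF that] \<Psi>V]] by (intro summable_mult) (simp add: lift_def)
        have "L2.l2ip (lift (lcomb F c) w) (lift (lreg x) \<Psi>)
            = (\<Sum>n. \<Sum>y\<in>F. c y * L2_inner M (w n) (lreg (inv y \<otimes> x) (\<Psi> n)))"
          unfolding L2.l2ip_def
        proof (rule suminf_cong)
          fix n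
          have wn: "w n \<in> L2_fun M" using wV by (rule L2.l2V_D)
          have "L2_inner M (lift (lcomb F c) w n) (lift (lreg x) \<Psi> n) = (\<Sum>y\<in>F. c y * L2_inner M (lreg y (w n)) (lreg x (\<Psi> n)))"
            unfolding lift_def using F wn x \<Psi> by (intro lcomb_inner lreg_L2)
          also have "\<dots> = (\<Sum>y\<in>F. c y * L2_inner M (w n) (lreg (inv y \<otimes> x) (\<Psi> n)))"
          proof (intro sum.cong refl)
            fix y assume "y \<in> F"
            then have y: "y \<in> carrier G" using F by blast
            have "L2_inner M (lreg y (w n)) (lreg x (\<Psi> n)) = L2_inner M (w n) (lreg (inv y) (lreg x (\<Psi> n)))"
              using y wn x \<Psi> by (intro lreg_adjoint lreg_L2)
            also have "\<dots> = L2_inner M (w n) (lreg (inv y \<otimes> x) (\<Psi> n))"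
              using x y by (intro L2_inner_cong) (simp_all add: lreg_mult)
            finally show "c y * L2_inner M (lreg y (w n)) (lreg x (\<Psi> n)) = c y * L2_inner M (w n) (lreg (inv y \<otimes> x) (\<Psi> n))" by simp
          qed
          finally show "L2_inner M (lift (lcomb F c) w n) (lift (lreg x) \<Psi> n) = (\<Sum>y\<in>F. c y * L2_inner M (w n) (lreg (inv y \<otimes> x) (\<Psi> n)))" .
        qed
        also have "\<dots> = (\<Sum>y\<in>F. \<Sum>n. c y * L2_inner M (w n) (lreg (inv y \<otimes> x) (\<Psi> n)))"
          by (rule suminf_sum[OF sm])
        also have "\<dots> = (\<Sum>y\<in>F. c y * w 0 (inv y \<otimes> x))"
        proof (intro sum.cong refl)
          fix y assume y: "y \<in> F"
          show "(\<Sum>n. c y * L2_inner M (w n) (lreg (inv y \<otimes> x) (\<Psi> n))) = c y * w 0 (inv y \<otimes> x)"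
            using L2.l2_summable_ip[OF wV lift_lreg_mem[OF yx[OF y] \<Psi>V]]
            by (simp add: w0[OF yx[OF y]] L2.l2ip_def lift_def suminf_mult)
        qed
        also have "\<dots> = lift (lcomb F c) w 0 x" by (simp add: lift_def lcomb_def left_regular_def)
        finally show "lift (lcomb F c) w 0 x = L2.l2ip (lift (lcomb F c) w) (lift (lreg x) \<Psi>)" by simp
      qed
    qed
    have comm: "S.eqv (?A (P Z)) (P (?A Z))" if "Z \<in> L2.l2V" for Z
      by (rule S.projection_commute[OF W P AA lift_lcomb_mem(2)[OF F(2)] AW[OF F] AW[OF F'] that])
    have AQ0: "?A (Q0 Z) = Q0 (?A Z)" for Z by (simp add: lift_def Q0_def fun_eq_iff lcomb_zero[unfolded fun_eq_iff, simplified])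
    have AQ1: "?A (Q1 Z) = Q1 (?A Z)" for Z by (simp add: lift_def Q1_def fun_eq_iff lcomb_zero[unfolded fun_eq_iff, simplified])
    have AV: "?A Z \<in> L2.l2V" if "Z \<in> L2.l2V" for Z using F that by (intro lift_lcomb_mem)
    have "S.nrm (?A \<Psi>) \<le> S.nrm (?A H)"
    proof (rule HA[OF AA lift_lcomb_mem(2)[OF F(2)]])
      fix Z assume Z: "Z \<in> L2.l2V"
      show "S.eqv (?A (X Z)) (X (?A Z))"
        unfolding X_def AQ1 AQ0[symmetric]
        by (intro S.adjoint_eqv[OF A1] comm Q0m Z AV PV)
      show "S.eqv (?A (Y Z)) (Y (?A Z))"
        unfolding Y_def AQ0 AQ1[symmetric]
        by (intro S.adjoint_eqv[OF A0] comm Q1m Z AV PV)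
    qed
    also have "S.nrm (?A H) = S.nrm (?A (Q0 H))"
      by (intro S.eqv_nrm S.eqv_sym[OF S.adjoint_eqv[OF AA QH]] AV Q0m H)
    also have "\<dots> = L2.nrm (lcomb F c (H 0))"
    proof -
      have "?A (Q0 H) = (\<lambda>n. if n = 0 then lcomb F c (H 0) else 0)" unfolding AQ0 by (simp add: Q0_def lift_def fun_eq_iff)
      then show ?thesis using single_mem(2)[of "lcomb F c (H 0)" 0] F H by (simp add: lcomb_L2 L2.l2V_D)
    qed
    finally have "S.nrm (?A \<Psi>) \<le> L2.nrm (lcomb F c (H 0))" .
    moreover have "L2.nrm (lcomb F c (\<Psi> n)) \<le> S.nrm (?A \<Psi>)" using S_component[OF AV[OF \<Psi>V], of n] by (simp add: lift_def)
    ultimately show "L2.nrm (lcomb F c (\<Psi> n)) \<le> L2.nrm (lcomb F c (H 0))" by linarith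
  qed
qed

text \<open>f need not have compact support, so it is expanded into differences of its cut-offs.
  Errors of order 4^(-n) leave room for weights 2^m in a square summable \<Psi>; each piece is then
  dominated with factor 2^(-m), and these factors add up to at most 2.\<close>

lemma dominating_pair:
  assumes f: "f \<in> L2_fun M" and k: "k \<in> L2_fun M" and Kk: "compactin T Kk" "\<And>x. x \<notin> Kk \<Longrightarrow> k x = 0"
  obtains h where "h \<in> L2_fun M"
    "\<And>F c. finite F \<Longrightarrow> F \<subseteq> carrier G \<Longrightarrow> L2.nrm (lcomb F c f) \<le> 2 * L2.nrm (lcomb F c h)"
    "\<And>F c. finite F \<Longrightarrow> F \<subseteq> carrier G \<Longrightarrow> L2.nrm (lcomb F c k) \<le> L2.nrm (lcomb F c h)"
proof -
  have "\<exists>K. compactin T K \<and> L2.nrm (f - cut K f) < (1/4) ^ n" for n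
    by (rule compact_support_approx[OF f]) simp
  then obtain K where K: "\<And>n. compactin T (K n)" "\<And>n. L2.nrm (f - cut (K n) f) < (1/4) ^ n" by metis
  have cL: "cut (K n) f \<in> L2_fun M" for n using K(1) f by (intro cut_L2 compactin_sets)
  define \<psi> where "\<psi> n = (case n of 0 \<Rightarrow> cut (K 0) f | Suc m \<Rightarrow> cut (K (Suc m)) f - cut (K m) f)" for n
  have \<psi>L: "\<psi> n \<in> L2_fun M" for n by (auto simp: \<psi>_def cL L2.diff_mem split: nat.split)
  have \<psi>sum: "(\<Sum>j\<le>n. \<psi> j) = cut (K n) f" for n
    by (induction n) (simp_all add: \<psi>_def)
  have \<psi>n: "L2.nrm (\<psi> (Suc n)) \<le> 2 * (1/4) ^ n" for n
  proof -
    have eq: "\<psi> (Suc n) = (f - cut (K n) f) - (f - cut (K (Suc n)) f)" by (simp add: \<psi>_def)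
    have "L2.nrm (\<psi> (Suc n)) \<le> L2.nrm (f - cut (K n) f) + L2.nrm (f - cut (K (Suc n)) f)"
      unfolding eq by (intro L2.nrm_triangle_diff L2.diff_mem f cL)
    moreover have "(1/4 :: real) ^ Suc n \<le> (1/4) ^ n" by simp
    ultimately show ?thesis using K(2)[of n] K(2)[of "Suc n"] by linarith
  qed
  \<comment> \<open>Component 0 must be zero for \<open>dominating_vector\<close>, component 1
    carries k, and the weighted pieces of f begin at component 2.\<close>
  define \<Psi> where "\<Psi> n = (case n of 0 \<Rightarrow> 0 | Suc 0 \<Rightarrow> k | Suc (Suc m) \<Rightarrow> (\<lambda>x. of_real (2 ^ m) * \<psi> m x))" for n
  have \<Psi>2: "\<Psi> (Suc (Suc m)) = (\<lambda>x. of_real (2 ^ m) * \<psi> m x)" for m by (simp add: \<Psi>_def)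
  have n2: "L2.nrm (\<Psi> (Suc (Suc m))) = 2 ^ m * L2.nrm (\<psi> m)" for m
    unfolding \<Psi>2 by (subst L2.nrm_sc[OF \<psi>L]) (simp add: norm_power)
  obtain h where h: "h \<in> L2_fun M"
    "\<And>F c n. finite F \<Longrightarrow> F \<subseteq> carrier G \<Longrightarrow> L2.nrm (lcomb F c (\<Psi> n)) \<le> L2.nrm (lcomb F c h)"
  proof (rule dominating_vector[of \<Psi>])
    show "\<Psi> n \<in> L2_fun M" for n
      using L2.zero_mem k L2.sc_mem[OF \<psi>L] by (auto simp: \<Psi>_def split: nat.split)
    show "\<Psi> 0 = 0" by (simp add: \<Psi>_def)
    have \<psi>0: "\<psi> m x = 0" if "x \<notin> K m \<union> K (m - 1)" for m x
      using that by (auto simp: \<psi>_def cut_def split: nat.split)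
    show "\<exists>K. compactin T K \<and> (\<forall>x. x \<notin> K \<longrightarrow> \<Psi> n x = 0)" for n
    proof (cases n)
      case 0
      then show ?thesis by (intro exI[of _ "{}"]) (simp add: \<Psi>_def)
    next
      case (Suc n')
      show ?thesis
      proof (cases n')
        case 0
        then show ?thesis using Suc Kk by (intro exI[of _ Kk]) (auto simp: \<Psi>_def)
      next
        case (Suc m)
        then show ?thesis using \<open>n = Suc n'\<close> \<psi>0[of _ m] K(1)
          by (intro exI[of _ "K m \<union> K (m - 1)"]) (auto simp: \<Psi>2 intro!: compactin_Un)
      qed
    qed
    \<comment> \<open>The shift by 3 skips 0, k and the first piece of f; the estimate
      \<open>\<psi>n\<close> begins with the piece of index 1.\<close>
    show "summable (\<lambda>n. (L2.nrm (\<Psi> n))\<^sup>2)"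
    proof (subst summable_iff_shift[of _ 3, symmetric], rule summable_comparison_test')
      show "summable (\<lambda>n. 16 * (1/4 :: real) ^ n)" by (intro summable_mult summable_geometric) simp
      fix n :: nat
      have "L2.nrm (\<Psi> (n + 3)) = 2 ^ Suc n * L2.nrm (\<psi> (Suc n))" using n2[of "Suc n"] by (simp add: numeral_3_eq_3)
      also have "\<dots> \<le> 2 ^ Suc n * (2 * (1/4) ^ n)" by (intro mult_left_mono \<psi>n) simp
      also have "\<dots> = 4 * (1/2) ^ n" by (simp add: field_simps power_mult_distrib[symmetric])
      finally have "(L2.nrm (\<Psi> (n + 3)))\<^sup>2 \<le> (4 * (1/2) ^ n)\<^sup>2"
        using L2.nrm_nonneg[OF L2.sc_mem[OF \<psi>L[of "Suc n"], of "of_real (2 ^ Suc n)"]] \<Psi>2[of "Suc n"]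
        by (intro power_mono) (auto simp: numeral_3_eq_3)
      also have "\<dots> = 16 * (1/4) ^ n" by (simp add: power_mult_distrib power2_eq_square power_mult_distrib[symmetric])
      finally show "norm ((L2.nrm (\<Psi> (n + 3)))\<^sup>2) \<le> 16 * (1/4) ^ n" by simp
    qed
  qed blast
  show thesis
  proof (rule that[OF h(1)])
    fix F :: "'a set" and c assume F: "finite F" "F \<subseteq> carrier G"
    show "L2.nrm (lcomb F c k) \<le> L2.nrm (lcomb F c h)" using h(2)[OF F, of c 1] by (simp add: \<Psi>_def)
    let ?H = "L2.nrm (lcomb F c h)" and ?C = "\<Sum>x\<in>F. cmod (c x)"
    have H: "0 \<le> ?H" by (intro L2.nrm_nonneg lcomb_L2 F h)
    note AA = lcomb_adjoint[OF F, of c] and AL = lcomb_L2[OF F(2), of _ c]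
    have \<psi>H: "L2.nrm (lcomb F c (\<psi> m)) \<le> (1/2) ^ m * ?H" for m
    proof -
      have "lcomb F c (\<Psi> (Suc (Suc m))) = (\<lambda>y. of_real (2 ^ m) * lcomb F c (\<psi> m) y)"
        unfolding \<Psi>2 by (simp add: lcomb_def left_regular_def sum_distrib_left mult_ac fun_eq_iff)
      then have "2 ^ m * L2.nrm (lcomb F c (\<psi> m)) = L2.nrm (lcomb F c (\<Psi> (Suc (Suc m))))"
        using L2.nrm_sc[OF AL[OF \<psi>L[of m]], of "of_real (2 ^ m)"] by (simp add: norm_power)
      also have "\<dots> \<le> ?H" by (rule h(2)[OF F])
      finally show ?thesis by (simp add: field_simps power_one_over)
    qed
    have cutH: "L2.nrm (lcomb F c (cut (K n) f)) \<le> 2 * ?H" for n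
    proof -
      have "lcomb F c (cut (K n) f) = (\<Sum>j\<le>n. lcomb F c (\<psi> j))"
      proof
        fix y
        have "lcomb F c (cut (K n) f) y = (\<Sum>x\<in>F. \<Sum>j\<le>n. c x * lreg x (\<psi> j) y)"
          unfolding \<psi>sum[symmetric] by (simp add: lcomb_def left_regular_def sum_fun_apply sum_distrib_left)
        also have "\<dots> = (\<Sum>j\<le>n. lcomb F c (\<psi> j)) y" unfolding sum_fun_apply lcomb_def by (rule sum.swap)
        finally show "lcomb F c (cut (K n) f) y = (\<Sum>j\<le>n. lcomb F c (\<psi> j)) y" .
      qed
      then have "L2.nrm (lcomb F c (cut (K n) f)) \<le> (\<Sum>j\<le>n. L2.nrm (lcomb F c (\<psi> j)))"
        using L2.nrm_sum[of "{..n}" "\<lambda>j. lcomb F c (\<psi> j)"] AL[OF \<psi>L] by simp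
      also have "\<dots> \<le> (\<Sum>j\<le>n. (1/2) ^ j * ?H)" by (intro sum_mono \<psi>H)
      also have "\<dots> = (\<Sum>j\<le>n. (1/2) ^ j) * ?H" by (simp add: sum_distrib_right)
      also have "\<dots> \<le> 2 * ?H"
      proof (rule mult_right_mono[OF _ H])
        have "(\<Sum>j\<le>n. (1/2 :: real) ^ j) = 2 - (1/2) ^ n" by (induction n) simp_all
        then show "(\<Sum>j\<le>n. (1/2 :: real) ^ j) \<le> 2" by simp
      qed
      finally show ?thesis .
    qed
    have "L2.nrm (lcomb F c f) \<le> ?C * (1/4) ^ n + 2 * ?H" for n
    proof -
      have "L2.nrm (lcomb F c f - lcomb F c (cut (K n) f)) = L2.nrm (lcomb F c (f - cut (K n) f))"
        using L2.adjoint_diff[OF AA f cL] by (intro L2.eqv_nrm) (auto intro: L2.eqv_sym simp: AL f cL L2.diff_mem)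
      also have "\<dots> \<le> ?C * L2.nrm (f - cut (K n) f)" by (intro lcomb_bound F L2.diff_mem f cL)
      also have "\<dots> \<le> ?C * (1/4) ^ n" by (intro mult_left_mono less_imp_le[OF K(2)] sum_nonneg) simp
      finally show ?thesis
        using L2.nrm_triangle[of "lcomb F c f - lcomb F c (cut (K n) f)" "lcomb F c (cut (K n) f)"] cutH[of n]
        by (simp add: AL f cL L2.diff_mem)
    qed
    moreover have "(\<lambda>n. ?C * (1/4) ^ n + 2 * ?H) \<longlonglongrightarrow> ?C * 0 + 2 * ?H"
      by (intro tendsto_add tendsto_mult tendsto_const LIMSEQ_power_zero) simp
    ultimately have "L2.nrm (lcomb F c f) \<le> ?C * 0 + 2 * ?H" by (intro LIMSEQ_le_const) auto
    then show "L2.nrm (lcomb F c f) \<le> 2 * ?H" by simp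
  qed
qed

text \<open>The case of Eymard's theorem used for the projection, with k carried by a compact set
  and f arbitrary. The Riesz bound \<open>2 * L2.nrm g + L2.nrm w\<close> collects the constants of
  \<open>dominating_pair\<close>; it also shows that \<phi> F c depends only on the vector
  \<open>lcomb F c h\<close>, which different F and c may share.\<close>

lemma fourier_algebra_add:
  assumes fg: "f \<in> L2_fun M" "g \<in> L2_fun M" and kw: "k \<in> L2_fun M" "w \<in> L2_fun M"
    and Kk: "compactin T Kk" "\<And>x. x \<notin> Kk \<Longrightarrow> k x = 0"
  shows "(\<lambda>x. matrix_coefficient G M f g x + matrix_coefficient G M k w x) \<in> fourier_algebra G M"
proof -
  obtain h where h: "h \<in> L2_fun M"
    "\<And>F c. finite F \<Longrightarrow> F \<subseteq> carrier G \<Longrightarrow> L2.nrm (lcomb F c f) \<le> 2 * L2.nrm (lcomb F c h)"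
    "\<And>F c. finite F \<Longrightarrow> F \<subseteq> carrier G \<Longrightarrow> L2.nrm (lcomb F c k) \<le> L2.nrm (lcomb F c h)"
    using dominating_pair[OF fg(1) kw(1) Kk] by blast
  define \<phi> where "\<phi> F c = L2_inner M (lcomb F c f) g + L2_inner M (lcomb F c k) w" for F c
  define R where "R = {(lcomb F c h, \<phi> F c) |F c. finite F \<and> F \<subseteq> carrier G}"
  obtain y where y: "y \<in> L2_fun M" "\<And>u z. (u, z) \<in> R \<Longrightarrow> z = L2_inner M u y"
  proof (rule L2.Riesz_graph[of R "2 * L2.nrm g + L2.nrm w"])
    show "R \<subseteq> L2_fun M \<times> UNIV" using h by (auto simp: R_def lcomb_L2)
    have "lcomb {} (\<lambda>_. 0) h = 0" "\<phi> {} (\<lambda>_. 0) = 0"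
      using fg kw by (auto simp: lcomb_def \<phi>_def fun_eq_iff L2_zero)
    then show "(0, 0) \<in> R" unfolding R_def by (auto intro!: exI[of _ "{}"] exI[of _ "\<lambda>_. 0"])
    show "(u + u', z + z') \<in> R" if uz: "(u, z) \<in> R" "(u', z') \<in> R" for u z u' z'
    proof -
      obtain F c where 1: "u = lcomb F c h" "z = \<phi> F c" "finite F" "F \<subseteq> carrier G" using uz by (auto simp: R_def)
      obtain F' c' where 2: "u' = lcomb F' c' h" "z' = \<phi> F' c'" "finite F'" "F' \<subseteq> carrier G" using uz by (auto simp: R_def)
      obtain d where d: "\<And>f. lcomb F c f + lcomb F' c' f = lcomb (F \<union> F') d f"
        using lcomb_add[OF 1(3,4) 2(3,4)] by blast
      have "z + z' = \<phi> (F \<union> F') d"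
        unfolding 1 2 \<phi>_def d[symmetric] using 1 2 fg kw by (simp add: L2.ip_add lcomb_L2)
      then show ?thesis unfolding R_def using 1 2 d[of h] by (auto intro!: exI[of _ "F \<union> F'"])
    qed
    show "((\<lambda>x. a * u x), a * z) \<in> R" if uz: "(u, z) \<in> R" for u z a
    proof -
      obtain F c where 1: "u = lcomb F c h" "z = \<phi> F c" "finite F" "F \<subseteq> carrier G" using uz by (auto simp: R_def)
      have "a * z = \<phi> F (\<lambda>x. a * c x)"
        unfolding 1 \<phi>_def lcomb_scale[symmetric] using 1 fg kw by (simp add: L2.ip_sc lcomb_L2 distrib_left)
      then show ?thesis unfolding R_def using 1 lcomb_scale[of a F c h] by blast
    qed
    show "cmod z \<le> (2 * L2.nrm g + L2.nrm w) * L2.nrm u" if uz: "(u, z) \<in> R" for u z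
    proof -
      obtain F c where 1: "u = lcomb F c h" "z = \<phi> F c" "finite F" "F \<subseteq> carrier G" using uz by (auto simp: R_def)
      have "cmod z \<le> cmod (L2_inner M (lcomb F c f) g) + cmod (L2_inner M (lcomb F c k) w)"
        unfolding 1 \<phi>_def by (rule norm_triangle_ineq)
      also have "\<dots> \<le> L2.nrm (lcomb F c f) * L2.nrm g + L2.nrm (lcomb F c k) * L2.nrm w"
        using 1 fg kw by (intro add_mono L2.Cauchy_Schwarz lcomb_L2)
      also have "\<dots> \<le> (2 * L2.nrm u) * L2.nrm g + L2.nrm u * L2.nrm w"
        unfolding 1(1) using 1 fg kw by (intro add_mono mult_right_mono h L2.nrm_nonneg)
      finally show ?thesis by (simp add: algebra_simps)
    qed
  qed blast
  have "(\<lambda>x. matrix_coefficient G M f g x + matrix_coefficient G M k w x) = matrix_coefficient G M h y"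
  proof
    fix x
    show "matrix_coefficient G M f g x + matrix_coefficient G M k w x = matrix_coefficient G M h y x"
    proof (cases "x \<in> carrier G")
      case True
      have "(lcomb {x} (\<lambda>_. 1) h, \<phi> {x} (\<lambda>_. 1)) \<in> R" unfolding R_def using True by blast
      from y(2)[OF this] show ?thesis using True
        by (simp add: matrix_coefficient_apply \<phi>_def lreg_lcomb[symmetric])
    qed (simp add: matrix_coefficient_def zero_extension_def)
  qed
  then show ?thesis using h y by (auto simp: fourier_algebra_def)
qed

end

section \<open>Leinert sets\<close>

lemma count_space_left_invariant:
  assumes "group D"
  shows "left_invariant_measure D (count_space (carrier D))"
proof -
  interpret group D by fact
  show ?thesis
  proof
    fix x A assume xA: "x \<in> carrier D" "A \<in> sets (count_space (carrier D))"
    then show "x <#\<^bsub>D\<^esub> A \<in> sets (count_space (carrier D))" by (auto simp: l_coset_def)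
    show "emeasure (count_space (carrier D)) (x <#\<^bsub>D\<^esub> A) = emeasure (count_space (carrier D)) A"
      using count_space_left_haar_measure[OF assms] xA unfolding left_haar_measure_def by blast
  qed simp
qed

text \<open>The isomorphism need not be the identity, but it carries the point mass at \<open>x\<close> to a nonzero
  idempotent; at any point \<open>\<sigma> x\<close> where that idempotent is \<open>1\<close>, the image of \<open>u\<close> has the value \<open>u x\<close>.\<close>

lemma leinert_set_restriction_bound:
  assumes D: "group D" and E: "leinert_set D E"
  obtains C where "0 \<le> C"
    "\<And>u F. u \<in> fourier_algebra D (count_space (carrier D)) \<Longrightarrow> finite F \<Longrightarrow> F \<subseteq> E \<Longrightarrow>
      (\<Sum>x\<in>F. (cmod (u x))\<^sup>2) \<le> (C * fourier_norm D (count_space (carrier D)) u)\<^sup>2"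
proof -
  define M where "M = count_space (carrier D)"
  interpret D: left_invariant_measure D M unfolding M_def by (rule count_space_left_invariant[OF D])
  define R where "R = restriction_algebra D M E"
  have ED: "E \<subseteq> carrier D" using E by (simp add: leinert_set_def)
  obtain \<Phi> where bij: "bij_betw \<Phi> R (ell2 E)"
    and bd: "bounded_clinear_between R (restriction_norm D M E) (ell2 E) (ell2_norm E) \<Phi>"
    and mult: "\<And>u v. u \<in> R \<Longrightarrow> v \<in> R \<Longrightarrow> \<Phi> (\<lambda>x. u x * v x) = (\<lambda>x. \<Phi> u x * \<Phi> v x)"
    using E unfolding leinert_set_def banach_algebra_isomorphic_def R_def M_def by blast
  define pt where "pt a x = (\<lambda>y. a * indicator {x} y :: complex)" for a :: complex and x :: 'a
  have ptL: "pt a x \<in> L2_fun M" if "x \<in> carrier D" for a x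
    unfolding pt_def using that by (intro D.L2.sc_mem D.indicator_L2) (auto simp: M_def)
  have ptR: "pt a x \<in> R" if x: "x \<in> E" for a x
  proof -
    have xD: "x \<in> carrier D" using x ED by blast
    \<comment> \<open>A multiple of a point mass is the coefficient of the point masses at the
      identity and at x.\<close>
    have "pt a x = matrix_coefficient D M (pt a \<one>\<^bsub>D\<^esub>) (pt 1 x)"
    proof
      fix y
      show "pt a x y = matrix_coefficient D M (pt a \<one>\<^bsub>D\<^esub>) (pt 1 x) y"
      proof (cases "y \<in> carrier D")
        case True
        have "L2_inner M (left_regular D y (pt a \<one>\<^bsub>D\<^esub>)) (pt 1 x) = (\<integral>z. pt a x y * indicator {x} z \<partial>M)"
          unfolding L2_inner_def
        proof (rule Bochner_Integration.integral_cong[OF refl])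
          fix z assume "z \<in> space M"
          have "inv\<^bsub>D\<^esub> y \<otimes>\<^bsub>D\<^esub> x = \<one>\<^bsub>D\<^esub> \<longleftrightarrow> y = x"
            using True xD D.inv_solve_left' by fastforce
          then show "left_regular D y (pt a \<one>\<^bsub>D\<^esub>) z * cnj (pt 1 x z) = pt a x y * indicator {x} z"
            by (auto simp: left_regular_def pt_def indicator_def)
        qed
        also have "\<dots> = pt a x y * complex_of_real (\<integral>z. indicator {x} z \<partial>M)"
          unfolding integral_complex_of_real[symmetric] integral_mult_right_zero[symmetric]
          by (intro Bochner_Integration.integral_cong) (auto simp: indicator_def)
        also have "\<dots> = pt a x y"
          using xD by (simp add: M_def measure_count_space)
        finally show ?thesis using True by (simp add: D.matrix_coefficient_apply)
      next
        case False
        then show ?thesis using xD by (auto simp: pt_def matrix_coefficient_def zero_extension_def indicator_def)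
      qed
    qed
    then have "pt a x \<in> fourier_algebra D M" unfolding fourier_algebra_def using ptL xD D.one_closed by blast
    moreover have "zero_extension E (pt a x) = pt a x" using x by (auto simp: zero_extension_def pt_def indicator_def fun_eq_iff)
    ultimately show ?thesis unfolding R_def restriction_algebra_def by (metis imageI)
  qed
  have lin: "\<Phi> (\<lambda>x. a * u x + b * v x) = (\<lambda>x. a * \<Phi> u x + b * \<Phi> v x)" if "u \<in> R" "v \<in> R" for a b u v
    using bd that unfolding bounded_clinear_between_def by blast
  have scal: "\<Phi> (pt a x) = (\<lambda>y. a * \<Phi> (pt 1 x) y)" if "x \<in> E" for a x
    using lin[OF ptR[OF that, of 1] ptR[OF that, of 1], of a 0] by (simp add: pt_def)
  have "\<exists>s. s \<in> E \<and> (\<forall>u\<in>R. \<Phi> u s = u x)" if x: "x \<in> E" for x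
  proof -
    have "pt 1 x x \<noteq> pt 0 x x" by (simp add: pt_def)
    then have "pt 1 x \<noteq> pt 0 x" by metis
    then have "\<Phi> (pt 1 x) \<noteq> \<Phi> (pt 0 x)" using bij ptR[OF x] by (meson bij_betw_def inj_on_eq_iff)
    then obtain s where s: "\<Phi> (pt 1 x) s \<noteq> 0" using scal[OF x, of 0] by (auto simp: fun_eq_iff)
    have "\<Phi> (pt 1 x) \<in> ell2 E" by (rule bij_betw_apply[OF bij ptR[OF x]])
    then have sE: "s \<in> E" using s by (auto simp: ell2_def)
    have "(\<lambda>y. pt 1 x y * pt 1 x y) = pt 1 x" by (simp add: pt_def indicator_def fun_eq_iff)
    then have "\<Phi> (pt 1 x) s * \<Phi> (pt 1 x) s = \<Phi> (pt 1 x) s"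
      using mult[OF ptR[OF x] ptR[OF x], of 1 1] by (metis (no_types, lifting))
    then have one: "\<Phi> (pt 1 x) s = 1" using s by simp
    have "\<Phi> u s = u x" if u: "u \<in> R" for u
    proof -
      have "(\<lambda>y. u y * pt 1 x y) = pt (u x) x" by (simp add: pt_def indicator_def fun_eq_iff)
      then have "\<Phi> (pt (u x) x) s = \<Phi> u s * \<Phi> (pt 1 x) s" using mult[OF u ptR[OF x], of 1] by simp
      then show ?thesis using scal[OF x, of "u x"] one by simp
    qed
    then show ?thesis using sE by blast
  qed
  then obtain \<sigma> where \<sigma>E: "\<And>x. x \<in> E \<Longrightarrow> \<sigma> x \<in> E" and \<sigma>: "\<And>x u. x \<in> E \<Longrightarrow> u \<in> R \<Longrightarrow> \<Phi> u (\<sigma> x) = u x" by metis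
  \<comment> \<open>Injectivity lets the sum over F of |u x|^2 appear as part of the sum over E
    defining the norm of the image; surjectivity of \<sigma> does not enter.\<close>
  have inj: "inj_on \<sigma> E"
  proof (rule inj_onI)
    fix x y assume xy: "x \<in> E" "y \<in> E" "\<sigma> x = \<sigma> y"
    then have "pt 1 x x = pt 1 x y" using \<sigma>[OF xy(1) ptR[OF xy(1), of 1]] \<sigma>[OF xy(2) ptR[OF xy(1), of 1]] by simp
    then show "x = y" by (simp add: pt_def indicator_def split: if_splits)
  qed
  obtain C where C: "\<And>u. u \<in> R \<Longrightarrow> ell2_norm E (\<Phi> u) \<le> C * restriction_norm D M E u"
    using bd unfolding bounded_clinear_between_def by blast
  show thesis
  proof (rule that[of "max C 0"])
    fix u F assume u: "u \<in> fourier_algebra D (count_space (carrier D))" and F: "finite F" "F \<subseteq> E"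
    define v where "v = zero_extension E u"
    have uM: "u \<in> fourier_algebra D M" using u by (simp add: M_def)
    have v: "v \<in> R" unfolding v_def R_def restriction_algebra_def using uM by blast
    let ?S = "{fourier_norm D M w |w. w \<in> fourier_algebra D M \<and> zero_extension E w = v}"
    have nonneg: "0 \<le> r" if "r \<in> ?S" for r using that D.fourier_norm_nonneg by auto
    have uS: "fourier_norm D M u \<in> ?S" using uM v_def by blast
    have rn: "0 \<le> restriction_norm D M E v" "restriction_norm D M E v \<le> fourier_norm D M u"
      unfolding restriction_norm_def using uS nonneg
      by (auto intro!: cInf_greatest cInf_lower bdd_belowI[of _ 0])
    have "ell2_norm E (\<Phi> v) \<le> C * restriction_norm D M E v" by (rule C[OF v])
    also have "\<dots> \<le> max C 0 * fourier_norm D M u" using rn by (intro mult_mono) auto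
    finally have le: "ell2_norm E (\<Phi> v) \<le> max C 0 * fourier_norm D M u" .
    have \<Phi>v: "\<Phi> v \<in> ell2 E" using bij v by (rule bij_betw_apply)
    have "(\<Sum>x\<in>F. (cmod (u x))\<^sup>2) = (\<Sum>x\<in>F. (cmod (\<Phi> v (\<sigma> x)))\<^sup>2)"
    proof (intro sum.cong refl)
      fix x assume "x \<in> F"
      then have "x \<in> E" using F by blast
      then show "(cmod (u x))\<^sup>2 = (cmod (\<Phi> v (\<sigma> x)))\<^sup>2" using \<sigma>[OF _ v, of x] by (simp add: v_def zero_extension_def)
    qed
    also have "\<dots> = (\<Sum>s\<in>\<sigma> ` F. (cmod (\<Phi> v s))\<^sup>2)"
      using inj_on_subset[OF inj F(2)] by (simp add: sum.reindex)
    also have "\<dots> \<le> (\<Sum>\<^sub>\<infinity>s\<in>E. (cmod (\<Phi> v s))\<^sup>2)"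
      using \<Phi>v F \<sigma>E by (intro finite_sum_le_infsum) (auto simp: ell2_def)
    also have "\<dots> = (ell2_norm E (\<Phi> v))\<^sup>2"
      by (simp add: ell2_norm_def infsum_nonneg)
    also have "\<dots> \<le> (max C 0 * fourier_norm D M u)\<^sup>2"
      using le by (intro power_mono) (auto simp: ell2_norm_def infsum_nonneg)
    finally show "(\<Sum>x\<in>F. (cmod (u x))\<^sup>2) \<le> (max C 0 * fourier_norm D (count_space (carrier D)) u)\<^sup>2" by (simp add: M_def)
  qed simp
qed

text \<open>Duality by testing the operator on its own output: for g = \<open>lcomb F c f\<close>
  and u the coefficient of f and g, \<parallel>g\<parallel>^2 is the sum of c x * u x.
  Cauchy-Schwarz, the hypothesis on u and the bound of the norm of u by \<parallel>f\<parallel>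
  \<parallel>g\<parallel> leave one factor \<parallel>g\<parallel> to cancel.\<close>

lemma (in left_invariant_measure) lcomb_bound_of_coefficients:
  assumes C: "0 \<le> C" "\<And>u F. u \<in> fourier_algebra G M \<Longrightarrow> finite F \<Longrightarrow> F \<subseteq> E \<Longrightarrow>
      (\<Sum>x\<in>F. (cmod (u x))\<^sup>2) \<le> (C * fourier_norm G M u)\<^sup>2"
    and E: "E \<subseteq> carrier G" and F: "finite F" "F \<subseteq> E" and f: "f \<in> L2_fun M"
  shows "L2.nrm (lcomb F c f) \<le> C * sqrt (\<Sum>x\<in>F. (cmod (c x))\<^sup>2) * L2.nrm f"
proof -
  have FG: "F \<subseteq> carrier G" using E F by blast
  define g where "g = lcomb F c f"
  have gL: "g \<in> L2_fun M" unfolding g_def using FG f by (rule lcomb_L2)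
  define u where "u = matrix_coefficient G M f g"
  have u: "u \<in> fourier_algebra G M" using f gL by (auto simp: u_def fourier_algebra_def)
  define s where "s = sqrt (\<Sum>x\<in>F. (cmod (c x))\<^sup>2)"
  have s: "0 \<le> s" by (simp add: s_def sum_nonneg)
  have "L2_inner M (lcomb F c f) g = (\<Sum>x\<in>F. c x * u x)"
    unfolding lcomb_inner[OF FG f gL] using FG by (intro sum.cong) (auto simp: u_def matrix_coefficient_apply)
  then have "(L2.nrm g)\<^sup>2 = Re (\<Sum>x\<in>F. c x * u x)" using gL by (simp add: L2.nrm_sq g_def)
  also have "\<dots> \<le> cmod (\<Sum>x\<in>F. c x * u x)" by (rule complex_Re_le_cmod)
  also have "\<dots> \<le> (\<Sum>x\<in>F. \<bar>cmod (c x)\<bar> * \<bar>cmod (u x)\<bar>)" by (rule order_trans[OF norm_sum]) (simp add: norm_mult)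
  also have "\<dots> \<le> L2_set (\<lambda>x. cmod (c x)) F * L2_set (\<lambda>x. cmod (u x)) F" by (rule L2_set_mult_ineq)
  also have "\<dots> \<le> s * (C * fourier_norm G M u)"
  proof -
    have "sqrt (\<Sum>x\<in>F. (cmod (u x))\<^sup>2) \<le> C * fourier_norm G M u"
      using C(2)[OF u F] C(1) fourier_norm_nonneg[OF u] by (intro real_le_lsqrt) (auto simp: sum_nonneg)
    then show ?thesis unfolding L2_set_def s_def by (intro mult_left_mono) (auto simp: sum_nonneg)
  qed
  also have "\<dots> \<le> s * (C * (L2.nrm f * L2.nrm g))"
    unfolding u_def using s C f gL by (intro mult_left_mono fourier_norm_coefficient_le) auto
  finally have "L2.nrm g * L2.nrm g \<le> (C * s * L2.nrm f) * L2.nrm g" by (simp add: power2_eq_square mult_ac)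
  moreover have "0 \<le> C * s * L2.nrm f" using C s f by simp
  ultimately have "L2.nrm g \<le> C * s * L2.nrm f"
    using L2.nrm_nonneg[OF gL] by (cases "L2.nrm g = 0") (auto simp: less_le mult_le_cancel_right)
  then show ?thesis by (simp add: g_def s_def)
qed

section \<open>Transfer from the discrete subgroup\<close>

lemma nn_integral_count_space_enumerate:
  assumes I: "countable I"
  obtains e :: "nat \<Rightarrow> 'i" and N where "inj_on e N" "e ` N = I"
    "\<And>\<phi>. (\<integral>\<^sup>+i. \<phi> i \<partial>count_space I) = (\<Sum>n. \<phi> (e n) * indicator N n)"
proof -
  define N where "N = to_nat_on I ` I"
  define e where "e = from_nat_into I"
  have bij: "bij_betw e N I"
    unfolding N_def e_def using I
    by (intro bij_betw_byWitness[where f' = "to_nat_on I"]) (auto simp: from_nat_into_to_nat_on)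
  show thesis
  proof (rule that)
    show "inj_on e N" "e ` N = I" using bij by (auto simp: bij_betw_def)
    show "(\<integral>\<^sup>+i. \<phi> i \<partial>count_space I) = (\<Sum>n. \<phi> (e n) * indicator N n)" for \<phi>
      unfolding nn_integral_bij_count_space[OF bij, symmetric]
      by (subst nn_integral_count_space_nat[symmetric]) (simp add: nn_integral_restrict_space[symmetric] restrict_count_space)
  qed
qed

text \<open>Tonelli's theorem with one countable factor. M need not be \<sigma>-finite, so the sum
  is enumerated as a series and monotone convergence does the interchange.\<close>

lemma nn_integral_count_space_swap:
  assumes I: "countable I" and f: "\<And>i. i \<in> I \<Longrightarrow> f i \<in> borel_measurable M"
  shows "(\<integral>\<^sup>+y. (\<integral>\<^sup>+i. f i y \<partial>count_space I) \<partial>M) = (\<integral>\<^sup>+i. (\<integral>\<^sup>+y. f i y \<partial>M) \<partial>count_space I)"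
proof -
  obtain e :: "nat \<Rightarrow> _" and N where eN: "inj_on e N" "e ` N = I"
    and conv: "\<And>\<phi>. (\<integral>\<^sup>+i. \<phi> i \<partial>count_space I) = (\<Sum>n. \<phi> (e n) * indicator N n)"
    using nn_integral_count_space_enumerate[OF I] by metis
  have "(\<integral>\<^sup>+y. (\<integral>\<^sup>+i. f i y \<partial>count_space I) \<partial>M) = (\<integral>\<^sup>+y. (\<Sum>n. f (e n) y * indicator N n) \<partial>M)"
    by (simp add: conv)
  also have "\<dots> = (\<Sum>n. \<integral>\<^sup>+y. f (e n) y * indicator N n \<partial>M)"
  proof (rule nn_integral_suminf)
    show "(\<lambda>y. f (e n) y * indicator N n) \<in> borel_measurable M" for n
      using f[of "e n"] eN(2) by (cases "n \<in> N") auto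
  qed
  also have "\<dots> = (\<Sum>n. (\<integral>\<^sup>+y. f (e n) y \<partial>M) * indicator N n)"
    by (intro suminf_cong) (simp add: indicator_def)
  finally show ?thesis by (simp add: conv)
qed

lemma nn_integral_count_space_le:
  assumes I: "countable I" and le: "\<And>F. finite F \<Longrightarrow> F \<subseteq> I \<Longrightarrow> (\<Sum>i\<in>F. f i) \<le> B"
  shows "(\<integral>\<^sup>+i. f i \<partial>count_space I) \<le> B"
proof -
  obtain e :: "nat \<Rightarrow> _" and N where eN: "inj_on e N" "e ` N = I"
    and conv: "\<And>\<phi>. (\<integral>\<^sup>+i. \<phi> i \<partial>count_space I) = (\<Sum>n. \<phi> (e n) * indicator N n)"
    using nn_integral_count_space_enumerate[OF I] by metis
  show ?thesis unfolding conv
  proof (rule suminf_le_const[OF summableI])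
    fix k
    have "(\<Sum>n<k. f (e n) * indicator N n) = (\<Sum>n\<in>{..<k} \<inter> N. f (e n))"
      by (rule sum.mono_neutral_cong_right) auto
    also have "\<dots> = (\<Sum>i\<in>e ` ({..<k} \<inter> N). f i)"
      using inj_on_subset[OF eN(1), of "{..<k} \<inter> N"] by (simp add: sum.reindex)
    also have "\<dots> \<le> B" using eN(2) by (intro le) auto
    finally show "(\<Sum>n<k. f (e n) * indicator N n) \<le> B" .
  qed
qed

text \<open>Every generated element is the product of a finite word in F and its inverses, and there
  are countably many words.\<close>

lemma (in group) countable_generate:
  assumes "countable F" "F \<subseteq> carrier G"
  shows "countable (generate G F)"
proof -
  let ?m = "\<lambda>l. foldr (\<otimes>) l \<one>"
  let ?L = "lists (F \<union> m_inv G ` F)"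
  have carr: "?m l \<in> carrier G" if "l \<in> ?L" for l
    using that assms by (induction l) auto
  have app: "?m (l @ l') = ?m l \<otimes> ?m l'" if "l \<in> ?L" "l' \<in> ?L" for l l'
    using that(1)
  proof (induction l)
    case Nil
    then show ?case using carr[OF that(2)] by simp
  next
    case (Cons a l)
    then have "a \<in> carrier G" using assms by auto
    then show ?case using Cons carr[of l] carr[OF that(2)] by (simp add: m_assoc)
  qed
  have "h \<in> ?m ` ?L" if "h \<in> generate G F" for h
    using that
  proof (induction rule: generate.induct)
    case one
    show ?case by (intro image_eqI[of _ _ "[]"]) auto
  next
    case (incl h)
    then show ?case using assms by (intro image_eqI[of _ _ "[h]"]) auto
  next
    case (inv h)
    then show ?case using assms by (intro image_eqI[of _ _ "[inv h]"]) auto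
  next
    case (eng h1 h2)
    then obtain l l' where "l \<in> ?L" "l' \<in> ?L" "h1 = ?m l" "h2 = ?m l'" by blast
    then show ?case using app[of l l'] by (intro image_eqI[of _ _ "l @ l'"]) auto
  qed
  then have "generate G F \<subseteq> ?m ` ?L" by blast
  moreover have "countable (?m ` ?L)" using assms by (intro countable_image countable_lists) auto
  ultimately show ?thesis by (rule countable_subset)
qed

section \<open>Discrete subgroups and integration over their cosets\<close>

context haar_group
begin

text \<open>Discreteness gives an open W meeting H only in \<one>, and continuity of x y^(-1) gives
  U with U U^(-1) \<subseteq> W. If h U meets U, then h lies in U U^(-1). Intersection with a
  relatively compact neighbourhood gives finite measure later.\<close>

lemma discrete_subgroup_nbhd:
  assumes H: "discrete_subgroup G T H"
  obtains U K where "openin T U" "\<one> \<in> U" "compactin T K" "U \<subseteq> K"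
    "\<And>h. h \<in> H \<Longrightarrow> h \<noteq> \<one> \<Longrightarrow> (h <# U) \<inter> U = {}"
proof -
  have sub: "subgroup H G" and disc: "subtopology T H = discrete_topology H" using H by (auto simp: discrete_subgroup_def)
  have HG: "H \<subseteq> carrier G" using sub by (rule subgroup.subset)
  have "openin (subtopology T H) {\<one>}" unfolding disc using subgroup.one_closed[OF sub] by simp
  then obtain W where W: "openin T W" "{\<one>} = W \<inter> H" by (auto simp: openin_subtopology)
  define Q where "Q = {p \<in> topspace (prod_topology T T). (\<lambda>(x, y). x \<otimes> inv y) p \<in> W}"
  have "continuous_map (prod_topology T T) (prod_topology T T) (\<lambda>(x, y). (x, inv y))"
    using continuous_map_prod_top[of T T T T "\<lambda>x. x" "\<lambda>y. inv y"] continuous_inv by simp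
  from continuous_map_compose[OF this continuous_mult]
  have "continuous_map (prod_topology T T) T (\<lambda>(x, y). x \<otimes> inv y)" by (simp add: comp_def case_prod_unfold)
  then have "openin (prod_topology T T) Q" unfolding Q_def using W(1) by (rule openin_continuous_map_preimage)
  then have Q: "\<forall>x y. (x, y) \<in> Q \<longrightarrow> (\<exists>A B. openin T A \<and> openin T B \<and> x \<in> A \<and> y \<in> B \<and> A \<times> B \<subseteq> Q)"
    by (rule openin_prod_topology_alt[THEN iffD1])
  have "(\<one>, \<one>) \<in> Q" using W(2) by (auto simp: Q_def topspace_eq)
  from Q[rule_format, OF this]
  obtain A B where AB: "openin T A" "openin T B" "\<one> \<in> A" "\<one> \<in> B" "A \<times> B \<subseteq> Q" by (elim exE conjE)
  have "\<exists>V K. openin T V \<and> compactin T K \<and> \<one> \<in> V \<and> V \<subseteq> K"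
    using locally_compact unfolding locally_compact_space_def topspace_eq by (rule bspec) simp
  then obtain V K where VK: "openin T V" "compactin T K" "\<one> \<in> V" "V \<subseteq> K" by blast
  define U where "U = A \<inter> B \<inter> V"
  show thesis
  proof (rule that[of U K])
    show "openin T U" unfolding U_def by (intro openin_Int AB VK)
    show "\<one> \<in> U" "compactin T K" "U \<subseteq> K" using AB VK by (auto simp: U_def)
    fix h assume h: "h \<in> H" "h \<noteq> \<one>"
    show "(h <# U) \<inter> U = {}"
    proof (rule ccontr)
      assume "(h <# U) \<inter> U \<noteq> {}"
      then obtain y where y: "y \<in> U" "h \<otimes> y \<in> U" by (auto simp: l_coset_def)
      then have yG: "y \<in> carrier G" using openin_subset_carrier[OF VK(1)] by (auto simp: U_def)
      have "(h \<otimes> y, y) \<in> Q" using y AB(5) by (auto simp: U_def)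
      then have "h \<otimes> y \<otimes> inv y \<in> W" by (simp add: Q_def)
      moreover have "h \<otimes> y \<otimes> inv y = h" using h HG yG by (auto simp: m_assoc)
      ultimately have "h \<in> W \<inter> H" using h by simp
      then show False using W(2) h(2) by blast
    qed
  qed
qed

text \<open>A measurable choice of coset representatives, made greedily: for each x, add the part of
  U x that is not yet in the union of the translates h V. Two points of U x in one coset coincide
  because the translates of U are disjoint. Countability of H keeps the union measurable, and
  finitely many x suffice for a compact support.\<close>

lemma fundamental_set:
  assumes H: "subgroup H G" "countable H" and U: "openin T U" "\<one> \<in> U"
    and disj: "\<And>h. h \<in> H \<Longrightarrow> h \<noteq> \<one> \<Longrightarrow> (h <# U) \<inter> U = {}"
    and X: "finite X" "X \<subseteq> carrier G"
  obtains V where "V \<in> sets M" "\<And>h v. h \<in> H \<Longrightarrow> v \<in> V \<Longrightarrow> h \<otimes> v \<in> V \<Longrightarrow> h = \<one>"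
    "(\<Union>x\<in>X. U #> x) \<subseteq> (\<Union>h\<in>H. h <# V)"
proof -
  have HG: "H \<subseteq> carrier G" using H(1) by (rule subgroup.subset)
  have "\<exists>V. V \<in> sets M \<and> (\<forall>h\<in>H. \<forall>v\<in>V. h \<otimes> v \<in> V \<longrightarrow> h = \<one>) \<and> (\<Union>x\<in>X. U #> x) \<subseteq> (\<Union>h\<in>H. h <# V)"
    using X
  proof (induction X)
    case empty
    show ?case by (intro exI[of _ "{}"]) auto
  next
    case (insert x X)
    then obtain V where V: "V \<in> sets M" "\<forall>h\<in>H. \<forall>v\<in>V. h \<otimes> v \<in> V \<longrightarrow> h = \<one>" "(\<Union>x\<in>X. U #> x) \<subseteq> (\<Union>h\<in>H. h <# V)"
      by auto
    have xG: "x \<in> carrier G" using insert by simp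
    have VG: "V \<subseteq> carrier G" using sets.sets_into_space[OF V(1)] by (simp add: space_M)
    define S where "S = (\<Union>h\<in>H. h <# V)"
    have "h <# V \<in> sets M" if "h \<in> H" for h using HG V(1) that by (intro l_coset_sets) auto
    then have Sm: "S \<in> sets M" unfolding S_def using H(2) by (intro sets.countable_UN') auto
    have UG: "U \<subseteq> carrier G" by (rule openin_subset_carrier[OF U(1)])
    have Uxm: "U #> x \<in> sets M" by (intro openin_sets openin_r_coset xG U)
    have UxG: "U #> x \<subseteq> carrier G" using UG xG by (auto simp: r_coset_def)
    define V' where "V' = V \<union> ((U #> x) - S)"
    have V'm: "V' \<in> sets M" unfolding V'_def using V Sm Uxm by auto
    have inS: "h \<otimes> v \<in> S" if "h \<in> H" "v \<in> V" for h v using that by (auto simp: S_def l_coset_def)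
    have dis: "h = \<one>" if h: "h \<in> H" and v: "v \<in> V'" "h \<otimes> v \<in> V'" for h v
    proof (rule ccontr)
      assume h1: "h \<noteq> \<one>"
      have hG: "h \<in> carrier G" using h HG by blast
      have vG: "v \<in> carrier G" using v VG UxG by (auto simp: V'_def)
      consider "v \<in> V" "h \<otimes> v \<in> V" | "v \<in> V" "h \<otimes> v \<notin> S" | "v \<notin> S" "h \<otimes> v \<in> V" | "v \<in> U #> x" "h \<otimes> v \<in> U #> x"
        using v by (auto simp: V'_def)
      then show False
      proof cases
        case 1 then show False using V(2) h h1 by blast
      next
        case 2 then show False using inS h by blast
      next
        case 3
        have "inv h \<otimes> (h \<otimes> v) \<in> S" using 3 H(1) h by (intro inS) (auto intro: subgroup.m_inv_closed)
        then show False using 3 hG vG by (simp add: m_assoc[symmetric])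
      next
        case 4
        then obtain a b where ab: "a \<in> U" "v = a \<otimes> x" "b \<in> U" "h \<otimes> v = b \<otimes> x" by (auto simp: r_coset_def)
        have abG: "a \<in> carrier G" "b \<in> carrier G" using ab UG by auto
        have "(h \<otimes> a) \<otimes> x = b \<otimes> x" using ab abG hG xG by (simp add: m_assoc)
        then have "h \<otimes> a = b" using abG hG xG by simp
        then have "b \<in> (h <# U) \<inter> U" using ab by (auto simp: l_coset_def)
        then show False using disj[OF h h1] by blast
      qed
    qed
    have "(\<Union>x\<in>insert x X. U #> x) \<subseteq> (\<Union>h\<in>H. h <# V')"
    proof
      fix y assume y: "y \<in> (\<Union>x\<in>insert x X. U #> x)"
      show "y \<in> (\<Union>h\<in>H. h <# V')"
      proof (cases "y \<in> S")
        case True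
        then show ?thesis by (auto simp: S_def V'_def l_coset_def)
      next
        case False
        then have "y \<in> U #> x" using y V(3) by (auto simp: S_def)
        then have "y \<in> V'" "y \<in> carrier G" using False UxG by (auto simp: V'_def)
        then have "y \<in> \<one> <# V'" by (auto simp: l_coset_def intro!: bexI[of _ y])
        then show ?thesis using subgroup.one_closed[OF H(1)] by blast
      qed
    qed
    then show ?case using V'm dis by blast
  qed
  then show thesis using that by blast
qed

text \<open>On the support of g each point lies in exactly one translate h V; invariance moves every
  translate back to V. The inner integral is then the sum of g over the coset of y.\<close>

lemma nn_integral_unfold:
  assumes H: "subgroup H G" "countable H" and V: "V \<in> sets M"
    and dis: "\<And>h v. h \<in> H \<Longrightarrow> v \<in> V \<Longrightarrow> h \<otimes> v \<in> V \<Longrightarrow> h = \<one>"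
    and g: "g \<in> borel_measurable M" and supp: "\<And>x. x \<in> carrier G \<Longrightarrow> x \<notin> (\<Union>h\<in>H. h <# V) \<Longrightarrow> g x = 0"
  shows "(\<integral>\<^sup>+x. g x \<partial>M) = (\<integral>\<^sup>+y. indicator V y * (\<integral>\<^sup>+h. g (h \<otimes> y) \<partial>count_space H) \<partial>M)"
proof -
  have HG: "H \<subseteq> carrier G" using H(1) by (rule subgroup.subset)
  have VG: "V \<subseteq> carrier G" using sets.sets_into_space[OF V] by (simp add: space_M)
  have hV: "h <# V \<in> sets M" if "h \<in> H" for h using HG V that by (intro l_coset_sets) auto
  have one: "g x = (\<integral>\<^sup>+h. indicator (h <# V) x * g x \<partial>count_space H)" if x: "x \<in> carrier G" for x
  proof (cases "x \<in> (\<Union>h\<in>H. h <# V)")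
    case True
    then obtain h0 v where h0: "h0 \<in> H" "v \<in> V" "x = h0 \<otimes> v" by (auto simp: l_coset_def)
    have uniq: "h = h0" if h: "h \<in> H" "x \<in> h <# V" for h
    proof -
      obtain v' where v': "v' \<in> V" "x = h \<otimes> v'" using h by (auto simp: l_coset_def)
      have G: "h \<in> carrier G" "h0 \<in> carrier G" "v \<in> carrier G" "v' \<in> carrier G" using h h0 v' HG VG by auto
      have "(inv h \<otimes> h0) \<otimes> v = inv h \<otimes> (h \<otimes> v')" using v' h0 G by (simp add: m_assoc)
      also have "\<dots> = v'" using G by (simp add: m_assoc[symmetric])
      finally have "inv h \<otimes> h0 = \<one>"
        using dis[of "inv h \<otimes> h0" v] h h0 v' H(1) by (simp add: subgroup.m_closed subgroup.m_inv_closed)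
      then show ?thesis using G by (metis inv_equality inv_inv inv_closed)
    qed
    have "(\<integral>\<^sup>+h. indicator (h <# V) x * g x \<partial>count_space H) = (\<Sum>h\<in>{h0}. indicator (h <# V) x * g x)"
      using uniq h0 by (intro nn_integral_count_space') (auto simp: indicator_def)
    also have "\<dots> = g x"
    proof -
      have "x \<in> h0 <# V" using h0 by (auto simp: l_coset_def)
      then show ?thesis by simp
    qed
    finally show ?thesis by simp
  next
    case False
    then show ?thesis using supp[OF x] by simp
  qed
  have "(\<integral>\<^sup>+x. g x \<partial>M) = (\<integral>\<^sup>+x. (\<integral>\<^sup>+h. indicator (h <# V) x * g x \<partial>count_space H) \<partial>M)"
    by (intro nn_integral_cong one) (simp add: space_M)
  also have "\<dots> = (\<integral>\<^sup>+h. (\<integral>\<^sup>+x. indicator (h <# V) x * g x \<partial>M) \<partial>count_space H)"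
    using hV g by (intro nn_integral_count_space_swap H) auto
  also have "\<dots> = (\<integral>\<^sup>+h. (\<integral>\<^sup>+y. indicator V y * g (h \<otimes> y) \<partial>M) \<partial>count_space H)"
  proof (rule nn_integral_cong)
    fix h assume "h \<in> space (count_space H)"
    then have h: "h \<in> H" by simp
    have hG: "h \<in> carrier G" using h HG by blast
    have "(\<integral>\<^sup>+x. indicator (h <# V) x * g x \<partial>M) = (\<integral>\<^sup>+y. indicator (h <# V) (h \<otimes> y) * g (h \<otimes> y) \<partial>M)"
      using hV[OF h] g hG by (intro nn_integral_translation[symmetric]) auto
    also have "\<dots> = (\<integral>\<^sup>+y. indicator V y * g (h \<otimes> y) \<partial>M)"
      using hG VG by (intro nn_integral_cong) (auto simp: space_M l_coset_preimage indicator_def m_assoc[symmetric])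
    finally show "(\<integral>\<^sup>+x. indicator (h <# V) x * g x \<partial>M) = (\<integral>\<^sup>+y. indicator V y * g (h \<otimes> y) \<partial>M)" .
  qed
  also have "\<dots> = (\<integral>\<^sup>+y. (\<integral>\<^sup>+h. indicator V y * g (h \<otimes> y) \<partial>count_space H) \<partial>M)"
  proof (rule nn_integral_count_space_swap[symmetric, OF H(2)])
    fix h assume "h \<in> H"
    then have "(\<lambda>y. g (h \<otimes> y)) \<in> borel_measurable M"
      using measurable_compose[OF translation_measurable g, of h] HG by auto
    then show "(\<lambda>y. indicator V y * g (h \<otimes> y)) \<in> borel_measurable M" using V by auto
  qed
  also have "\<dots> = (\<integral>\<^sup>+y. indicator V y * (\<integral>\<^sup>+h. g (h \<otimes> y) \<partial>count_space H) \<partial>M)"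
    by (simp add: nn_integral_cmult)
  finally show ?thesis .
qed

text \<open>On a coset \<open>H y\<close> the operator acts as the corresponding operator of the discrete group; integrating
  over a set of representatives gives the estimate. Only the countable subgroup generated by \<open>F\<close>
  is needed, which keeps the sums countable.\<close>

lemma lcomb_bound_transfer:
  assumes H: "discrete_subgroup G T H" and F: "finite F" "F \<subseteq> H" and D: "0 < D"
    and bd: "\<And>\<xi>. \<xi> \<in> L2_fun (count_space H) \<Longrightarrow>
      L2_norm (count_space H) (\<lambda>h. \<Sum>x\<in>F. c x * left_regular (G\<lparr>carrier := H\<rparr>) x \<xi> h) \<le> D * L2_norm (count_space H) \<xi>"
    and f: "f \<in> L2_fun M"
  shows "L2.nrm (lcomb F c f) \<le> D * L2.nrm f"
proof -
  have sub: "subgroup H G" using H by (simp add: discrete_subgroup_def)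
  have HG: "H \<subseteq> carrier G" using sub by (rule subgroup.subset)
  have FG: "F \<subseteq> carrier G" using F HG by blast
  define H0 where "H0 = generate G F"
  have H0: "subgroup H0 G" "countable H0" "F \<subseteq> H0" "H0 \<subseteq> H"
    unfolding H0_def using F FG sub
    by (auto intro: generate_is_subgroup countable_generate countable_finite generate.incl
        dest: subsetD[OF generate_subgroup_incl])
  have H0G: "H0 \<subseteq> carrier G" using H0 HG by blast
  have invH: "inv\<^bsub>G\<lparr>carrier := H\<rparr>\<^esub> x = inv x" if "x \<in> H" for x
    using m_inv_consistent[OF sub that] by simp
  obtain U Q where U: "openin T U" "\<one> \<in> U" "\<And>h. h \<in> H \<Longrightarrow> h \<noteq> \<one> \<Longrightarrow> (h <# U) \<inter> U = {}"
    using discrete_subgroup_nbhd[OF H] by metis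
  define q where "q g x = ennreal ((cmod (g x))\<^sup>2)" for g :: "'a \<Rightarrow> complex" and x
  \<comment> \<open>If the coset sum of q g is infinite, nothing is to be shown. Otherwise g read
    along the coset H0 y and extended by 0 to H is a square summable \<xi>, to which
    \<open>bd\<close> applies.\<close>
  have fibre: "(\<integral>\<^sup>+h. q (lcomb F c g) (h \<otimes> y) \<partial>count_space H0) \<le> (\<integral>\<^sup>+h. ennreal (D\<^sup>2) * q g (h \<otimes> y) \<partial>count_space H0)"
    if y: "y \<in> carrier G" for g y
  proof (cases "(\<integral>\<^sup>+h. q g (h \<otimes> y) \<partial>count_space H0) = \<infinity>")
    case True
    then have "(\<integral>\<^sup>+h. ennreal (D\<^sup>2) * q g (h \<otimes> y) \<partial>count_space H0) = \<infinity>"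
      using D by (simp add: nn_integral_cmult ennreal_mult_top)
    then show ?thesis by simp
  next
    case False
    define \<xi> where "\<xi> h = (if h \<in> H0 then g (h \<otimes> y) else 0)" for h
    define \<eta> where "\<eta> h = (\<Sum>x\<in>F. c x * left_regular (G\<lparr>carrier := H\<rparr>) x \<xi> h)" for h
    have nn\<xi>: "(\<integral>\<^sup>+h. ennreal ((cmod (\<xi> h))\<^sup>2) \<partial>count_space H) = (\<integral>\<^sup>+h. q g (h \<otimes> y) \<partial>count_space H0)"
    proof -
      have "(\<integral>\<^sup>+h. ennreal ((cmod (\<xi> h))\<^sup>2) \<partial>count_space H) = (\<integral>\<^sup>+h. ennreal ((cmod (\<xi> h))\<^sup>2) \<partial>count_space H0)"
        using H0 by (intro nn_integral_count_space_eq) (auto simp: \<xi>_def)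
      also have "\<dots> = (\<integral>\<^sup>+h. q g (h \<otimes> y) \<partial>count_space H0)"
        by (intro nn_integral_cong) (simp add: \<xi>_def q_def)
      finally show ?thesis .
    qed
    have \<xi>L: "\<xi> \<in> L2_fun (count_space H)" using False unfolding L2_fun_iff_nn nn\<xi> by (simp add: less_top)
    have grpH: "group (G\<lparr>carrier := H\<rparr>)" using sub by (rule subgroup_imp_group)
    interpret LH: left_invariant_measure "G\<lparr>carrier := H\<rparr>" "count_space H"
      using count_space_left_invariant[OF grpH] by simp
    have \<eta>L: "\<eta> \<in> L2_fun (count_space H)"
      using LH.lcomb_L2[of F \<xi> c] F \<xi>L by (simp add: LH.lcomb_def \<eta>_def[abs_def])
    have "q (lcomb F c g) (h \<otimes> y) = ennreal ((cmod (\<eta> h))\<^sup>2)" if h: "h \<in> H0" for h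
    proof -
      \<comment> \<open>Left translations commute with the right translation by y, and H0 is closed
        under multiplication by inverses of elements of F, so the values of \<xi> used here are
        values of g.\<close>
      have "lcomb F c g (h \<otimes> y) = \<eta> h"
        unfolding lcomb_def \<eta>_def
      proof (intro sum.cong refl)
        fix x assume x: "x \<in> F"
        have G: "x \<in> carrier G" "h \<in> carrier G" using x h FG H0G by auto
        have "inv x \<otimes> h \<in> H0" using H0 x h by (intro subgroup.m_closed subgroup.m_inv_closed) auto
        then show "c x * lreg x g (h \<otimes> y) = c x * left_regular (G\<lparr>carrier := H\<rparr>) x \<xi> h"
          using x F invH[of x] G y by (auto simp: left_regular_def \<xi>_def m_assoc)
      qed
      then show ?thesis by (simp add: q_def)
    qed
    then have "(\<integral>\<^sup>+h. q (lcomb F c g) (h \<otimes> y) \<partial>count_space H0) = (\<integral>\<^sup>+h. ennreal ((cmod (\<eta> h))\<^sup>2) \<partial>count_space H0)"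
      by (intro nn_integral_cong) simp
    also have "\<dots> \<le> (\<integral>\<^sup>+h. ennreal ((cmod (\<eta> h))\<^sup>2) \<partial>count_space H)"
    proof -
      have "(\<integral>\<^sup>+h. ennreal ((cmod (\<eta> h))\<^sup>2) \<partial>count_space H0)
          = (\<integral>\<^sup>+h. ennreal ((cmod (\<eta> h))\<^sup>2) * indicator H0 h \<partial>count_space H)"
        using H0 by (subst nn_integral_count_space_eq[of H H0]) (auto intro!: nn_integral_cong)
      also have "\<dots> \<le> (\<integral>\<^sup>+h. ennreal ((cmod (\<eta> h))\<^sup>2) \<partial>count_space H)"
        by (intro nn_integral_mono) (auto simp: indicator_def)
      finally show ?thesis .
    qed
    also have "\<dots> = ennreal ((L2_norm (count_space H) \<eta>)\<^sup>2)"
      using nn_L2[OF \<eta>L] by (simp add: L2_norm_def Re_L2_inner_self[OF \<eta>L])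
    also have "\<dots> \<le> ennreal ((D * L2_norm (count_space H) \<xi>)\<^sup>2)"
      using bd[OF \<xi>L] unfolding \<eta>_def[abs_def, symmetric]
      by (intro ennreal_leI power_mono) (auto simp: L2_norm_def)
    also have "\<dots> = ennreal (D\<^sup>2) * (\<integral>\<^sup>+h. ennreal ((cmod (\<xi> h))\<^sup>2) \<partial>count_space H)"
      using nn_L2[OF \<xi>L] by (simp add: L2_norm_def Re_L2_inner_self[OF \<xi>L] power_mult_distrib ennreal_mult)
    also have "\<dots> = (\<integral>\<^sup>+h. ennreal (D\<^sup>2) * q g (h \<otimes> y) \<partial>count_space H0)"
      unfolding nn\<xi> by (simp add: nn_integral_cmult)
    finally show ?thesis .
  qed
  \<comment> \<open>A compact support is covered by finitely many translates U x, which is the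
    situation of \<open>fundamental_set\<close>.\<close>
  have compact: "L2.nrm (lcomb F c g) \<le> D * L2.nrm g"
    if g: "g \<in> L2_fun M" and K: "compactin T K" "\<And>x. x \<notin> K \<Longrightarrow> g x = 0" for g K
  proof -
    have KG: "K \<subseteq> carrier G" by (rule compactin_subset_carrier[OF K(1)])
    have "\<exists>X. finite X \<and> X \<subseteq> K \<and> K \<subseteq> (\<Union>x\<in>X. U #> x)"
    proof -
      have "openin T (U #> x)" "x \<in> U #> x" if "x \<in> K" for x
      proof -
        have xG: "x \<in> carrier G" using KG that by blast
        then show "openin T (U #> x)" using U(1) by (intro openin_r_coset)
        show "x \<in> U #> x" unfolding r_coset_def using U(2) xG by (auto intro!: bexI[of _ \<one>])
      qed
      then obtain \<F> where "finite \<F>" "\<F> \<subseteq> (\<lambda>x. U #> x) ` K" "K \<subseteq> \<Union>\<F>"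
        using compactinD[OF K(1), of "(\<lambda>x. U #> x) ` K"] by blast
      then show ?thesis by (metis finite_subset_image)
    qed
    then obtain X where X: "finite X" "X \<subseteq> carrier G" "K \<subseteq> (\<Union>x\<in>X. U #> x)" using KG by blast
    have disj: "(h <# U) \<inter> U = {}" if "h \<in> H0" "h \<noteq> \<one>" for h using U(3) that H0(4) by blast
    obtain V where V: "V \<in> sets M" "\<And>h v. h \<in> H0 \<Longrightarrow> v \<in> V \<Longrightarrow> h \<otimes> v \<in> V \<Longrightarrow> h = \<one>"
      "(\<Union>x\<in>X. U #> x) \<subseteq> (\<Union>h\<in>H0. h <# V)"
      using fundamental_set[OF H0(1,2) U(1,2) disj X(1,2)] by metis
    have VG: "V \<subseteq> carrier G" using sets.sets_into_space[OF V(1)] by (simp add: space_M)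
    let ?W = "\<Union>h\<in>H0. h <# V"
    have g0: "g x = 0" if "x \<notin> ?W" for x using that X(3) V(3) K(2) by blast
    \<comment> \<open>The union of the h V is stable under H0, which contains F, so the operator
      keeps functions supported there.\<close>
    have Tg0: "lcomb F c g x = 0" if x: "x \<in> carrier G" "x \<notin> ?W" for x
      unfolding lcomb_def
    proof (intro sum.neutral ballI)
      fix z assume z: "z \<in> F"
      have zG: "z \<in> carrier G" using z FG by blast
      have "inv z \<otimes> x \<notin> ?W"
      proof
        assume "inv z \<otimes> x \<in> ?W"
        then obtain h v where hv: "h \<in> H0" "v \<in> V" "inv z \<otimes> x = h \<otimes> v" by (auto simp: l_coset_def)
        have G: "h \<in> carrier G" "v \<in> carrier G" using hv H0G VG by auto
        have "x = z \<otimes> (inv z \<otimes> x)" using zG x by (simp add: m_assoc[symmetric])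
        also have "\<dots> = (z \<otimes> h) \<otimes> v" using hv zG G by (simp add: m_assoc)
        finally have "x = (z \<otimes> h) \<otimes> v" .
        moreover have "z \<otimes> h \<in> H0" using z hv H0 by (intro subgroup.m_closed) auto
        ultimately have "x \<in> ?W" using hv(2) unfolding l_coset_def by blast
        then show False using x by simp
      qed
      then show "c z * lreg z g x = 0" by (simp add: left_regular_def g0)
    qed
    have TgL: "lcomb F c g \<in> L2_fun M" using FG g by (rule lcomb_L2)
    have qm: "q g \<in> borel_measurable M" "q (lcomb F c g) \<in> borel_measurable M"
      unfolding q_def[abs_def] using L2_funD(1)[OF g] L2_funD(1)[OF TgL] by measurable
    have "(\<integral>\<^sup>+x. q (lcomb F c g) x \<partial>M) = (\<integral>\<^sup>+y. indicator V y * (\<integral>\<^sup>+h. q (lcomb F c g) (h \<otimes> y) \<partial>count_space H0) \<partial>M)"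
      by (rule nn_integral_unfold[OF H0(1,2) V(1,2) qm(2)]) (auto simp: q_def Tg0)
    also have "\<dots> \<le> (\<integral>\<^sup>+y. indicator V y * (\<integral>\<^sup>+h. ennreal (D\<^sup>2) * q g (h \<otimes> y) \<partial>count_space H0) \<partial>M)"
    proof (rule nn_integral_mono)
      fix y assume "y \<in> space M"
      then have y: "y \<in> carrier G" by (simp add: space_M)
      show "indicator V y * (\<integral>\<^sup>+h. q (lcomb F c g) (h \<otimes> y) \<partial>count_space H0)
          \<le> indicator V y * (\<integral>\<^sup>+h. ennreal (D\<^sup>2) * q g (h \<otimes> y) \<partial>count_space H0)"
        by (rule mult_left_mono[OF fibre[OF y]]) simp
    qed
    also have "\<dots> = (\<integral>\<^sup>+x. ennreal (D\<^sup>2) * q g x \<partial>M)"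
    proof (rule nn_integral_unfold[OF H0(1,2) V(1,2), symmetric])
      show "(\<lambda>x. ennreal (D\<^sup>2) * q g x) \<in> borel_measurable M" using qm(1) by measurable
    qed (auto simp: q_def g0)
    also have "\<dots> = ennreal (D\<^sup>2) * (\<integral>\<^sup>+x. q g x \<partial>M)" using qm(1) by (rule nn_integral_cmult)
    finally have "ennreal ((L2.nrm (lcomb F c g))\<^sup>2) \<le> ennreal (D\<^sup>2) * ennreal ((L2.nrm g)\<^sup>2)"
      unfolding q_def nn_L2[OF g] nn_L2[OF TgL] L2.nrm_sq[OF g, symmetric] L2.nrm_sq[OF TgL, symmetric] .
    then have "(L2.nrm (lcomb F c g))\<^sup>2 \<le> (D * L2.nrm g)\<^sup>2"
      by (simp add: ennreal_mult[symmetric] power_mult_distrib)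
    then show ?thesis by (rule power2_le_imp_le) (use D g in simp)
  qed
  let ?S = "\<Sum>x\<in>F. cmod (c x)"
  have "L2.nrm (lcomb F c f) \<le> D * L2.nrm f + e" if e: "e > 0" for e
  proof -
    have S: "0 \<le> ?S" by (intro sum_nonneg) auto
    then have "e / (?S + 1) > 0" using e by simp
    then obtain K where K: "compactin T K" "L2.nrm (f - cut K f) < e / (?S + 1)" using compact_support_approx[OF f] by blast
    note Km = compactin_sets[OF K(1)]
    have cL: "cut K f \<in> L2_fun M" and cn: "L2.nrm (cut K f) \<le> L2.nrm f" using cut_L2[OF Km f] by auto
    have "L2.nrm (lcomb F c f - lcomb F c (cut K f)) = L2.nrm (lcomb F c (f - cut K f))"
      using L2.adjoint_diff[OF lcomb_adjoint[OF F(1) FG] f cL]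
      by (intro L2.eqv_nrm) (auto intro: L2.eqv_sym simp: lcomb_L2 FG f cL L2.diff_mem)
    also have "\<dots> \<le> ?S * L2.nrm (f - cut K f)" by (intro lcomb_bound FG L2.diff_mem f cL)
    also have "\<dots> \<le> (?S + 1) * (e / (?S + 1))"
      using K(2) S f cL by (intro mult_mono) (auto simp: L2.diff_mem)
    also have "\<dots> = e"
    proof -
      have "?S + 1 \<noteq> 0" using S by linarith
      then show ?thesis by simp
    qed
    finally have 1: "L2.nrm (lcomb F c f - lcomb F c (cut K f)) \<le> e" .
    have "L2.nrm (lcomb F c (cut K f)) \<le> D * L2.nrm (cut K f)"
      by (rule compact[OF cL K(1)]) (simp add: cut_def)
    also have "\<dots> \<le> D * L2.nrm f" using cn D by (intro mult_left_mono) auto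
    finally show ?thesis
      using 1 L2.nrm_triangle[of "lcomb F c f - lcomb F c (cut K f)" "lcomb F c (cut K f)"]
      by (simp add: lcomb_L2 FG f cL L2.diff_mem)
  qed
  then show ?thesis by (rule field_le_epsilon)
qed

text \<open>With c the conjugate of u on F and s the \<ell>^2 norm of u on F, the bound in the
  discrete group transfers to G and, paired with u, gives s^2 \<le> max C 1 * s times the norm of u.
  Cancelling s finishes; \<open>max C 1\<close> keeps the operator bound strictly positive, as
  division by it requires.\<close>

lemma leinert_restriction_square_summable:
  assumes H: "discrete_subgroup G T H" and E: "leinert_set (G\<lparr>carrier := H\<rparr>) E"
  obtains C where "0 \<le> C"
    "\<And>u F. u \<in> fourier_algebra G M \<Longrightarrow> finite F \<Longrightarrow> F \<subseteq> E \<Longrightarrow> (\<Sum>x\<in>F. (cmod (u x))\<^sup>2) \<le> (C * fourier_norm G M u)\<^sup>2"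
proof -
  have sub: "subgroup H G" using H by (simp add: discrete_subgroup_def)
  have HG: "H \<subseteq> carrier G" using sub by (rule subgroup.subset)
  have EH: "E \<subseteq> H" using E by (simp add: leinert_set_def)
  have grpH: "group (G\<lparr>carrier := H\<rparr>)" using sub by (rule subgroup_imp_group)
  interpret LH: left_invariant_measure "G\<lparr>carrier := H\<rparr>" "count_space H"
    using count_space_left_invariant[OF grpH] by simp
  obtain C where C: "0 \<le> C" "\<And>u F. u \<in> fourier_algebra (G\<lparr>carrier := H\<rparr>) (count_space H) \<Longrightarrow> finite F \<Longrightarrow> F \<subseteq> E \<Longrightarrow>
      (\<Sum>x\<in>F. (cmod (u x))\<^sup>2) \<le> (C * fourier_norm (G\<lparr>carrier := H\<rparr>) (count_space H) u)\<^sup>2"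
    using leinert_set_restriction_bound[OF grpH E] by auto
  show thesis
  proof (rule that[of "max C 1"])
    fix u F assume u: "u \<in> fourier_algebra G M" and F: "finite F" "F \<subseteq> E"
    define s where "s = sqrt (\<Sum>x\<in>F. (cmod (u x))\<^sup>2)"
    have s0: "0 \<le> s" and s2: "s\<^sup>2 = (\<Sum>x\<in>F. (cmod (u x))\<^sup>2)" by (auto simp: s_def sum_nonneg)
    have "s \<le> max C 1 * fourier_norm G M u"
    proof (cases "s = 0")
      case True
      then show ?thesis using fourier_norm_nonneg[OF u] by simp
    next
      case False
      then have s: "s > 0" using s0 by simp
      let ?c = "\<lambda>x. cnj (u x)"
      have D: "0 < max C 1 * s" using s by simp
      have "L2.nrm (lcomb F ?c f) \<le> max C 1 * s * L2.nrm f" if f: "f \<in> L2_fun M" for f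
      proof (rule lcomb_bound_transfer[OF H F(1) _ D _ f])
        show "F \<subseteq> H" using F EH by blast
        fix \<xi> assume \<xi>: "\<xi> \<in> L2_fun (count_space H)"
        have FH: "F \<subseteq> H" using F EH by blast
        have "LH.L2.nrm (LH.lcomb F ?c \<xi>) \<le> C * sqrt (\<Sum>x\<in>F. (cmod (?c x))\<^sup>2) * LH.L2.nrm \<xi>"
          using C F EH \<xi> by (intro LH.lcomb_bound_of_coefficients[of C E]) auto
        also have "\<dots> \<le> max C 1 * s * LH.L2.nrm \<xi>"
        proof (rule mult_right_mono[OF _ LH.L2.nrm_nonneg[OF \<xi>]])
          have "C * s \<le> max C 1 * s" using s0 by (intro mult_right_mono) auto
          then show "C * sqrt (\<Sum>x\<in>F. (cmod (?c x))\<^sup>2) \<le> max C 1 * s" by (simp add: s_def)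
        qed
        finally show "L2_norm (count_space H) (\<lambda>h. \<Sum>x\<in>F. ?c x * left_regular (G\<lparr>carrier := H\<rparr>) x \<xi> h)
            \<le> max C 1 * s * L2_norm (count_space H) \<xi>"
          using LH.L2_norm_nrm[OF \<xi>] LH.L2_norm_nrm[OF LH.lcomb_L2[of F \<xi> ?c]] FH \<xi> by (simp add: LH.lcomb_def)
      qed
      then have "cmod (\<Sum>x\<in>F. ?c x * u x) \<le> max C 1 * s * fourier_norm G M u"
        using F EH HG by (intro fourier_norm_dual_bound u D) auto
      moreover have "(\<Sum>x\<in>F. ?c x * u x) = of_real (s\<^sup>2)"
        unfolding s2 by (simp add: complex_norm_square mult.commute del: of_real_power)
      ultimately have "s * s \<le> s * (max C 1 * fourier_norm G M u)"
        by (simp add: power2_eq_square mult_ac norm_mult)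
      then show ?thesis using s by simp
    qed
    then show "(\<Sum>x\<in>F. (cmod (u x))\<^sup>2) \<le> (max C 1 * fourier_norm G M u)\<^sup>2"
      unfolding s2[symmetric] using s0 by (intro power_mono)
  qed simp
qed

section \<open>The extension operator and the projection\<close>

text \<open>The function \<Sum> v h 1_(h U). For disjoint translates the sum at each y has at most
  one term, so no convergence is involved.\<close>

definition step :: "'a set \<Rightarrow> 'a set \<Rightarrow> ('a \<Rightarrow> complex) \<Rightarrow> 'a \<Rightarrow> complex" where
  "step H U v y = (\<Sum>h\<in>{h \<in> H. y \<in> h <# U}. v h)"

lemma step_eq:
  assumes H: "subgroup H G" and U: "U \<subseteq> carrier G"
    and disj: "\<And>h. h \<in> H \<Longrightarrow> h \<noteq> \<one> \<Longrightarrow> (h <# U) \<inter> U = {}"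
    and h: "h \<in> H" "y \<in> h <# U"
  shows "step H U v y = v h"
proof -
  have HG: "H \<subseteq> carrier G" using H by (rule subgroup.subset)
  have "h' = h" if h': "h' \<in> H" "y \<in> h' <# U" for h'
  proof -
    obtain a b where ab: "a \<in> U" "y = h \<otimes> a" "b \<in> U" "y = h' \<otimes> b" using h h' by (auto simp: l_coset_def)
    have G: "a \<in> carrier G" "b \<in> carrier G" "h \<in> carrier G" "h' \<in> carrier G" using ab U h h' HG by auto
    have "(inv h' \<otimes> h) \<otimes> a = inv h' \<otimes> (h' \<otimes> b)" using ab G by (simp add: m_assoc)
    also have "\<dots> = b" using G by (simp add: m_assoc[symmetric])
    finally have "b \<in> ((inv h' \<otimes> h) <# U) \<inter> U" using ab by (auto simp: l_coset_def)
    moreover have "inv h' \<otimes> h \<in> H" using H h h' by (simp add: subgroup.m_closed subgroup.m_inv_closed)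
    ultimately have "inv h' \<otimes> h = \<one>" using disj by blast
    then show ?thesis using G by (metis inv_equality inv_inv inv_closed)
  qed
  then have "{h' \<in> H. y \<in> h' <# U} = {h}" using h by blast
  then show ?thesis by (simp add: step_def)
qed

lemma step_L2:
  assumes H: "subgroup H G" and U: "U \<in> sets M" "emeasure M U < \<infinity>"
    and disj: "\<And>h. h \<in> H \<Longrightarrow> h \<noteq> \<one> \<Longrightarrow> (h <# U) \<inter> U = {}"
    and B: "0 \<le> B" "\<And>F. finite F \<Longrightarrow> F \<subseteq> H \<Longrightarrow> (\<Sum>h\<in>F. (cmod (v h))\<^sup>2) \<le> B"
  shows "step H U v \<in> L2_fun M" "(L2.nrm (step H U v))\<^sup>2 \<le> B * measure M U"
proof -
  have HG: "H \<subseteq> carrier G" using H by (rule subgroup.subset)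
  have UG: "U \<subseteq> carrier G" using sets.sets_into_space[OF U(1)] by (simp add: space_M)
  have hU: "h <# U \<in> sets M" if "h \<in> H" for h using HG U that by (intro l_coset_sets) auto
  \<comment> \<open>H may be uncountable, but v is square summable and hence has countable support
    J; measurability and the interchange of sum and integral are obtained over J.\<close>
  define J where "J = {h \<in> H. v h \<noteq> 0}"
  have J: "countable J"
  proof -
    have "(\<lambda>h. (cmod (v h))\<^sup>2) summable_on H"
      using B(2) by (intro nonneg_bdd_above_summable_on bdd_aboveI[of _ B]) auto
    then have "countable {h \<in> H. (cmod (v h))\<^sup>2 \<noteq> 0}" by (rule summable_countable_real)
    then show ?thesis by (simp add: J_def)
  qed
  note st = step_eq[OF H UG disj]
  have st0: "step H U v y = 0" if "y \<notin> (\<Union>h\<in>J. h <# U)" for y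
    unfolding step_def using that by (intro sum.neutral) (auto simp: J_def)
  have [measurable]: "step H U v \<in> borel_measurable M"
  proof (rule borel_measurableI)
    fix S :: "complex set" assume "open S"
    define A where "A = (\<Union>h\<in>{h \<in> J. v h \<in> S}. h <# U)"
    define A' where "A' = (\<Union>h\<in>J. h <# U)"
    have "countable {h \<in> J. v h \<in> S}" by (rule countable_subset[OF _ J]) auto
    moreover have "h <# U \<in> sets M" if "h \<in> J" for h using hU that by (simp add: J_def)
    ultimately have Am: "A \<in> sets M" "A' \<in> sets M"
      unfolding A_def A'_def using J by (auto intro!: sets.countable_UN')
    have Asp: "A \<subseteq> space M" using sets.sets_into_space[OF Am(1)] .
    have "step H U v -` S \<inter> space M = A \<union> (if 0 \<in> S then space M - A' else {})"
    proof (intro equalityI subsetI)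
      fix y assume y: "y \<in> step H U v -` S \<inter> space M"
      show "y \<in> A \<union> (if 0 \<in> S then space M - A' else {})"
      proof (cases "y \<in> A'")
        case True
        then obtain h where h: "h \<in> J" "y \<in> h <# U" by (auto simp: A'_def)
        then have "step H U v y = v h" by (intro st) (auto simp: J_def)
        then show ?thesis using y h by (auto simp: A_def)
      next
        case False
        then show ?thesis using st0[of y] y by (auto simp: A'_def)
      qed
    next
      fix y assume y: "y \<in> A \<union> (if 0 \<in> S then space M - A' else {})"
      show "y \<in> step H U v -` S \<inter> space M"
      proof (cases "y \<in> A")
        case True
        then obtain h where h: "h \<in> J" "v h \<in> S" "y \<in> h <# U" by (auto simp: A_def)
        then have "step H U v y = v h" by (intro st) (auto simp: J_def)
        then show ?thesis using h True Asp by auto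
      next
        case False
        then have "0 \<in> S" "y \<in> space M" "y \<notin> A'" using y by (auto split: if_splits)
        then show ?thesis using st0[of y] by (simp add: A'_def)
      qed
    qed
    then show "step H U v -` S \<inter> space M \<in> sets M" using Am by auto
  qed
  have emU: "emeasure M U = ennreal (measure M U)" using U by (simp add: emeasure_eq_ennreal_measure)
  have "(\<integral>\<^sup>+y. ennreal ((cmod (step H U v y))\<^sup>2) \<partial>M)
      \<le> (\<integral>\<^sup>+y. (\<integral>\<^sup>+h. ennreal ((cmod (v h))\<^sup>2) * indicator (h <# U) y \<partial>count_space J) \<partial>M)"
  proof (rule nn_integral_mono)
    fix y
    show "ennreal ((cmod (step H U v y))\<^sup>2) \<le> (\<integral>\<^sup>+h. ennreal ((cmod (v h))\<^sup>2) * indicator (h <# U) y \<partial>count_space J)"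
    proof (cases "y \<in> (\<Union>h\<in>J. h <# U)")
      case True
      then obtain h where h: "h \<in> J" "y \<in> h <# U" by auto
      then have "step H U v y = v h" by (intro st) (auto simp: J_def)
      then have "ennreal ((cmod (step H U v y))\<^sup>2) = (\<integral>\<^sup>+h'. ennreal ((cmod (v h))\<^sup>2) * indicator {h} h' \<partial>count_space J)"
        using h by (subst nn_integral_cmult_indicator) auto
      also have "\<dots> \<le> (\<integral>\<^sup>+h. ennreal ((cmod (v h))\<^sup>2) * indicator (h <# U) y \<partial>count_space J)"
        using h by (intro nn_integral_mono) (auto simp: indicator_def)
      finally show ?thesis .
    qed (simp add: st0)
  qed
  also have "\<dots> = (\<integral>\<^sup>+h. (\<integral>\<^sup>+y. ennreal ((cmod (v h))\<^sup>2) * indicator (h <# U) y \<partial>M) \<partial>count_space J)"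
    using hU by (intro nn_integral_count_space_swap J) (auto simp: J_def)
  also have "\<dots> = (\<integral>\<^sup>+h. emeasure M U * ennreal ((cmod (v h))\<^sup>2) \<partial>count_space J)"
  proof (rule nn_integral_cong)
    fix h assume "h \<in> space (count_space J)"
    then have h: "h \<in> H" by (simp add: J_def)
    then show "(\<integral>\<^sup>+y. ennreal ((cmod (v h))\<^sup>2) * indicator (h <# U) y \<partial>M) = emeasure M U * ennreal ((cmod (v h))\<^sup>2)"
      using hU[OF h] HG U(1) by (subst nn_integral_cmult_indicator) (auto simp: l_coset_emeasure mult.commute subset_iff)
  qed
  also have "\<dots> = emeasure M U * (\<integral>\<^sup>+h. ennreal ((cmod (v h))\<^sup>2) \<partial>count_space J)" by (simp add: nn_integral_cmult)
  also have "\<dots> \<le> emeasure M U * ennreal B"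
  proof (rule mult_left_mono[OF nn_integral_count_space_le[OF J]])
    fix F assume F: "finite F" "F \<subseteq> J"
    then have "(\<Sum>h\<in>F. (cmod (v h))\<^sup>2) \<le> B" by (intro B) (auto simp: J_def)
    then show "(\<Sum>h\<in>F. ennreal ((cmod (v h))\<^sup>2)) \<le> ennreal B" by (simp add: sum_ennreal ennreal_leI)
  qed simp
  also have "\<dots> = ennreal (B * measure M U)" using B by (simp add: emU ennreal_mult[symmetric] mult.commute)
  finally have le: "(\<integral>\<^sup>+y. ennreal ((cmod (step H U v y))\<^sup>2) \<partial>M) \<le> ennreal (B * measure M U)" .
  then show L: "step H U v \<in> L2_fun M" by (simp add: L2_fun_iff_nn le_less_trans)
  show "(L2.nrm (step H U v))\<^sup>2 \<le> B * measure M U"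
    using le B unfolding nn_L2[OF L] L2.nrm_sq[OF L, symmetric] by (simp add: ennreal_le_iff)
qed

lemma vanishing_ideal_complemented:
  assumes H: "discrete_subgroup G T H" and E: "leinert_set (G\<lparr>carrier := H\<rparr>) E"
  shows "\<exists>P. bounded_clinear_between (fourier_algebra G M) (fourier_norm G M)
               (vanishing_ideal G M E) (fourier_norm G M) P
           \<and> P ` fourier_algebra G M = vanishing_ideal G M E
           \<and> (\<forall>u\<in>fourier_algebra G M. P (P u) = P u)"
proof -
  have sub: "subgroup H G" using H by (simp add: discrete_subgroup_def)
  have HG: "H \<subseteq> carrier G" using sub by (rule subgroup.subset)
  have EH: "E \<subseteq> H" using E by (simp add: leinert_set_def)
  obtain C where C: "0 \<le> C" "\<And>u F. u \<in> fourier_algebra G M \<Longrightarrow> finite F \<Longrightarrow> F \<subseteq> E \<Longrightarrow>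
      (\<Sum>x\<in>F. (cmod (u x))\<^sup>2) \<le> (C * fourier_norm G M u)\<^sup>2"
    using leinert_restriction_square_summable[OF H E] by blast
  obtain U Q where U: "openin T U" "\<one> \<in> U" and Q: "compactin T Q" "U \<subseteq> Q"
    and disj: "\<And>h. h \<in> H \<Longrightarrow> h \<noteq> \<one> \<Longrightarrow> (h <# U) \<inter> U = {}"
    using discrete_subgroup_nbhd[OF H] by metis
  have UG: "U \<subseteq> carrier G" by (rule openin_subset_carrier[OF U(1)])
  have Um: "U \<in> sets M" by (rule openin_sets[OF U(1)])
  have Uf: "emeasure M U < \<infinity>"
    using emeasure_mono[OF Q(2) compactin_sets[OF Q(1)]] compactin_finite[OF Q(1)] by (rule le_less_trans)
  define \<mu> where "\<mu> = measure M U"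
  have \<mu>: "\<mu> > 0"
    using open_emeasure_pos[OF U] Uf unfolding \<mu>_def measure_def by (simp add: enn2real_positive_iff)
  \<comment> \<open>The minus sign is placed in k, so that u minus its extension is a sum of two
    coefficients, in the form of \<open>fourier_algebra_add\<close>.\<close>
  define k :: "'a \<Rightarrow> complex" where "k = - indicator U"
  have kL: "k \<in> L2_fun M" and kn: "L2.nrm k = sqrt \<mu>"
    using indicator_L2[OF Um Uf] by (auto simp: k_def \<mu>_def L2.neg_mem L2.nrm_neg real_sqrt_unique)
  \<comment> \<open>Division by \<mu> compensates the measure of h U. The conjugate offsets
    conjugate linearity of the inner product in its second argument, so that the coefficient is
    linear in v.\<close>
  define w where "w v = (\<lambda>y. of_real (1 / \<mu>) * cnj (step H U v y))" for v
  have wL: "w v \<in> L2_fun M" and wn: "L2.nrm w' \<le> sqrt (B / \<mu>)"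
    if B: "0 \<le> B" "\<And>F. finite F \<Longrightarrow> F \<subseteq> H \<Longrightarrow> (\<Sum>h\<in>F. (cmod (v h))\<^sup>2) \<le> B" and w': "w' = w v" for v B w'
  proof -
    note S = step_L2[OF sub Um Uf disj B]
    have cm: "(\<lambda>y. cnj (step H U v y)) \<in> borel_measurable M" using L2_funD(1)[OF S(1)] by measurable
    note c = L2_mono[OF S(1) cm]
    show "w v \<in> L2_fun M" unfolding w_def using c(1) by (intro L2.sc_mem) auto
    have "L2.nrm (w v) = 1 / \<mu> * L2.nrm (\<lambda>y. cnj (step H U v y))"
      unfolding w_def using \<mu> c(1) by (subst L2.nrm_sc) (auto simp: norm_divide)
    also have "\<dots> \<le> 1 / \<mu> * sqrt (B * \<mu>)"
    proof (rule mult_left_mono)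
      have "L2.nrm (step H U v) \<le> sqrt (B * \<mu>)" using S by (intro real_le_rsqrt) (simp add: \<mu>_def)
      then show "L2.nrm (\<lambda>y. cnj (step H U v y)) \<le> sqrt (B * \<mu>)" using c(2) by simp
    qed (use \<mu> in simp)
    also have "\<dots> = sqrt (B / \<mu>)" using \<mu> by (simp add: real_sqrt_mult real_sqrt_divide field_simps)
    finally show "L2.nrm w' \<le> sqrt (B / \<mu>)" using w' by simp
  qed
  define r where "r u = zero_extension E u" for u
  define P where "P u = (\<lambda>x. u x + matrix_coefficient G M k (w (r u)) x)" for u
  have rB: "(\<Sum>h\<in>F. (cmod (r u h))\<^sup>2) \<le> (C * fourier_norm G M u)\<^sup>2"
    if u: "u \<in> fourier_algebra G M" and F: "finite F" for u F
  proof -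
    have "(\<Sum>h\<in>F. (cmod (r u h))\<^sup>2) = (\<Sum>h\<in>F \<inter> E. (cmod (u h))\<^sup>2)"
      using F by (intro sum.mono_neutral_cong_right) (auto simp: r_def zero_extension_def)
    then show ?thesis using C(2)[OF u, of "F \<inter> E"] F by simp
  qed
  have wrL: "w (r u) \<in> L2_fun M" and wrn: "L2.nrm (w (r u)) \<le> sqrt ((C * fourier_norm G M u)\<^sup>2 / \<mu>)"
    if "u \<in> fourier_algebra G M" for u
    using wL[of "(C * fourier_norm G M u)\<^sup>2" "r u" "w (r u)"] wn[of "(C * fourier_norm G M u)\<^sup>2" "r u" "w (r u)"]
      rB[OF that] by auto
  \<comment> \<open>Translating U by h selects the value v h of the step function. This holds at
    every point of H, in particular on E, where v is the restriction of u.\<close>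
  have coef: "matrix_coefficient G M k (w v) h = - v h" if h: "h \<in> H" for v h
  proof -
    have hG: "h \<in> carrier G" using h HG by blast
    have hU: "h <# U \<in> sets M" "emeasure M (h <# U) = emeasure M U"
      using hG Um by (auto intro: l_coset_sets simp: l_coset_emeasure)
    have "L2_inner M (lreg h k) (w v) = (\<integral>y. complex_of_real (indicator (h <# U) y) * (- v h / \<mu>) \<partial>M)"
      unfolding L2_inner_def
    proof (rule Bochner_Integration.integral_cong[OF refl])
      fix y assume "y \<in> space M"
      then have y: "y \<in> carrier G" by (simp add: space_M)
      have "lreg h k y = - indicator (h <# U) y"
        using lreg_indicator[OF hG UG y] by (simp add: k_def left_regular_def)
      then show "lreg h k y * cnj (w v y) = complex_of_real (indicator (h <# U) y) * (- v h / \<mu>)"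
        using step_eq[OF sub UG disj h, of y v] by (cases "y \<in> h <# U") (auto simp: w_def)
    qed
    also have "\<dots> = complex_of_real (measure M (h <# U)) * (- v h / \<mu>)"
      using sets.sets_into_space[OF hU(1)]
      unfolding integral_mult_left_zero integral_complex_of_real by (simp add: Int_absorb2)
    also have "measure M (h <# U) = \<mu>" using hU(2) by (simp add: \<mu>_def measure_def)
    also have "complex_of_real \<mu> * (- v h / \<mu>) = - v h" using \<mu> by simp
    finally show ?thesis using hG by (simp add: matrix_coefficient_apply)
  qed
  have P_mem: "P u \<in> vanishing_ideal G M E" if u: "u \<in> fourier_algebra G M" for u
  proof -
    obtain f g where fg: "f \<in> L2_fun M" "g \<in> L2_fun M" "u = matrix_coefficient G M f g" using fourier_algebraE[OF u] .
    have "P u \<in> fourier_algebra G M"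
      unfolding P_def using fourier_algebra_add[OF fg(1,2) kL wrL[OF u] Q(1)] Q(2)
      by (force simp: fg(3)[symmetric] k_def indicator_def)
    moreover have "P u x = 0" if x: "x \<in> E" for x
      using coef[of x "r u"] x EH by (auto simp: P_def r_def zero_extension_def)
    ultimately show ?thesis by (simp add: vanishing_ideal_def)
  qed
  \<comment> \<open>The correction depends on u only through its restriction to E, which is zero
    here. Idempotence and surjectivity of P both follow from this.\<close>
  have P_id: "P u = u" if u: "u \<in> vanishing_ideal G M E" for u
  proof -
    have "r u = (\<lambda>x. 0)" using u by (auto simp: r_def zero_extension_def vanishing_ideal_def)
    then have "w (r u) = (\<lambda>x. 0)" by (simp add: w_def step_def)
    then show ?thesis by (simp add: P_def matrix_coefficient_def zero_extension_def L2_zero)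
  qed
  have P_lin: "P (\<lambda>x. a * u x + b * v x) = (\<lambda>x. a * P u x + b * P v x)"
    if uv: "u \<in> fourier_algebra G M" "v \<in> fourier_algebra G M" for u v a b
  proof
    fix x
    have "w (r (\<lambda>x. a * u x + b * v x)) = (\<lambda>y. cnj a * w (r u) y) + (\<lambda>y. cnj b * w (r v) y)"
    proof
      fix y
      have "step H U (r (\<lambda>x. a * u x + b * v x)) y = a * step H U (r u) y + b * step H U (r v) y"
        unfolding step_def sum_distrib_left sum.distrib[symmetric]
        by (intro sum.cong) (auto simp: r_def zero_extension_def)
      then show "w (r (\<lambda>x. a * u x + b * v x)) y = ((\<lambda>y. cnj a * w (r u) y) + (\<lambda>y. cnj b * w (r v) y)) y"
        by (simp add: w_def algebra_simps add_divide_distrib)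
    qed
    moreover have "L2_inner M (lreg x k) ((\<lambda>y. cnj a * w (r u) y) + (\<lambda>y. cnj b * w (r v) y))
        = a * L2_inner M (lreg x k) (w (r u)) + b * L2_inner M (lreg x k) (w (r v))" if "x \<in> carrier G"
      using that kL wrL uv by (simp add: L2.ip_add2 L2.ip_sc2 L2.sc_mem lreg_L2)
    ultimately show "P (\<lambda>x. a * u x + b * v x) x = a * P u x + b * P v x"
      by (cases "x \<in> carrier G")
        (simp_all add: P_def matrix_coefficient_apply algebra_simps, simp add: matrix_coefficient_def zero_extension_def)
  qed
  \<comment> \<open>The norm sqrt \<mu> of k cancels the factor 1 / sqrt \<mu> in the norm of w (r
    u), so the correction has norm at most C times that of u, and P is bounded by 1 + C.\<close>
  have P_bd: "fourier_norm G M (P u) \<le> (1 + C) * fourier_norm G M u" if u: "u \<in> fourier_algebra G M" for u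
  proof -
    have m: "matrix_coefficient G M k (w (r u)) \<in> fourier_algebra G M"
      using kL wrL[OF u] by (auto simp: fourier_algebra_def)
    have "fourier_norm G M (matrix_coefficient G M k (w (r u))) \<le> L2.nrm k * L2.nrm (w (r u))"
      by (intro fourier_norm_coefficient_le kL wrL u)
    also have "\<dots> \<le> sqrt \<mu> * sqrt ((C * fourier_norm G M u)\<^sup>2 / \<mu>)"
      unfolding kn using wrn[OF u] \<mu> by (intro mult_left_mono) auto
    also have "\<dots> = C * fourier_norm G M u"
      using \<mu> C(1) fourier_norm_nonneg[OF u] by (simp add: real_sqrt_divide)
    finally have "fourier_norm G M (matrix_coefficient G M k (w (r u))) \<le> C * fourier_norm G M u" .
    moreover have "P u \<in> fourier_algebra G M" using P_mem[OF u] by (simp add: vanishing_ideal_def)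
    then have "fourier_norm G M (P u) \<le> fourier_norm G M u + fourier_norm G M (matrix_coefficient G M k (w (r u)))"
      unfolding P_def by (intro fourier_norm_add_le u m)
    ultimately show ?thesis by (simp add: algebra_simps)
  qed
  show ?thesis
  proof (intro exI[of _ P] conjI ballI)
    show "bounded_clinear_between (fourier_algebra G M) (fourier_norm G M) (vanishing_ideal G M E) (fourier_norm G M) P"
      unfolding bounded_clinear_between_def using P_mem P_lin P_bd by blast
    show "P ` fourier_algebra G M = vanishing_ideal G M E"
    proof (intro equalityI subsetI)
      fix u assume "u \<in> vanishing_ideal G M E"
      then have "u = P u" "u \<in> fourier_algebra G M" using P_id by (auto simp: vanishing_ideal_def)
      then show "u \<in> P ` fourier_algebra G M" by blast
    qed (use P_mem in blast)
    show "P (P u) = P u" if "u \<in> fourier_algebra G M" for u using P_id P_mem that by blast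
  qed
qed

end

theorem theorem3p17:
  fixes G :: "('a, 'm) monoid_scheme" and T :: "'a topology" and \<mu> :: "'a measure"
    and H E :: "'a set"
  assumes "locally_compact_group G T"
    and "left_haar_measure G T \<mu>"
    and "discrete_subgroup G T H"
    and "leinert_set (G\<lparr>carrier := H\<rparr>) E"
  shows "\<exists>P. bounded_clinear_between
               (fourier_algebra G \<mu>) (fourier_norm G \<mu>)
               (vanishing_ideal G \<mu> E) (fourier_norm G \<mu>) P
           \<and> P ` fourier_algebra G \<mu> = vanishing_ideal G \<mu> E
           \<and> (\<forall>u\<in>fourier_algebra G \<mu>. P (P u) = P u)"
proof -
  interpret haar_group G T \<mu>
    using assms(1,2) by (simp add: haar_group_def haar_group_axioms_def)
  show ?thesis using assms(3,4) by (rule vanishing_ideal_complemented)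
qed

end
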